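(* Let $\alpha\in(\frac12,1)$. For all $\beta>0$, $h_c(\beta)>h_c^a(\beta)$.
   Context: Let $\tau=(\tau_n)_{n\ge 0}$ be a recurrent renewal process with $\tau_0=0$ and law $P$ (expectation $E$), i.e. the increments $T_k=\tau_k-\tau_{k-1}$, $k\ge1$, are i.i.d. with values in $\{1,2,\ldots\}$ and $$K(n)=P(\tau_1=n)=L(n)\,n^{-(1+\alpha)},\qquad \sum_{n\ge1}K(n)=1,$$ where $L$ is a (positive) slowly varying function. Write $\delta_n=\mathbf 1_{\{n\in\tau\}}$. Independently of $\tau$, let $\omega=(\omega_n)_{n\in\mathbb Z}$ be a stationary Gaussian process with law $\mathbb P$ (expectation $\mathbb E$), mean $0$ and variance $1$, and correlations $\rho_n=\operatorname{Cov}(\omega_0,\omega_n)$. Assume finite range correlations: there is an integer $q\ge1$ such that $\rho_n=0$ for all $n>q$. For $\beta\ge0$, $h\in\mathbb R$, $n\ge1$, set $H_n=\sum_{k=1}^n(\beta\omega_k+h)\delta_k$, $Z_{n,\beta,h,\omega}=E(\exp(H_n)\delta_n)$ (quenched partition function) and $Z^a_{n,\beta,h}=\mathbb E Z_{n,\beta,h,\omega}$ (annealed partition function). The quenched and annealed free energies are $$F(\beta,h)=\lim_{n\to\infty}\frac1n\log Z_{n,\beta,h,\omega}\ge 0,\qquad F^a(\beta,h)=\lim_{n\to\infty}\frac1n\log Z^a_{n,\beta,h}\ge 0,$$ where the first limit is $\mathbb P$-almost sure and in $L^1(\mathbb P)$ (these limits are known to exist and $F$ is nonrandom). The quenched and annealed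 critical points are $h_c(\beta)=\sup\{h\in\mathbb R:F(\beta,h)=0\}$ and $h_c^a(\beta)=\sup\{h\in\mathbb R:F^a(\beta,h)=0\}$. *)

theory Defs
  imports "HOL-Probability.Probability"
begin

definition slowly_varying :: "(real \<Rightarrow> real) \<Rightarrow> bool" where
  "slowly_varying L \<longleftrightarrow>
     set_borel_measurable borel {0<..} L \<and>
     (\<forall>x>0. L x > 0) \<and>
     (\<forall>c>0. ((\<lambda>x. L (c * x) / L x) \<longlongrightarrow> 1) at_top)"

text \<open>The value of \<open>K\<close> at \<open>0\<close> plays no role: the increments take values in \<open>{1, 2, \<dots>}\<close>.\<close>

locale recurrent_renewal_process = prob_space P
  for P :: "'a measure" +
  fixes \<tau> :: "nat \<Rightarrow> 'a \<Rightarrow> nat" and K :: "nat \<Rightarrow> real"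
  assumes tau_measurable: "\<And>k. \<tau> k \<in> measurable P (count_space UNIV)"
    and tau_0: "\<And>t. t \<in> space P \<Longrightarrow> \<tau> 0 t = 0"
    and tau_increasing: "\<And>k t. t \<in> space P \<Longrightarrow> \<tau> k t < \<tau> (Suc k) t"
    and increments_indep:
      "indep_vars (\<lambda>_. count_space UNIV) (\<lambda>k t. \<tau> (Suc k) t - \<tau> k t) UNIV"
    and increments_law:
      "\<And>k n. n \<ge> 1 \<Longrightarrow> prob {t \<in> space P. \<tau> (Suc k) t - \<tau> k t = n} = K n"
    and recurrent: "(\<lambda>n. K (Suc n)) sums 1"

text \<open>A one-dimensional Gaussian law may be degenerate (a point mass); this is needed because
  nontrivial linear combinations of jointly Gaussian variables can be constant.\<close>

definition gaussian_variable :: "'b measure \<Rightarrow> ('b \<Rightarrow> real) \<Rightarrow> bool" where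
  "gaussian_variable M X \<longleftrightarrow>
     X \<in> borel_measurable M \<and>
     (\<exists>m. (AE x in M. X x = m) \<or>
       (\<exists>\<sigma>>0. distributed M lborel X (\<lambda>y. ennreal (normal_density m \<sigma> y))))"

definition covariance :: "'b measure \<Rightarrow> ('b \<Rightarrow> real) \<Rightarrow> ('b \<Rightarrow> real) \<Rightarrow> real" where
  "covariance M X Y =
     (LINT x|M. (X x - (LINT y|M. X y)) * (Y x - (LINT y|M. Y y)))"

locale stationary_gaussian_process = prob_space M
  for M :: "'b measure" +
  fixes \<omega> :: "int \<Rightarrow> 'b \<Rightarrow> real"
  assumes omega_measurable: "\<And>n. \<omega> n \<in> borel_measurable M"
    and gaussian: "\<And>I c. finite I \<Longrightarrow> gaussian_variable M (\<lambda>x. \<Sum>i\<in>I. c i * \<omega> i x)"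
    and stationary:
      "\<And>m. distr M (PiM UNIV (\<lambda>_. borel)) (\<lambda>x n. \<omega> (n + m) x)
          = distr M (PiM UNIV (\<lambda>_. borel)) (\<lambda>x n. \<omega> n x)"

definition renewal_indicator :: "(nat \<Rightarrow> 'a \<Rightarrow> nat) \<Rightarrow> nat \<Rightarrow> 'a \<Rightarrow> real" where
  "renewal_indicator \<tau> n t = of_bool (n \<in> range (\<lambda>k. \<tau> k t))"

definition hamiltonian ::
    "(nat \<Rightarrow> 'a \<Rightarrow> nat) \<Rightarrow> real \<Rightarrow> real \<Rightarrow> (int \<Rightarrow> real) \<Rightarrow> nat \<Rightarrow> 'a \<Rightarrow> real" where
  "hamiltonian \<tau> \<beta> h w n t =
     (\<Sum>k=1..n. (\<beta> * w (int k) + h) * renewal_indicator \<tau> k t)"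

text \<open>The independence of renewal process and disorder is built in: they live on separate
  spaces \<open>P\<close> and \<open>M\<close>, i.e. on the product space, and the quenched partition function
  integrates over \<open>P\<close> only, for a fixed disorder sequence \<open>w\<close>.\<close>

definition quenched_Z ::
    "'a measure \<Rightarrow> (nat \<Rightarrow> 'a \<Rightarrow> nat) \<Rightarrow> real \<Rightarrow> real \<Rightarrow> (int \<Rightarrow> real) \<Rightarrow> nat \<Rightarrow> real" where
  "quenched_Z P \<tau> \<beta> h w n =
     (LINT t|P. exp (hamiltonian \<tau> \<beta> h w n t) * renewal_indicator \<tau> n t)"

definition annealed_Z ::
    "'a measure \<Rightarrow> (nat \<Rightarrow> 'a \<Rightarrow> nat) \<Rightarrow> 'b measure \<Rightarrow> (int \<Rightarrow> 'b \<Rightarrow> real) \<Rightarrow>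
      real \<Rightarrow> real \<Rightarrow> nat \<Rightarrow> real" where
  "annealed_Z P \<tau> M \<omega> \<beta> h n = (LINT x|M. quenched_Z P \<tau> \<beta> h (\<lambda>k. \<omega> k x) n)"

text \<open>The free energies are given as relations, \<open>F\<close> being the (unique) limit: almost surely
  and in \<open>L\<^sup>1\<close> in the quenched case.\<close>

definition has_quenched_free_energy ::
    "'a measure \<Rightarrow> (nat \<Rightarrow> 'a \<Rightarrow> nat) \<Rightarrow> 'b measure \<Rightarrow> (int \<Rightarrow> 'b \<Rightarrow> real) \<Rightarrow>
      real \<Rightarrow> real \<Rightarrow> real \<Rightarrow> bool" where
  "has_quenched_free_energy P \<tau> M \<omega> \<beta> h F \<longleftrightarrow>
     (let X = (\<lambda>n x. ln (quenched_Z P \<tau> \<beta> h (\<lambda>k. \<omega> k x) n) / real n) in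
       (AE x in M. (\<lambda>n. X n x) \<longlonglongrightarrow> F) \<and>
       (\<forall>n\<ge>1. integrable M (X n)) \<and>
       (\<lambda>n. LINT x|M. \<bar>X n x - F\<bar>) \<longlonglongrightarrow> 0)"

definition has_annealed_free_energy ::
    "'a measure \<Rightarrow> (nat \<Rightarrow> 'a \<Rightarrow> nat) \<Rightarrow> 'b measure \<Rightarrow> (int \<Rightarrow> 'b \<Rightarrow> real) \<Rightarrow>
      real \<Rightarrow> real \<Rightarrow> real \<Rightarrow> bool" where
  "has_annealed_free_energy P \<tau> M \<omega> \<beta> h F \<longleftrightarrow>
     (\<lambda>n. ln (annealed_Z P \<tau> M \<omega> \<beta> h n) / real n) \<longlonglongrightarrow> F"

definition quenched_critical_point ::
    "'a measure \<Rightarrow> (nat \<Rightarrow> 'a \<Rightarrow> nat) \<Rightarrow> 'b measure \<Rightarrow> (int \<Rightarrow> 'b \<Rightarrow> real) \<Rightarrow> real \<Rightarrow> real" where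
  "quenched_critical_point P \<tau> M \<omega> \<beta> = Sup {h. has_quenched_free_energy P \<tau> M \<omega> \<beta> h 0}"

definition annealed_critical_point ::
    "'a measure \<Rightarrow> (nat \<Rightarrow> 'a \<Rightarrow> nat) \<Rightarrow> 'b measure \<Rightarrow> (int \<Rightarrow> 'b \<Rightarrow> real) \<Rightarrow> real \<Rightarrow> real" where
  "annealed_critical_point P \<tau> M \<omega> \<beta> = Sup {h. has_annealed_free_energy P \<tau> M \<omega> \<beta> h 0}"

end

theory Submission
  imports Defs
begin

text \<open>
  Averaging over the disorder turns it into an interaction between renewal points: for a path
  with point set \<open>S\<close> the average of \<open>exp (\<Sum>i\<in>S. \<beta> \<omega>\<^sub>i)\<close> is \<open>exp (\<beta>\<^sup>2/2 \<Sum>i,j\<in>S. \<rho> (j - i))\<close>.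
  The annealed partition function is therefore a sum over paths (lists of positive gaps) of
  explicit weights. Correlations have finite range, so cutting a path in two changes its weight by
  at most a constant factor (\<open>weight_append\<close>). This almost-multiplicativity replaces the exact
  renewal structure of the annealed model with independent disorder.

  If the annealed free energy vanishes at \<open>h\<close>, then the paths with exactly \<open>b\<close> long gaps that end
  with a long gap have total weight at most a constant, uniformly in \<open>b\<close>: a larger total would,
  by concatenating such paths, make the partition functions grow exponentially. The bound
  passes to the annealed critical point \<open>h\<^sub>a\<close> (\<open>renewal_mass_le_Sup\<close>). Hence, at \<open>h\<^sub>a\<close>,
  discounting every long gap by a factor \<open>t < 1\<close> leaves a total weight of order \<open>1 / (1 - t)\<close>
  (\<open>discounted_weight_le\<close>).

  The quenched free energy vanishes at \<open>h\<close> as soon as the fractional moments \<open>E Z\<^sub>N\<^sup>\<gamma>\<close> are bounded in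
  \<open>N\<close> for one \<open>\<gamma> \<in> (0,1)\<close>; this is shown for \<open>\<gamma> = n/(n+1)\<close> near \<open>1\<close> and some \<open>h > h\<^sub>a\<close>. By Hoelder's
  inequality \<open>Z\<close> may be multiplied by a random weight \<open>\<Omega>\<close> at the price of a moment of \<open>1/\<Omega>\<close>. The
  weight is a product over sites \<open>j\<close> of \<open>(1 + \<lambda> cosh \<omega>\<^sub>j)\<close> to the power \<open>-1/(q+1)\<close>. It costs a factor
  \<open>exp (O(\<lambda>\<^sup>2))\<close> per site. Its gain comes from the sites where a path shifts the disorder: under the
  measure with density proportional to \<open>exp (\<Sum>i\<in>S. \<beta> \<omega>\<^sub>i)\<close> the mean of \<open>\<omega>\<^sub>j\<close> becomes
  \<open>\<beta> \<Sum>i\<in>S. \<rho> (j - i)\<close>, and the mean of \<open>cosh \<omega>\<^sub>j\<close> is multiplied by the cosh of that number. If \<open>q\<close>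
  is the largest lag with \<open>\<rho> q \<noteq> 0\<close>, then at every point of \<open>S\<close> reached by a gap larger than \<open>2q\<close> the
  site at distance \<open>q\<close> to the left feels this single point only, and its mean is \<open>\<beta> \<rho> q \<noteq> 0\<close>. So each
  long gap is discounted by a factor \<open>1 - c \<lambda>\<close>. The penalty is an even function of \<open>\<omega>\<^sub>j\<close> because the
  responses at different sites may have opposite signs: shifting the mean of the disorder by a
  constant would gain nothing from a point of \<open>S\<close> when the correlations sum to zero.

  On stretches of length of order \<open>m\<close> the choice \<open>\<lambda> = m\<^sup>-\<^sup>1\<^sup>/\<^sup>2\<close> makes the cost bounded and the discounted
  annealed weight of order \<open>m\<^sup>1\<^sup>/\<^sup>2\<close>. Cutting a path at its last point before and its first point
  after level \<open>k\<close>, and repeating from there, bounds all fractional moments once a single sum over such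
  cuts is at most \<open>1\<close> (\<open>coarse_graining\<close>). Averaged over \<open>k \<in> (m, 2m]\<close>, this sum is a power of \<open>m\<close> whose
  exponent tends to \<open>1/2 - \<alpha>\<close> as \<open>\<gamma>\<close> tends to \<open>1\<close>: this is where \<open>\<alpha> > 1/2\<close> enters
  (\<open>bounded_fractional_moment\<close>). The average over \<open>k\<close> is taken because only the total discounted
  weight is controlled, not the weight at a given length.
  Raising \<open>h\<close> by \<open>1/k\<close> multiplies the weight of a stretch shorter than \<open>k\<close> by at most \<open>e\<close>, which
  leaves room above \<open>h\<^sub>a\<close>.
\<close>

section \<open>Slowly varying functions\<close>

text \<open>
  The uniform convergence theorem for slowly varying functions, in additive form. If it failed along
  points \<open>x\<^sub>N\<close> and shifts \<open>u\<^sub>N\<close>, then every \<open>v \<in> [1,2]\<close> would be a shift that moves \<open>f\<close> by at least \<open>e/2\<close>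
  either from \<open>x\<^sub>N\<close> or, after translation by \<open>u\<^sub>N\<close>, from \<open>x\<^sub>N + u\<^sub>N\<close>. Both sets of shifts have
  measure tending to \<open>0\<close> by dominated convergence, whereas \<open>[1,2]\<close> has measure \<open>1\<close>.
\<close>
lemma additive_slow_variation_uniform:
  fixes f :: "real \<Rightarrow> real"
  assumes meas: "f \<in> borel_measurable borel"
    and lim: "\<And>u. ((\<lambda>x. f (x + u) - f x) \<longlongrightarrow> 0) at_top"
    and e: "e > 0"
  shows "\<exists>X. \<forall>x\<ge>X. \<forall>u\<in>{0..1}. \<bar>f (x + u) - f x\<bar> \<le> e"
proof (rule ccontr)
  assume "\<not> ?thesis"
  then have "\<forall>N::nat. \<exists>x u. x \<ge> real N \<and> u \<in> {0..1} \<and> \<bar>f (x + u) - f x\<bar> > e"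
    by (metis not_le)
  then obtain x u where xu: "\<And>N::nat. x N \<ge> real N" "\<And>N. u N \<in> {0..1}"
      "\<And>N. \<bar>f (x N + u N) - f (x N)\<bar> > e"
    by metis
  have jump_set: "{v\<in>{0..2}. \<bar>f (a + v) - f a\<bar> \<ge> e / 2} \<in> sets lborel" for a
  proof -
    have "{v\<in>{0..2}. \<bar>f (a + v) - f a\<bar> \<ge> e / 2} = {v \<in> space borel. v \<in> {0..2} \<and> \<bar>f (a + v) - f a\<bar> \<ge> e / 2}"
      by auto
    also have "\<dots> \<in> sets borel" using meas by measurable
    finally show ?thesis by simp
  qed
  have bad: "(\<lambda>N. measure lborel {v\<in>{0..2}. \<bar>f (y N + v) - f (y N)\<bar> \<ge> e / 2}) \<longlonglongrightarrow> 0"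
    if y: "filterlim y at_top sequentially" for y :: "nat \<Rightarrow> real"
  proof -
    define B where "B N = {v\<in>{0..2}. \<bar>f (y N + v) - f (y N)\<bar> \<ge> e / 2}" for N
    have Bm: "B N \<in> sets lborel" for N unfolding B_def by (rule jump_set)
    have "(\<lambda>N. LINT v|lborel. indicator (B N) v :: real) \<longlonglongrightarrow> (LINT v|(lborel :: real measure). (0::real))"
    proof (rule integral_dominated_convergence[where w = "indicator {0..2}"])
      show "AE v in lborel. (\<lambda>N. indicator (B N) v :: real) \<longlonglongrightarrow> 0"
      proof (rule AE_I2)
        fix v :: real
        have "(\<lambda>N. f (y N + v) - f (y N)) \<longlonglongrightarrow> 0"
          using filterlim_compose[OF lim y] .
        then have "eventually (\<lambda>N. \<bar>f (y N + v) - f (y N)\<bar> < e / 2) sequentially"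
          using e by (auto dest!: tendstoD[where e = "e/2"] simp: dist_real_def)
        then have "eventually (\<lambda>N. indicator (B N) v = (0::real)) sequentially"
          by eventually_elim (auto simp: B_def indicator_def)
        then show "(\<lambda>N. indicator (B N) v :: real) \<longlonglongrightarrow> 0"
          by (rule tendsto_eventually)
      qed
      show "(\<lambda>v. indicator (B N) v :: real) \<in> borel_measurable lborel" for N
        using Bm[of N] by (intro borel_measurable_indicator)
      show "AE v in lborel. norm (indicator (B N) v :: real) \<le> indicator {0..2} v" for N
        by (intro AE_I2) (simp add: B_def indicator_def)
    qed auto
    moreover have "(LINT v|lborel. indicator (B N) v :: real) = measure lborel (B N)" for N
      using Bm by (simp add: lmeasurable_iff_integrable)
    ultimately show ?thesis by (simp add: B_def)
  qed
  define y where "y N = x N + u N" for N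
  define B1 where "B1 N = {v\<in>{0..2}. \<bar>f (x N + v) - f (x N)\<bar> \<ge> e / 2}" for N
  define B2 where "B2 N = {v\<in>{0..2}. \<bar>f (y N + v) - f (y N)\<bar> \<ge> e / 2}" for N
  have x: "filterlim x at_top sequentially"
    by (rule filterlim_at_top_mono[OF filterlim_real_sequentially]) (use xu in auto)
  have yt: "filterlim y at_top sequentially"
    by (rule filterlim_at_top_mono[OF filterlim_real_sequentially])
      (use xu(1,2) in \<open>auto simp: y_def intro!: always_eventually add_increasing2\<close>)
  have "(\<lambda>N. measure lborel (B1 N) + measure lborel (B2 N)) \<longlonglongrightarrow> 0 + 0"
    unfolding B1_def B2_def by (intro tendsto_add bad x yt)
  then have "eventually (\<lambda>N. measure lborel (B1 N) + measure lborel (B2 N) < 1) sequentially"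
    by (rule order_tendstoD) simp
  then obtain N where N: "measure lborel (B1 N) + measure lborel (B2 N) < 1"
    by (auto simp: eventually_sequentially)
  have B1s: "B1 N \<in> sets lborel" and B2s: "B2 N \<in> sets lborel"
    unfolding B1_def B2_def by (rule jump_set)+
  have fin: "A \<in> fmeasurable lebesgue" if "A \<in> sets lborel" "A \<subseteq> {0..2}" for A :: "real set"
    by (rule fmeasurableI2[OF lmeasurable_cbox[of 0 2]]) (use that in auto)
  have F1: "B1 N \<in> fmeasurable lebesgue" by (rule fin[OF B1s]) (auto simp: B1_def)
  have F2: "B2 N \<in> fmeasurable lebesgue" by (rule fin[OF B2s]) (auto simp: B2_def)
  have img: "(+) (u N) ` B2 N \<in> fmeasurable lebesgue \<and>
      measure lebesgue ((+) (u N) ` B2 N) = measure lborel (B2 N)"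
    using F2 B2s by (simp add: measurable_translation measure_translation)
  have sub: "{1..2} \<subseteq> B1 N \<union> (+) (u N) ` B2 N"
  proof
    fix v :: real assume v: "v \<in> {1..2}"
    show "v \<in> B1 N \<union> (+) (u N) ` B2 N"
    proof (rule ccontr)
      assume "v \<notin> B1 N \<union> (+) (u N) ` B2 N"
      then have "v \<notin> B1 N" and n2: "v - u N \<notin> B2 N"
        by (auto simp: image_iff)
      have "\<bar>f (x N + v) - f (x N)\<bar> < e / 2" using \<open>v \<notin> B1 N\<close> v by (auto simp: B1_def)
      moreover have "\<bar>f (x N + v) - f (x N + u N)\<bar> < e / 2"
        using n2 v xu(2)[of N] by (auto simp: B2_def y_def)
      ultimately show False using xu(3)[of N] by linarith
    qed
  qed
  have "1 = measure lebesgue {1..2::real}" by simp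
  also have "\<dots> \<le> measure lebesgue (B1 N \<union> (+) (u N) ` B2 N)"
    using sub img F1 by (intro measure_mono_fmeasurable) auto
  also have "\<dots> \<le> measure lebesgue (B1 N) + measure lebesgue ((+) (u N) ` B2 N)"
    using img F1 by (intro measure_Un_le) auto
  also have "\<dots> < 1" using N img B1s by simp
  finally show False by simp
qed

text \<open>
  The logarithm of \<open>L\<close>, read on the logarithmic scale, grows by at most \<open>e\<close> per unit step from some
  point on; the finitely many integers before that point are absorbed in the constant.
\<close>
lemma slowly_varying_le_powr:
  assumes "slowly_varying L" and e: "e > 0"
  obtains C where "C > 0" "\<And>n::nat. n \<ge> 1 \<Longrightarrow> L (real n) \<le> C * real n powr e"
proof -
  have Lp: "\<And>x. x > 0 \<Longrightarrow> L x > 0" using assms by (auto simp: slowly_varying_def)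
  define f where "f x = ln (L (exp x))" for x
  have meas: "f \<in> borel_measurable borel"
  proof -
    have "(\<lambda>x. indicator {0<..} x *\<^sub>R L x) \<in> borel_measurable borel"
      using assms(1) by (simp add: slowly_varying_def set_borel_measurable_def)
    then have "(\<lambda>x. ln (indicator {0<..} (exp x) *\<^sub>R L (exp x))) \<in> borel_measurable borel"
      by measurable
    then show ?thesis unfolding f_def by simp
  qed
  have lim: "((\<lambda>x. f (x + u) - f x) \<longlongrightarrow> 0) at_top" for u
  proof -
    have "((\<lambda>x. L (exp u * x) / L x) \<longlongrightarrow> 1) at_top" using assms(1) by (simp add: slowly_varying_def)
    then have "((\<lambda>x. L (exp u * exp x) / L (exp x)) \<longlongrightarrow> 1) at_top"
      using filterlim_compose[OF _ exp_at_top] by blast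
    then have "((\<lambda>x. ln (L (exp u * exp x) / L (exp x))) \<longlongrightarrow> ln 1) at_top"
      by (rule tendsto_ln) simp
    then show ?thesis using Lp by (simp add: f_def ln_div exp_add mult.commute less_imp_neq[OF Lp, symmetric])
  qed
  obtain X0 where X0: "\<And>x u. x \<ge> X0 \<Longrightarrow> u \<in> {0..1} \<Longrightarrow> \<bar>f (x + u) - f x\<bar> \<le> e"
    using additive_slow_variation_uniform[OF meas lim e] by blast
  define X where "X = max X0 0"
  have X: "\<bar>f (x + u) - f x\<bar> \<le> e" if "x \<ge> X" "u \<in> {0..1}" for x u
    using X0[of x u] that by (simp add: X_def)
  have step: "f (X + real i) \<le> f X + e * real i" for i
  proof (induction i)
    case (Suc i)
    have "\<bar>f (X + real i + 1) - f (X + real i)\<bar> \<le> e" by (rule X) auto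
    with Suc show ?case by (simp add: algebra_simps)
  qed simp
  have fX: "f x \<le> f X + e * (x - X) + e" if "x \<ge> X" for x
  proof -
    define i where "i = nat \<lfloor>x - X\<rfloor>"
    have i: "real i \<le> x - X" "x - X < real i + 1" using that by (auto simp: i_def)
    have "\<bar>f (X + real i + (x - X - real i)) - f (X + real i)\<bar> \<le> e"
      by (rule X) (use i in auto)
    then have "f x \<le> f (X + real i) + e" by simp
    also have "\<dots> \<le> f X + e * real i + e" using step[of i] by simp
    also have "\<dots> \<le> f X + e * (x - X) + e" using i e by (simp add: mult_left_mono)
    finally show ?thesis .
  qed
  define M where "M = Max (L ` real ` {1..nat \<lceil>exp X\<rceil>})"
  define C where "C = \<bar>M\<bar> + exp (f X + e)"
  show thesis
  proof (rule that[of C])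
    show "C > 0" unfolding C_def by (simp add: add_nonneg_pos)
    fix n :: nat assume n: "n \<ge> 1"
    then have one: "real n powr e \<ge> 1" using e by (simp add: ge_one_powr_ge_zero)
    show "L (real n) \<le> C * real n powr e"
    proof (cases "ln (real n) \<ge> X")
      case True
      have "0 \<le> e * X" using e by (simp add: X_def)
      have "L (real n) = exp (f (ln (real n)))" using n Lp by (simp add: f_def)
      also have "\<dots> \<le> exp (f X + e + e * ln (real n))"
        using fX[OF True] \<open>0 \<le> e * X\<close> by (simp add: algebra_simps)
      also have "\<dots> = exp (f X + e) * real n powr e" using n by (simp add: exp_add powr_def)
      also have "\<dots> \<le> C * real n powr e" by (intro mult_right_mono) (auto simp: C_def)
      finally show ?thesis .
    next
      case False
      then have "real n < exp X" using n by (metis exp_less_mono exp_ln not_le of_nat_0_less_iff less_le_trans zero_less_one)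
      then have "n \<in> {1..nat \<lceil>exp X\<rceil>}" using n by (auto simp: le_nat_iff) linarith
      then have "L (real n) \<le> M" unfolding M_def by (intro Max_ge) auto
      also have "\<dots> \<le> C" by (simp add: C_def add_increasing2)
      also have "\<dots> \<le> C * real n powr e" using one \<open>C > 0\<close> by (simp add: mult_le_cancel_left1)
      finally show ?thesis .
    qed
  qed
qed

lemma slowly_varying_inverse:
  assumes "slowly_varying L" shows "slowly_varying (\<lambda>x. 1 / L x)"
proof -
  have "((\<lambda>x. 1 / L (c * x) / (1 / L x)) \<longlongrightarrow> 1) at_top" if "c > 0" for c
  proof -
    have "((\<lambda>x. inverse (L (c * x) / L x)) \<longlongrightarrow> inverse 1) at_top"
      using assms that by (intro tendsto_inverse) (auto simp: slowly_varying_def)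
    then show ?thesis by (simp add: field_simps)
  qed
  moreover have "set_borel_measurable borel {0<..} (\<lambda>x. 1 / L x)"
  proof -
    have "(\<lambda>x. indicator {0<..} x *\<^sub>R L x) \<in> borel_measurable borel"
      using assms(1) by (simp add: slowly_varying_def set_borel_measurable_def)
    then have "(\<lambda>x. indicator {0<..} x * inverse (indicator {0<..} x *\<^sub>R L x)) \<in> borel_measurable borel"
      by measurable
    moreover have "(\<lambda>x. indicator {0<..} x * inverse (indicator {0<..} x *\<^sub>R L x))
        = (\<lambda>x. indicator {0<..} x *\<^sub>R (1 / L x))"
      by (auto simp: indicator_def field_simps)
    ultimately show ?thesis by (simp add: set_borel_measurable_def)
  qed
  ultimately show ?thesis using assms by (auto simp: slowly_varying_def)
qed

lemma slowly_varying_ge_powr: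
  assumes "slowly_varying L" and e: "e > 0"
  obtains c where "c > 0" "\<And>n::nat. n \<ge> 1 \<Longrightarrow> L (real n) \<ge> c * real n powr (-e)"
proof -
  obtain C where C: "C > 0" "\<And>n::nat. n \<ge> 1 \<Longrightarrow> 1 / L (real n) \<le> C * real n powr e"
    using slowly_varying_le_powr[OF slowly_varying_inverse[OF assms(1)] e] by blast
  show thesis
  proof (rule that[of "1 / C"])
    fix n :: nat assume n: "n \<ge> 1"
    have "L (real n) > 0" using assms n by (simp add: slowly_varying_def)
    then show "L (real n) \<ge> 1 / C * real n powr (-e)"
      using C(2)[OF n] C(1) n by (simp add: powr_minus field_simps)
  qed (use C in simp)
qed

section \<open>Renewal paths and the quenched partition function\<close>

text \<open>
  A path is the list of its gaps. Requiring positive gaps makes this a finite set.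
\<close>
definition compositions :: "nat \<Rightarrow> nat list set" where
  "compositions n = {xs. 0 \<notin> set xs \<and> sum_list xs = n}"

text \<open>
  The points of a path started at \<open>a\<close>, without the starting point itself, so that concatenating paths
  partitions the points.
\<close>
fun points :: "int \<Rightarrow> nat list \<Rightarrow> int set" where
  "points a [] = {}"
| "points a (x # xs) = insert (a + int x) (points (a + int x) xs)"

lemma length_le_sum_list_pos: "0 \<notin> set xs \<Longrightarrow> length xs \<le> sum_list (xs :: nat list)"
  by (induction xs) auto

lemma finite_compositions [simp, intro]: "finite (compositions n)"
proof (rule finite_subset)
  show "compositions n \<subseteq> {xs. set xs \<subseteq> {..n} \<and> length xs \<le> n}"
    using length_le_sum_list_pos by (auto simp: compositions_def dest: member_le_sum_list)
qed (rule finite_lists_length_le, simp)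

lemma compositions_0 [simp]: "compositions 0 = {[]}"
proof -
  have "xs = []" if "0 \<notin> set xs" "sum_list xs = 0" for xs :: "nat list"
    using that by (cases xs) auto
  then show ?thesis by (auto simp: compositions_def)
qed

lemma singleton_in_compositions: "n \<ge> 1 \<Longrightarrow> [n] \<in> compositions n"
  by (simp add: compositions_def)

lemma compositions_nonempty: "compositions n \<noteq> {}"
  using singleton_in_compositions[of n] compositions_0 by (cases n) auto

lemma finite_points [simp, intro]: "finite (points a xs)"
  by (induction xs arbitrary: a) auto

lemma points_append: "points a (xs @ ys) = points a xs \<union> points (a + int (sum_list xs)) ys"
  by (induction xs arbitrary: a) (auto simp: add.assoc)

lemma points_subset: "0 \<notin> set xs \<Longrightarrow> points a xs \<subseteq> {a<..a + int (sum_list xs)}"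
proof (induction xs arbitrary: a)
  case (Cons x xs)
  have "points (a + int x) xs \<subseteq> {a + int x<..a + int x + int (sum_list xs)}"
    using Cons by auto
  then show ?case using Cons.prems by force
qed simp

lemma points_translate: "points (a + b) xs = (+) a ` points b xs"
  by (induction xs arbitrary: b) (auto simp: add.assoc)

lemma card_points_eq: "0 \<notin> set xs \<Longrightarrow> card (points a xs) = length xs"
proof (induction xs arbitrary: a)
  case (Cons x xs)
  have "a + int x \<notin> points (a + int x) xs" using points_subset[of xs "a + int x"] Cons.prems by auto
  then show ?case using Cons by auto
qed simp

text \<open>
  A prefix of a path is determined by its length, because all gaps are positive.
\<close>
lemma append_eq_append_sum_list_eq:
  fixes xs xs' :: "nat list"
  assumes "xs @ ys = xs' @ ys'" "sum_list xs = sum_list xs'" "0 \<notin> set xs" "0 \<notin> set xs'"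
  shows "xs = xs' \<and> ys = ys'"
proof -
  have nil: "us = []" if "0 \<notin> set us" "sum_list us = 0" for us :: "nat list"
    using that by (cases us) auto
  obtain us where "xs = xs' @ us \<and> us @ ys = ys' \<or> xs @ us = xs' \<and> ys = us @ ys'"
    using assms(1) by (auto simp: append_eq_append_conv2)
  then have "us = []" using assms by (intro nil) auto
  with assms(1) \<open>_ \<or> _\<close> show ?thesis by auto
qed

context recurrent_renewal_process
begin

definition starts_with :: "nat list \<Rightarrow> 'a \<Rightarrow> bool" where
  "starts_with xs t \<longleftrightarrow> (\<forall>i<length xs. \<tau> (Suc i) t - \<tau> i t = xs ! i)"

lemma tau_mono: "t \<in> space P \<Longrightarrow> i < j \<Longrightarrow> \<tau> i t < \<tau> j t"
  by (rule lift_Suc_mono_less[of "\<lambda>k. \<tau> k t"]) (use tau_increasing in auto)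

lemma starts_with_sum:
  assumes "t \<in> space P" "starts_with xs t" "i \<le> length xs"
  shows "\<tau> i t = sum_list (take i xs)"
  using assms(3)
proof (induction i)
  case 0
  then show ?case using tau_0 assms by simp
next
  case (Suc i)
  have "\<tau> (Suc i) t - \<tau> i t = xs ! i" using assms(2) Suc.prems by (simp add: starts_with_def Suc_le_eq)
  moreover have "\<tau> i t < \<tau> (Suc i) t" using tau_increasing assms by auto
  ultimately show ?case using Suc by (simp add: take_Suc_conv_app_nth)
qed

lemma points_eq_image: "points a xs = (\<lambda>i. a + int (sum_list (take (Suc i) xs))) ` {..<length xs}"
proof (induction xs arbitrary: a)
  case (Cons x xs)
  have "(\<lambda>i. a + int (sum_list (take (Suc i) (x # xs)))) ` {..<length (x # xs)}
     = insert (a + int x) ((\<lambda>i. a + int x + int (sum_list (take (Suc i) xs))) ` {..<length xs})"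
    by (simp add: lessThan_Suc_eq_insert_0 image_image add.assoc)
  then show ?case using Cons by simp
qed simp

lemma starts_with_points:
  assumes t: "t \<in> space P" and xs: "starts_with xs t" and n: "sum_list xs = n" and i: "i \<ge> 1"
    and le: "i \<le> n"
  shows "i \<in> range (\<lambda>k. \<tau> k t) \<longleftrightarrow> int i \<in> points 0 xs"
proof -
  have last: "\<tau> (length xs) t = n" using starts_with_sum[OF t xs, of "length xs"] n by simp
  have "i \<in> range (\<lambda>k. \<tau> k t) \<longleftrightarrow> (\<exists>k<length xs. i = \<tau> (Suc k) t)"
  proof
    assume "i \<in> range (\<lambda>k. \<tau> k t)"
    then obtain k where k: "i = \<tau> k t" by auto
    then have "k \<noteq> 0" using i tau_0[OF t] by (metis not_one_le_zero)
    moreover have "k \<le> length xs"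
      using tau_mono[OF t, of "length xs" k] k le last by (meson not_le)
    ultimately show "\<exists>k<length xs. i = \<tau> (Suc k) t"
      using k by (intro exI[of _ "k - 1"]) auto
  qed auto
  also have "\<dots> \<longleftrightarrow> (\<exists>k<length xs. i = sum_list (take (Suc k) xs))"
    using starts_with_sum[OF t xs] by (metis Suc_leI)
  also have "\<dots> \<longleftrightarrow> int i \<in> points 0 xs" by (auto simp: points_eq_image)
  finally show ?thesis .
qed

lemma starts_with_unique:
  assumes t: "t \<in> space P" and "xs \<in> compositions n" "ys \<in> compositions n" "starts_with xs t" "starts_with ys t"
  shows "xs = ys"
proof -
  have *: "length xs \<le> length ys" if "xs \<in> compositions n" "ys \<in> compositions n" "starts_with xs t" "starts_with ys t" for xs ys
  proof (rule ccontr)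
    assume "\<not> ?thesis"
    then have "\<tau> (length ys) t < \<tau> (length xs) t" using tau_mono[OF t] by simp
    then show False using starts_with_sum[OF t] that by (simp add: compositions_def)
  qed
  have "length xs = length ys" using *[OF assms(2-5)] *[OF assms(3,2,5,4)] by simp
  then show ?thesis using assms(4,5) by (auto simp: starts_with_def intro!: nth_equalityI)
qed

text \<open>
  Together with \<open>starts_with_unique\<close>: the event that \<open>n\<close> is a renewal time is the disjoint union, over
  the paths of length \<open>n\<close>, of the events that the renewal process begins with that path.
\<close>
lemma starts_with_exists:
  assumes t: "t \<in> space P" and n: "n \<in> range (\<lambda>k. \<tau> k t)"
  shows "\<exists>xs\<in>compositions n. starts_with xs t"
proof -
  obtain k where k: "n = \<tau> k t" using n by auto
  define xs where "xs = map (\<lambda>i. \<tau> (Suc i) t - \<tau> i t) [0..<k]"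
  have sw: "starts_with xs t" by (auto simp: starts_with_def xs_def)
  moreover have "sum_list xs = n"
    using starts_with_sum[OF t sw, of k] k by (simp add: xs_def)
  moreover have "0 \<notin> set xs" using tau_increasing[OF t] by (auto simp: xs_def) (metis leD)
  ultimately show ?thesis by (auto simp: compositions_def)
qed

lemma starts_with_in_range:
  assumes t: "t \<in> space P" and "xs \<in> compositions n" "starts_with xs t"
  shows "n \<in> range (\<lambda>k. \<tau> k t)"
  using starts_with_sum[OF t assms(3), of "length xs"] assms(2) by (auto simp: compositions_def)

lemma starts_with_event: "{t \<in> space P. starts_with xs t} \<in> events"
  unfolding starts_with_def using tau_measurable by measurable

lemma prob_starts_with:
  assumes "0 \<notin> set xs"
  shows "prob {t \<in> space P. starts_with xs t} = prod_list (map K xs)"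
proof (cases "xs = []")
  case True
  then show ?thesis by (simp add: starts_with_def prob_space)
next
  case False
  have "prob (\<Inter>i\<in>{..<length xs}. (\<lambda>t. \<tau> (Suc i) t - \<tau> i t) -` {xs ! i} \<inter> space P)
      = (\<Prod>i\<in>{..<length xs}. prob ((\<lambda>t. \<tau> (Suc i) t - \<tau> i t) -` {xs ! i} \<inter> space P))"
    by (rule indep_varsD[OF increments_indep]) (use False in auto)
  moreover have "(\<Inter>i\<in>{..<length xs}. (\<lambda>t. \<tau> (Suc i) t - \<tau> i t) -` {xs ! i} \<inter> space P)
      = {t \<in> space P. starts_with xs t}"
    using False by (auto simp: starts_with_def)
  moreover have "prob ((\<lambda>t. \<tau> (Suc i) t - \<tau> i t) -` {xs ! i} \<inter> space P) = K (xs ! i)" if "i < length xs" for i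
  proof -
    have "xs ! i \<noteq> 0" using that assms by (metis nth_mem)
    then have "prob {t \<in> space P. \<tau> (Suc i) t - \<tau> i t = xs ! i} = K (xs ! i)"
      by (intro increments_law) auto
    moreover have "(\<lambda>t. \<tau> (Suc i) t - \<tau> i t) -` {xs ! i} \<inter> space P = {t \<in> space P. \<tau> (Suc i) t - \<tau> i t = xs ! i}"
      by auto
    ultimately show ?thesis by simp
  qed
  ultimately show ?thesis by (simp add: prod.list_conv_set_nth atLeast0LessThan)
qed

lemma quenched_Z_eq:
  "quenched_Z P \<tau> \<beta> h w n =
    (\<Sum>xs\<in>compositions n. prod_list (map K xs) * exp (\<Sum>i\<in>points 0 xs. \<beta> * w i + h))"
proof -
  define e where "e xs = exp (\<Sum>i\<in>points 0 xs. \<beta> * w i + h)" for xs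
  have pt: "exp (hamiltonian \<tau> \<beta> h w n t) * renewal_indicator \<tau> n t
     = (\<Sum>xs\<in>compositions n. e xs * indicator {t \<in> space P. starts_with xs t} t)" if t: "t \<in> space P" for t
  proof (cases "n \<in> range (\<lambda>k. \<tau> k t)")
    case False
    then have "\<not> starts_with xs t" if "xs \<in> compositions n" for xs
      using starts_with_in_range[OF t that] by blast
    then show ?thesis using False by (simp add: renewal_indicator_def)
  next
    case True
    obtain xs where xs: "xs \<in> compositions n" "starts_with xs t" using starts_with_exists[OF t True] by blast
    have "(\<Sum>ys\<in>compositions n. e ys * indicator {t \<in> space P. starts_with ys t} t) = (\<Sum>ys\<in>{xs}. e ys)"
    proof (rule sum.mono_neutral_cong_right)
      show "\<forall>ys\<in>compositions n - {xs}. e ys * indicator {t \<in> space P. starts_with ys t} t = 0"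
        using starts_with_unique[OF t _ xs(1) _ xs(2)] by (auto simp: indicator_def)
    qed (use xs t in auto)
    moreover have "hamiltonian \<tau> \<beta> h w n t = (\<Sum>i\<in>points 0 xs. \<beta> * w i + h)"
    proof -
      have sub: "points 0 xs \<subseteq> {0<..int n}" using points_subset[of xs 0] xs by (auto simp: compositions_def)
      have "hamiltonian \<tau> \<beta> h w n t = (\<Sum>k=1..n. (\<beta> * w (int k) + h) * of_bool (int k \<in> points 0 xs))"
        unfolding hamiltonian_def renewal_indicator_def
        using starts_with_points[OF t xs(2)] xs(1) by (intro sum.cong) (auto simp: compositions_def)
      also have "\<dots> = (\<Sum>k\<in>{k\<in>{1..n}. int k \<in> points 0 xs}. \<beta> * w (int k) + h)"
        by (rule sum.mono_neutral_cong_right) auto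
      also have "\<dots> = (\<Sum>i\<in>points 0 xs. \<beta> * w i + h)"
        by (rule sum.reindex_bij_witness[of _ nat int]) (use sub in force)+
      finally show ?thesis .
    qed
    ultimately show ?thesis using True by (simp add: renewal_indicator_def e_def)
  qed
  have "quenched_Z P \<tau> \<beta> h w n
      = (LINT t|P. (\<Sum>xs\<in>compositions n. e xs * indicator {t \<in> space P. starts_with xs t} t))"
    unfolding quenched_Z_def using pt by (intro Bochner_Integration.integral_cong) auto
  also have "\<dots> = (\<Sum>xs\<in>compositions n. e xs * prob {t \<in> space P. starts_with xs t})"
    using integrable_real_indicator[OF starts_with_event]
    by (subst Bochner_Integration.integral_sum) (auto simp: emeasure_eq_measure Int_absorb1 intro!: sum.cong arg_cong[where f=prob])
  also have "\<dots> = (\<Sum>xs\<in>compositions n. prod_list (map K xs) * exp (\<Sum>i\<in>points 0 xs. \<beta> * w i + h))"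
    by (intro sum.cong refl) (auto simp: e_def compositions_def prob_starts_with)
  finally show ?thesis .
qed

lemma sum_compositions_prod_le_1: "(\<Sum>xs\<in>compositions n. prod_list (map K xs)) \<le> 1"
proof -
  have "(\<Sum>xs\<in>compositions n. prod_list (map K xs)) = quenched_Z P \<tau> 0 0 (\<lambda>_. 0) n"
    by (simp add: quenched_Z_eq)
  also have "\<dots> \<le> (LINT t|P. 1)"
  proof -
    have "quenched_Z P \<tau> 0 0 (\<lambda>_. 0) n = prob {t \<in> space P. n \<in> range (\<lambda>k. \<tau> k t)}"
    proof -
      have "{t \<in> space P. n \<in> range (\<lambda>k. \<tau> k t)} = {t \<in> space P. \<exists>k. n = \<tau> k t}" by auto
      also have "\<dots> \<in> events" using tau_measurable by measurable
      finally have m: "{t \<in> space P. n \<in> range (\<lambda>k. \<tau> k t)} \<in> events" .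
      have "quenched_Z P \<tau> 0 0 (\<lambda>_. 0) n = (LINT t|P. indicator {t \<in> space P. n \<in> range (\<lambda>k. \<tau> k t)} t)"
        unfolding quenched_Z_def
        by (intro Bochner_Integration.integral_cong) (auto simp: hamiltonian_def renewal_indicator_def)
      then show ?thesis using m by (simp add: Int_absorb1)
    qed
    then show ?thesis by (simp add: prob_space)
  qed
  finally show ?thesis by (simp add: prob_space)
qed

end

section \<open>Exponential moments of the disorder\<close>

text \<open>
  Completing the square: an exponential tilt of a centred normal density is a shifted normal density.
\<close>
lemma normal_density_mult_exp:
  assumes "\<sigma> > 0"
  shows "exp y * normal_density 0 \<sigma> y = exp (\<sigma>\<^sup>2 / 2) * normal_density (\<sigma>\<^sup>2) \<sigma> y"
proof -
  have "y + - y\<^sup>2 / (2 * \<sigma>\<^sup>2) = \<sigma>\<^sup>2 / 2 + - (y - \<sigma>\<^sup>2)\<^sup>2 / (2 * \<sigma>\<^sup>2)"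
    using assms by (simp add: field_simps power2_eq_square)
  then have "exp y * exp (- y\<^sup>2 / (2 * \<sigma>\<^sup>2)) = exp (\<sigma>\<^sup>2 / 2) * exp (- (y - \<sigma>\<^sup>2)\<^sup>2 / (2 * \<sigma>\<^sup>2))"
    by (simp flip: exp_add)
  then show ?thesis by (simp add: normal_density_def)
qed

text \<open>
  The degenerate case of a constant variable is included; its constant is then \<open>0\<close>.
\<close>
lemma (in prob_space) centred_gaussian_exp:
  assumes g: "gaussian_variable M X" and mean: "expectation X = 0"
  shows "integrable M X" "integrable M (\<lambda>x. (X x)\<^sup>2)" "integrable M (\<lambda>x. exp (X x))"
    "expectation (\<lambda>x. exp (X x)) = exp (expectation (\<lambda>x. (X x)\<^sup>2) / 2)"
proof -
  have [measurable]: "X \<in> borel_measurable M" using g by (simp add: gaussian_variable_def)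
  have "integrable M X \<and> integrable M (\<lambda>x. (X x)\<^sup>2) \<and> integrable M (\<lambda>x. exp (X x)) \<and>
      expectation (\<lambda>x. exp (X x)) = exp (expectation (\<lambda>x. (X x)\<^sup>2) / 2)"
  proof -
    obtain m where "(AE x in M. X x = m) \<or>
        (\<exists>\<sigma>>0. distributed M lborel X (\<lambda>y. ennreal (normal_density m \<sigma> y)))"
      using g by (auto simp: gaussian_variable_def)
    then show ?thesis
    proof
      assume ae: "AE x in M. X x = m"
      have c: "integrable M f" "expectation f = c"
        if "f \<in> borel_measurable M" "AE x in M. f x = c" for f and c :: real
      proof -
        have "integrable M f \<longleftrightarrow> integrable M (\<lambda>_. c)"
          using that by (intro integrable_cong_AE) auto
        then show "integrable M f" by simp
        have "expectation f = expectation (\<lambda>_. c)"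
          using that by (intro integral_cong_AE) auto
        then show "expectation f = c" by (simp add: prob_space)
      qed
      have "expectation X = m" using c(2)[OF _ ae] by (simp add: prob_space)
      then have "m = 0" using mean by simp
      then have ae0: "AE x in M. X x = 0" using ae by simp
      have "AE x in M. (X x)\<^sup>2 = 0" "AE x in M. exp (X x) = 1" using ae0 by auto
      then show ?thesis using c[OF _ ae0] c[of "\<lambda>x. (X x)\<^sup>2" 0] c[of "\<lambda>x. exp (X x)" 1]
        by (simp add: prob_space)
    next
      assume "\<exists>\<sigma>>0. distributed M lborel X (\<lambda>y. ennreal (normal_density m \<sigma> y))"
      then obtain \<sigma> where s: "\<sigma> > 0"
        and D: "distributed M lborel X (\<lambda>y. ennreal (normal_density m \<sigma> y))" by blast
      have m: "m = 0" using normal_distributed_expectation[OF s D] mean by simp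
      note D = D[unfolded m]
      have var: "expectation (\<lambda>x. (X x)\<^sup>2) = \<sigma>\<^sup>2"
        using normal_distributed_variance[OF s D] mean by simp
      have "integrable lborel (\<lambda>y. exp (\<sigma>\<^sup>2 / 2) * normal_density (\<sigma>\<^sup>2) \<sigma> y)"
        using s by (intro integrable_mult_right) auto
      then have i1: "integrable lborel (\<lambda>y. normal_density 0 \<sigma> y * exp y)"
        using normal_density_mult_exp[OF s] by (simp add: mult.commute)
      have "expectation (\<lambda>x. exp (X x)) = (\<integral>y. normal_density 0 \<sigma> y * exp y \<partial>lborel)"
        by (rule distributed_integral[OF D, symmetric]) auto
      also have "\<dots> = (\<integral>y. exp (\<sigma>\<^sup>2 / 2) * normal_density (\<sigma>\<^sup>2) \<sigma> y \<partial>lborel)"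
        using normal_density_mult_exp[OF s] by (simp add: mult.commute)
      also have "\<dots> = exp (\<sigma>\<^sup>2 / 2)" using s by simp
      finally have e: "expectation (\<lambda>x. exp (X x)) = exp (\<sigma>\<^sup>2 / 2)" .
      have "integrable M (\<lambda>x. exp (X x))"
        using distributed_integrable[OF D, of exp] i1 by simp
      moreover have "integrable M X"
        using distributed_integrable[OF D, of "\<lambda>x. x"] integrable_normal_moment_nz_1[OF s, of 0] by simp
      moreover have "integrable M (\<lambda>x. (X x)\<^sup>2)"
        using distributed_integrable[OF D, of "\<lambda>x. x\<^sup>2"] integrable_normal_moment[OF s, of 0 2] by simp
      ultimately show ?thesis using e var by simp
    qed
  qed
  then show "integrable M X" "integrable M (\<lambda>x. (X x)\<^sup>2)" "integrable M (\<lambda>x. exp (X x))"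
    "expectation (\<lambda>x. exp (X x)) = exp (expectation (\<lambda>x. (X x)\<^sup>2) / 2)" by auto
qed

definition cov_form :: "(int \<Rightarrow> real) \<Rightarrow> int set \<Rightarrow> (int \<Rightarrow> real) \<Rightarrow> real" where
  "cov_form \<rho> I c = (\<Sum>i\<in>I. \<Sum>j\<in>I. c i * c j * \<rho> (j - i))"

text \<open>
  Linear combinations of the disorder enter only through their exponential moments: every expectation
  computed below is that of a polynomial in exponentials of the \<open>\<omega>\<^sub>n\<close>, and for these the formula
  expresses both decorrelation of distant variables and the shift caused by a Gaussian tilt. The number \<open>q\<close> is the largest
  lag with a nonzero correlation and may be \<open>0\<close>.
\<close>
locale gaussian_disorder = prob_space M for M :: "'b measure" +
  fixes \<omega> :: "int \<Rightarrow> 'b \<Rightarrow> real" and \<rho> :: "int \<Rightarrow> real" and q :: nat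
  assumes omega_meas [measurable]: "\<And>n. \<omega> n \<in> borel_measurable M"
    and exp_integrable: "\<And>I c. finite I \<Longrightarrow> integrable M (\<lambda>x. exp (\<Sum>i\<in>I. c i * \<omega> i x))"
    and exp_moment: "\<And>I c. finite I \<Longrightarrow>
        expectation (\<lambda>x. exp (\<Sum>i\<in>I. c i * \<omega> i x)) = exp (cov_form \<rho> I c / 2)"
    and omega_integrable: "\<And>n. integrable M (\<omega> n)"
    and omega_sq_integrable: "\<And>n. integrable M (\<lambda>x. (\<omega> n x)\<^sup>2)"
    and omega_mean: "\<And>n. expectation (\<omega> n) = 0"
    and omega_var: "\<And>n. expectation (\<lambda>x. (\<omega> n x)\<^sup>2) = 1"
    and rho_0: "\<rho> 0 = 1"
    and rho_sym: "\<And>n. \<rho> (- n) = \<rho> n"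
    and rho_le: "\<And>n. \<bar>\<rho> n\<bar> \<le> 1"
    and rho_range: "\<And>n. \<bar>n\<bar> > int q \<Longrightarrow> \<rho> n = 0"
    and rho_q: "\<rho> (int q) \<noteq> 0"

lemma (in stationary_gaussian_process) stationary_expectation:
  assumes f: "f \<in> borel_measurable (PiM UNIV (\<lambda>_. borel))"
  shows "expectation (\<lambda>x. f (\<lambda>n. \<omega> (n + m) x)) = expectation (\<lambda>x. f (\<lambda>n. \<omega> n x) :: real)"
proof -
  have m: "(\<lambda>x n. \<omega> (n + k) x) \<in> measurable M (PiM UNIV (\<lambda>_. borel))" for k
    by (rule measurable_PiM_single') (use omega_measurable in auto)
  have "expectation (\<lambda>x. f (\<lambda>n. \<omega> (n + k) x))
     = integral\<^sup>L (distr M (PiM UNIV (\<lambda>_. borel)) (\<lambda>x n. \<omega> (n + k) x)) f" for k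
    by (rule integral_distr[OF m f, symmetric])
  from this[of m] this[of 0] show ?thesis using stationary[of m] by simp
qed

theorem gaussian_disorderI:
  assumes sg: "stationary_gaussian_process M \<omega>"
    and mean0: "prob_space.expectation M (\<omega> 0) = 0"
    and var0: "prob_space.variance M (\<omega> 0) = 1"
    and range: "\<And>n::int. n > int q0 \<Longrightarrow> covariance M (\<omega> 0) (\<omega> n) = 0"
  obtains q where "gaussian_disorder M \<omega> (\<lambda>n. covariance M (\<omega> 0) (\<omega> n)) q"
proof -
  interpret stationary_gaussian_process M \<omega> by (rule sg)
  note [measurable] = omega_measurable
  have mean: "expectation (\<omega> n) = 0" for n
  proof -
    have "expectation (\<lambda>x. (\<lambda>f. f 0) (\<lambda>k. \<omega> (k + n) x)) = expectation (\<lambda>x. (\<lambda>f. f 0) (\<lambda>k. \<omega> k x))"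
      by (rule stationary_expectation) measurable
    then show ?thesis using mean0 by simp
  qed
  have gv: "gaussian_variable M (\<omega> n)" for n
    using gaussian[of "{n}" "\<lambda>_. 1"] by simp
  note single = centred_gaussian_exp[OF gv mean]
  have cov2: "integrable M (\<lambda>x. \<omega> i x * \<omega> j x)" for i j
  proof (rule Bochner_Integration.integrable_bound)
    show "integrable M (\<lambda>x. (\<omega> i x)\<^sup>2 + (\<omega> j x)\<^sup>2)" using single by auto
    show "AE x in M. norm (\<omega> i x * \<omega> j x) \<le> norm ((\<omega> i x)\<^sup>2 + (\<omega> j x)\<^sup>2)"
    proof (rule AE_I2)
      fix x
      have "2 * (\<bar>\<omega> i x\<bar> * \<bar>\<omega> j x\<bar>) \<le> (\<omega> i x)\<^sup>2 + (\<omega> j x)\<^sup>2"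
        using sum_squares_bound[of "\<bar>\<omega> i x\<bar>" "\<bar>\<omega> j x\<bar>"] by simp
      moreover have "0 \<le> \<bar>\<omega> i x\<bar> * \<bar>\<omega> j x\<bar>" by simp
      ultimately have "\<bar>\<omega> i x\<bar> * \<bar>\<omega> j x\<bar> \<le> (\<omega> i x)\<^sup>2 + (\<omega> j x)\<^sup>2"
        by linarith
      then show "norm (\<omega> i x * \<omega> j x) \<le> norm ((\<omega> i x)\<^sup>2 + (\<omega> j x)\<^sup>2)"
        by (simp add: abs_mult)
    qed
  qed simp
  define \<rho> where "\<rho> n = covariance M (\<omega> 0) (\<omega> n)" for n
  have rho: "\<rho> n = expectation (\<lambda>x. \<omega> 0 x * \<omega> n x)" for n
    by (simp add: \<rho>_def covariance_def mean)
  have prod: "expectation (\<lambda>x. \<omega> i x * \<omega> j x) = \<rho> (j - i)" for i j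
  proof -
    have "expectation (\<lambda>x. (\<lambda>f. f 0 * f (j - i)) (\<lambda>k. \<omega> (k + i) x))
        = expectation (\<lambda>x. (\<lambda>f. f 0 * f (j - i)) (\<lambda>k. \<omega> k x))"
      by (rule stationary_expectation) measurable
    then show ?thesis using rho by simp
  qed
  have rho0: "\<rho> 0 = 1"
    using var0 mean[of 0] by (simp add: rho power2_eq_square)
  have sym: "\<rho> (- n) = \<rho> n" for n
    using prod[of n 0] prod[of 0 n] by (simp add: mult.commute)
  have le: "\<bar>\<rho> n\<bar> \<le> 1" for n
  proof -
    have "0 \<le> expectation (\<lambda>x. (\<omega> 0 x + s * \<omega> n x)\<^sup>2)" for s by (intro integral_nonneg_AE) auto
    moreover have "expectation (\<lambda>x. (\<omega> 0 x + s * \<omega> n x)\<^sup>2) = 1 + 2 * s * \<rho> n + s * s" for s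
    proof -
      have "expectation (\<lambda>x. (\<omega> 0 x + s * \<omega> n x)\<^sup>2)
         = expectation (\<lambda>x. \<omega> 0 x * \<omega> 0 x + (2 * s) * (\<omega> 0 x * \<omega> n x) + (s * s) * (\<omega> n x * \<omega> n x))"
        by (simp add: power2_eq_square algebra_simps)
      also have "\<dots> = 1 + 2 * s * \<rho> n + s * s"
        using cov2 by (simp add: prod rho0)
      finally show ?thesis .
    qed
    ultimately have *: "0 \<le> 1 + 2 * s * \<rho> n + s * s" for s by metis
    from *[of 1] *[of "-1"] show ?thesis by simp
  qed
  have range': "\<rho> n = 0" if "\<bar>n\<bar> > int q0" for n
    using range[of n] range[of "- n"] sym[of n] that by (cases "n \<ge> 0") (auto simp: \<rho>_def)
  define q where "q = Max {k. k \<le> q0 \<and> \<rho> (int k) \<noteq> 0}"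
  have fin: "finite {k. k \<le> q0 \<and> \<rho> (int k) \<noteq> 0}" by simp
  have ne: "0 \<in> {k. k \<le> q0 \<and> \<rho> (int k) \<noteq> 0}" using rho0 by simp
  have q: "q \<in> {k. k \<le> q0 \<and> \<rho> (int k) \<noteq> 0}" unfolding q_def using fin ne by (intro Max_in) auto
  have rangeq: "\<rho> n = 0" if "\<bar>n\<bar> > int q" for n
  proof (rule ccontr)
    assume "\<rho> n \<noteq> 0"
    then have "\<rho> (int (nat \<bar>n\<bar>)) \<noteq> 0" using sym[of n] by (cases "n \<ge> 0") auto
    moreover have "nat \<bar>n\<bar> \<le> q0" using range'[of n] \<open>\<rho> n \<noteq> 0\<close> by linarith
    ultimately have "nat \<bar>n\<bar> \<le> q" unfolding q_def using fin by (intro Max_ge) auto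
    then show False using that by linarith
  qed
  have gd: "integrable M (\<lambda>x. exp (\<Sum>i\<in>I. c i * \<omega> i x)) \<and>
     expectation (\<lambda>x. exp (\<Sum>i\<in>I. c i * \<omega> i x)) = exp (cov_form \<rho> I c / 2)" if I: "finite I" for I c
  proof -
    have m: "expectation (\<lambda>x. \<Sum>i\<in>I. c i * \<omega> i x) = 0"
      using single(1) mean by (simp add: Bochner_Integration.integral_sum)
    have "expectation (\<lambda>x. (\<Sum>i\<in>I. c i * \<omega> i x)\<^sup>2)
       = expectation (\<lambda>x. \<Sum>i\<in>I. \<Sum>j\<in>I. c i * c j * (\<omega> i x * \<omega> j x))"
      by (simp add: power2_eq_square sum_product mult_ac)
    also have "\<dots> = cov_form \<rho> I c"
      using cov2 by (simp add: Bochner_Integration.integral_sum prod cov_form_def)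
    finally show ?thesis using centred_gaussian_exp[OF gaussian[OF I] m] by simp
  qed
  have "gaussian_disorder M \<omega> \<rho> q"
    by unfold_locales
      (use gd single(1,2) mean rho0 sym le rangeq q prod in \<open>auto simp: power2_eq_square\<close>)
  moreover have "\<rho> = (\<lambda>n. covariance M (\<omega> 0) (\<omega> n))" by (simp add: \<rho>_def fun_eq_iff)
  ultimately show thesis using that by simp
qed

text \<open>
  After normalising each factor by its expectation this is the weighted inequality between geometric and
  arithmetic means, which is concavity of the logarithm, integrated.
\<close>
lemma (in prob_space) holder_prod:
  fixes X :: "'i \<Rightarrow> 'a \<Rightarrow> real"
  assumes fin: "finite I" and w: "\<And>i. i \<in> I \<Longrightarrow> w i \<ge> 0" "(\<Sum>i\<in>I. w i) = 1"
    and pos: "\<And>i x. i \<in> I \<Longrightarrow> x \<in> space M \<Longrightarrow> X i x > 0"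
    and int: "\<And>i. i \<in> I \<Longrightarrow> integrable M (X i)"
  shows "integrable M (\<lambda>x. \<Prod>i\<in>I. X i x powr w i)"
    and "expectation (\<lambda>x. \<Prod>i\<in>I. X i x powr w i) \<le> (\<Prod>i\<in>I. expectation (X i) powr w i)"
proof -
  define y where "y i = expectation (X i)" for i
  have y: "y i > 0" if "i \<in> I" for i
  proof -
    have "y i \<ge> 0" unfolding y_def using pos[OF that] by (intro integral_nonneg_AE) (auto intro: AE_I2 less_imp_le)
    moreover have "y i \<noteq> 0"
    proof
      assume "y i = 0"
      then have "AE x in M. X i x = 0"
        unfolding y_def using int[OF that] pos[OF that]
        by (subst (asm) integral_nonneg_eq_0_iff_AE) (auto intro: AE_I2 less_imp_le)
      then have "AE x in M. False" using AE_space by eventually_elim (use pos[OF that] in force)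
      then show False using AE_False by (simp add: prob_space)
    qed
    ultimately show ?thesis by simp
  qed
  have pw: "(\<Prod>i\<in>I. X i x powr w i) \<le> (\<Prod>i\<in>I. y i powr w i) * (\<Sum>i\<in>I. w i * (X i x / y i))"
    if x: "x \<in> space M" for x
  proof -
    have "(\<Sum>i\<in>I. w i * ln (X i x / y i)) \<le> ln (\<Sum>i\<in>I. w i * (X i x / y i))"
    proof -
      have "concave_on {0<..} (ln :: real \<Rightarrow> real)" by (rule ln_concave)
      moreover have "I \<noteq> {}" using w(2) by auto
      ultimately have "ln (\<Sum>i\<in>I. w i *\<^sub>R (X i x / y i)) \<ge> (\<Sum>i\<in>I. w i * ln (X i x / y i))"
        using fin w y pos[OF _ x] by (intro concave_on_sum[where C = "{0<..}"]) auto
      then show ?thesis by simp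
    qed
    moreover have "(\<Sum>i\<in>I. w i * (X i x / y i)) > 0"
    proof -
      obtain i where i: "i \<in> I" "w i > 0" using w by (metis less_eq_real_def sum.neutral zero_neq_one)
      have "w i * (X i x / y i) > 0" using i y pos[OF _ x] by simp
      moreover have "w j * (X j x / y j) \<ge> 0" if "j \<in> I" for j
        using that y[OF that] pos[OF that x] w(1)[OF that] by simp
      ultimately show ?thesis using fin i by (intro sum_pos2[of _ i]) auto
    qed
    ultimately have "exp (\<Sum>i\<in>I. w i * ln (X i x / y i)) \<le> (\<Sum>i\<in>I. w i * (X i x / y i))"
      by (metis exp_le_cancel_iff exp_ln)
    moreover have "(\<Prod>i\<in>I. X i x powr w i) = (\<Prod>i\<in>I. y i powr w i) * exp (\<Sum>i\<in>I. w i * ln (X i x / y i))"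
      unfolding exp_sum[OF fin] prod.distrib[symmetric]
    proof (rule prod.cong)
      fix i assume i: "i \<in> I"
      have "exp (w i * ln (X i x / y i)) = (X i x / y i) powr w i"
        using y[OF i] pos[OF i x] by (simp add: powr_def)
      then show "X i x powr w i = y i powr w i * exp (w i * ln (X i x / y i))"
        using y[OF i] pos[OF i x] by (simp add: powr_divide)
    qed simp
    moreover have "0 \<le> (\<Prod>i\<in>I. y i powr w i)" by (intro prod_nonneg) auto
    ultimately show ?thesis by (simp add: mult_left_mono)
  qed
  have int2: "integrable M (\<lambda>x. (\<Prod>i\<in>I. y i powr w i) * (\<Sum>i\<in>I. w i * (X i x / y i)))"
    using int by auto
  have meas: "(\<lambda>x. \<Prod>i\<in>I. X i x powr w i) \<in> borel_measurable M"
    using int by (intro borel_measurable_prod powr_real_measurable) auto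
  have nn: "0 \<le> (\<Prod>i\<in>I. X i x powr w i)" for x by (intro prod_nonneg) auto
  show 1: "integrable M (\<lambda>x. \<Prod>i\<in>I. X i x powr w i)"
  proof (rule Bochner_Integration.integrable_bound[OF int2 meas], rule AE_I2)
    fix x assume "x \<in> space M"
    from pw[OF this] nn[of x]
    show "norm (\<Prod>i\<in>I. X i x powr w i) \<le> norm ((\<Prod>i\<in>I. y i powr w i) * (\<Sum>i\<in>I. w i * (X i x / y i)))"
      by simp
  qed
  have "expectation (\<lambda>x. \<Prod>i\<in>I. X i x powr w i)
     \<le> expectation (\<lambda>x. (\<Prod>i\<in>I. y i powr w i) * (\<Sum>i\<in>I. w i * (X i x / y i)))"
    by (rule integral_mono[OF 1 int2 pw])
  also have "\<dots> = (\<Prod>i\<in>I. y i powr w i) * (\<Sum>i\<in>I. w i * (expectation (X i) / y i))"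
    using int by (simp add: Bochner_Integration.integral_sum)
  also have "(\<Sum>i\<in>I. w i * (expectation (X i) / y i)) = (\<Sum>i\<in>I. w i)"
    using y by (intro sum.cong) (auto simp: y_def less_imp_neq[symmetric])
  finally show "expectation (\<lambda>x. \<Prod>i\<in>I. X i x powr w i) \<le> (\<Prod>i\<in>I. expectation (X i) powr w i)"
    using w by (simp add: y_def)
qed

section \<open>Tilting by a path and penalising the sites\<close>

context gaussian_disorder
begin

text \<open>
  The mean of \<open>\<omega>\<^sub>j\<close> under the measure with density proportional to \<open>exp (\<Sum>i\<in>I. c i * \<omega> i)\<close>.
\<close>
definition tilt_mean :: "int set \<Rightarrow> (int \<Rightarrow> real) \<Rightarrow> int \<Rightarrow> real" where
  "tilt_mean I c j = (\<Sum>i\<in>I. c i * \<rho> (j - i))"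

lemma tilt_mean_add:
  assumes "finite I" "k \<in> I"
  shows "tilt_mean I (\<lambda>i. c i + (if i = k then \<theta> else 0)) j = tilt_mean I c j + \<theta> * \<rho> (j - k)"
proof -
  have "tilt_mean I (\<lambda>i. c i + (if i = k then \<theta> else 0)) j
      = (\<Sum>i\<in>I. c i * \<rho> (j - i) + (if i = k then \<theta> * \<rho> (j - i) else 0))"
    unfolding tilt_mean_def by (intro sum.cong) (auto simp: algebra_simps)
  then show ?thesis using assms by (simp add: sum.distrib tilt_mean_def)
qed

lemma cov_form_tilt_mean: "cov_form \<rho> I c = (\<Sum>i\<in>I. c i * tilt_mean I c i)"
  unfolding cov_form_def tilt_mean_def sum_distrib_left
proof (intro sum.cong refl)
  fix i j show "c i * c j * \<rho> (j - i) = c i * (c j * \<rho> (i - j))"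
    using rho_sym[of "i - j"] by simp
qed

lemma cov_form_add:
  assumes "finite I" "k \<in> I"
  shows "cov_form \<rho> I (\<lambda>i. c i + (if i = k then \<theta> else 0)) = cov_form \<rho> I c + 2 * \<theta> * tilt_mean I c k + \<theta>\<^sup>2"
proof -
  have "cov_form \<rho> I (\<lambda>i. c i + (if i = k then \<theta> else 0))
     = (\<Sum>i\<in>I. c i * tilt_mean I c i + \<theta> * (c i * \<rho> (i - k)) +
          (if i = k then \<theta> * (tilt_mean I c i + \<theta> * \<rho> (i - k)) else 0))"
    unfolding cov_form_tilt_mean tilt_mean_add[OF assms] by (intro sum.cong) (auto simp: algebra_simps)
  also have "\<dots> = cov_form \<rho> I c + \<theta> * (\<Sum>i\<in>I. c i * \<rho> (i - k)) + \<theta> * (tilt_mean I c k + \<theta>)"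
    using assms by (simp add: sum.distrib cov_form_tilt_mean sum_distrib_left rho_0)
  also have "(\<Sum>i\<in>I. c i * \<rho> (i - k)) = tilt_mean I c k"
    unfolding tilt_mean_def using rho_sym[of "_ - k"] by (intro sum.cong) auto
  finally show ?thesis by (simp add: power2_eq_square algebra_simps)
qed

text \<open>
  If the sites in \<open>J\<close> are pairwise uncorrelated, an exponential tilt acts on a product of exponential
  polynomials of the \<open>\<omega>\<^sub>j\<close> site by site, each site being shifted by its tilted mean. Expanding the factor at
  one site only adds a multiple of \<open>\<omega>\<^sub>k\<close> to the tilt, and this leaves the tilted means at the other sites of
  \<open>J\<close> unchanged; so induction over \<open>J\<close>, with the tilt arbitrary, proves the formula.
\<close>
lemma exp_poly_prod:
  assumes I: "finite I" and J: "J \<subseteq> I"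
    and unc: "\<And>i j. i \<in> J \<Longrightarrow> j \<in> J \<Longrightarrow> i \<noteq> j \<Longrightarrow> \<rho> (i - j) = 0"
    and Ls: "finite Ls"
  shows "integrable M (\<lambda>x. exp (\<Sum>i\<in>I. c i * \<omega> i x) * (\<Prod>j\<in>J. \<Sum>l\<in>Ls. a l * exp (t l * \<omega> j x)))
    \<and> expectation (\<lambda>x. exp (\<Sum>i\<in>I. c i * \<omega> i x) * (\<Prod>j\<in>J. \<Sum>l\<in>Ls. a l * exp (t l * \<omega> j x)))
      = exp (cov_form \<rho> I c / 2) * (\<Prod>j\<in>J. \<Sum>l\<in>Ls. a l * exp (t l * tilt_mean I c j + (t l)\<^sup>2 / 2))"
proof -
  have "finite J" using I J finite_subset by blast
  then show ?thesis using J unc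
  proof (induction J arbitrary: c rule: finite_induct)
    case empty
    then show ?case using exp_integrable[OF I] exp_moment[OF I] by simp
  next
    case (insert k J)
    have k: "k \<in> I" using insert by auto
    define c' where "c' l = (\<lambda>i. c i + (if i = k then t l else 0))" for l
    define R where "R x = (\<Prod>j\<in>J. \<Sum>l\<in>Ls. a l * exp (t l * \<omega> j x))" for x
    have IH: "integrable M (\<lambda>x. exp (\<Sum>i\<in>I. c' l i * \<omega> i x) * R x)"
        "expectation (\<lambda>x. exp (\<Sum>i\<in>I. c' l i * \<omega> i x) * R x)
          = exp (cov_form \<rho> I (c' l) / 2) * (\<Prod>j\<in>J. \<Sum>m\<in>Ls. a m * exp (t m * tilt_mean I (c' l) j + (t m)\<^sup>2 / 2))" for l
      using insert.IH[of "c' l"] insert.prems unfolding R_def by auto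
    have ex: "exp (\<Sum>i\<in>I. c' l i * \<omega> i x) = exp (\<Sum>i\<in>I. c i * \<omega> i x) * exp (t l * \<omega> k x)" for l x
    proof -
      have "(\<Sum>i\<in>I. c' l i * \<omega> i x) = (\<Sum>i\<in>I. c i * \<omega> i x + (if i = k then t l * \<omega> i x else 0))"
        unfolding c'_def by (intro sum.cong) (auto simp: algebra_simps)
      then show ?thesis using k I by (simp add: sum.distrib exp_add)
    qed
    have eq: "exp (\<Sum>i\<in>I. c i * \<omega> i x) * (\<Prod>j\<in>insert k J. \<Sum>l\<in>Ls. a l * exp (t l * \<omega> j x))
        = (\<Sum>l\<in>Ls. a l * (exp (\<Sum>i\<in>I. c' l i * \<omega> i x) * R x))" for x
      unfolding ex R_def using insert.hyps by (simp add: sum_distrib_left sum_distrib_right mult_ac)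
    have tm: "tilt_mean I (c' l) j = tilt_mean I c j" if "j \<in> J" for j l
    proof -
      have "\<rho> (j - k) = 0" using insert.prems(2)[of j k] insert.hyps that by auto
      then show ?thesis unfolding c'_def tilt_mean_add[OF I k] by simp
    qed
    have qd: "exp (cov_form \<rho> I (c' l) / 2) = exp (cov_form \<rho> I c / 2) * exp (t l * tilt_mean I c k + (t l)\<^sup>2 / 2)" for l
      unfolding c'_def cov_form_add[OF I k] by (simp add: exp_add[symmetric] field_simps)
    have "integrable M (\<lambda>x. \<Sum>l\<in>Ls. a l * (exp (\<Sum>i\<in>I. c' l i * \<omega> i x) * R x))"
      using IH(1) by auto
    moreover have "expectation (\<lambda>x. \<Sum>l\<in>Ls. a l * (exp (\<Sum>i\<in>I. c' l i * \<omega> i x) * R x))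
       = (\<Sum>l\<in>Ls. a l * (exp (cov_form \<rho> I (c' l) / 2) * (\<Prod>j\<in>J. \<Sum>m\<in>Ls. a m * exp (t m * tilt_mean I c j + (t m)\<^sup>2 / 2))))"
      using IH by (simp add: Bochner_Integration.integral_sum tm cong: prod.cong)
    ultimately show ?case unfolding eq qd using insert.hyps
      by (simp add: sum_distrib_left sum_distrib_right mult_ac)
  qed
qed

lemma cosh_poly_prod:
  fixes a0 a1 a2 s :: real
  assumes I: "finite I" and J: "J \<subseteq> I"
    and unc: "\<And>i j. i \<in> J \<Longrightarrow> j \<in> J \<Longrightarrow> i \<noteq> j \<Longrightarrow> \<rho> (i - j) = 0"
  shows "integrable M (\<lambda>x. exp (\<Sum>i\<in>I. c i * \<omega> i x) *
            (\<Prod>j\<in>J. a0 + a1 * cosh (\<omega> j x) + a2 * cosh (s * \<omega> j x)))"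
    and "expectation (\<lambda>x. exp (\<Sum>i\<in>I. c i * \<omega> i x) *
            (\<Prod>j\<in>J. a0 + a1 * cosh (\<omega> j x) + a2 * cosh (s * \<omega> j x)))
      = exp (cov_form \<rho> I c / 2) * (\<Prod>j\<in>J. a0 + a1 * exp (1/2) * cosh (tilt_mean I c j)
            + a2 * exp (s\<^sup>2 / 2) * cosh (s * tilt_mean I c j))"
proof -
  define a where "a l = [a0, a1 / 2, a1 / 2, a2 / 2, a2 / 2] ! l" for l
  define t where "t l = [0, 1, -1, s, - s] ! l" for l
  have e1: "(\<Sum>l\<in>{..<5::nat}. a l * exp (t l * y)) = a0 + a1 * cosh y + a2 * cosh (s * y)" for y
    by (simp add: eval_nat_numeral a_def t_def cosh_def algebra_simps)
  have e2: "(\<Sum>l\<in>{..<5::nat}. a l * exp (t l * m + (t l)\<^sup>2 / 2))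
      = a0 + a1 * exp (1/2) * cosh m + a2 * exp (s\<^sup>2 / 2) * cosh (s * m)" for m
    by (simp add: eval_nat_numeral a_def t_def cosh_def exp_add algebra_simps)
  show "integrable M (\<lambda>x. exp (\<Sum>i\<in>I. c i * \<omega> i x) *
            (\<Prod>j\<in>J. a0 + a1 * cosh (\<omega> j x) + a2 * cosh (s * \<omega> j x)))"
    "expectation (\<lambda>x. exp (\<Sum>i\<in>I. c i * \<omega> i x) *
            (\<Prod>j\<in>J. a0 + a1 * cosh (\<omega> j x) + a2 * cosh (s * \<omega> j x)))
      = exp (cov_form \<rho> I c / 2) * (\<Prod>j\<in>J. a0 + a1 * exp (1/2) * cosh (tilt_mean I c j)
            + a2 * exp (s\<^sup>2 / 2) * cosh (s * tilt_mean I c j))"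
    using exp_poly_prod[OF I J unc, of "{..<5::nat}" c a t] unfolding e1 e2 by auto
qed

definition residue :: "int set \<Rightarrow> int \<Rightarrow> int set" where
  "residue B r = {j \<in> B. j mod (int q + 1) = r}"

lemma residue_uncorrelated:
  assumes "i \<in> residue B r" "j \<in> residue B r" "i \<noteq> j"
  shows "\<rho> (i - j) = 0"
proof (rule rho_range)
  have "(int q + 1) dvd (i - j)" using assms by (simp add: residue_def mod_eq_dvd_iff[symmetric])
  then have "int q + 1 \<le> \<bar>i - j\<bar>" using assms(3) by (intro zdvd_imp_le) (auto simp: dvd_abs_iff)
  then show "\<bar>i - j\<bar> > int q" by simp
qed

text \<open>
  Sites in one residue class modulo \<open>q + 1\<close> are uncorrelated, so expectations of products over one class can
  be computed. Hoelder's inequality with \<open>q + 1\<close> equal exponents extends bounds for the classes to the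
  whole set of sites.
\<close>
lemma holder_residues:
  fixes F :: "'b \<Rightarrow> real" and f :: "int \<Rightarrow> 'b \<Rightarrow> real"
  assumes B: "finite B" and F: "\<And>x. F x > 0" and f: "\<And>j x. f j x > 0"
    and int: "\<And>r. integrable M (\<lambda>x. F x * (\<Prod>j\<in>residue B r. f j x))"
    and bound: "\<And>r. expectation (\<lambda>x. F x * (\<Prod>j\<in>residue B r. f j x)) \<le> exp (a + (\<Sum>j\<in>residue B r. b j))"
  shows "integrable M (\<lambda>x. F x * (\<Prod>j\<in>B. f j x powr (1 / (real q + 1))))"
    and "expectation (\<lambda>x. F x * (\<Prod>j\<in>B. f j x powr (1 / (real q + 1)))) \<le> exp (a + (\<Sum>j\<in>B. b j) / (real q + 1))"
proof -
  define D where "D = real q + 1"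
  have D: "D > 0" by (simp add: D_def)
  define R where "R = {0..<int q + 1}"
  have cR: "real (card R) = D" by (simp add: R_def D_def)
  have modR: "j mod (int q + 1) \<in> R" for j
    using pos_mod_sign[of "int q + 1" j] pos_mod_bound[of "int q + 1" j] by (simp add: R_def)
  have grp: "(\<Prod>r\<in>R. \<Prod>j\<in>residue B r. h j) = prod h B" for h :: "int \<Rightarrow> real"
    unfolding residue_def by (rule prod.group) (use B modR in \<open>auto simp: R_def\<close>)
  have grps: "(\<Sum>r\<in>R. \<Sum>j\<in>residue B r. h j) = sum h B" for h :: "int \<Rightarrow> real"
    unfolding residue_def by (rule sum.group) (use B modR in \<open>auto simp: R_def\<close>)
  define X where "X r x = F x * (\<Prod>j\<in>residue B r. f j x)" for r x
  have Xp: "X r x > 0" for r x unfolding X_def using F f by (simp add: prod_pos)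
  have w: "(\<Sum>r\<in>R. 1 / D) = 1" using D cR by simp
  have eq: "(\<Prod>r\<in>R. X r x powr (1 / D)) = F x * (\<Prod>j\<in>B. f j x powr (1 / D))" for x
  proof -
    have "(\<Prod>r\<in>R. X r x powr (1 / D)) = (\<Prod>r\<in>R. F x powr (1 / D) * (\<Prod>j\<in>residue B r. f j x powr (1 / D)))"
      unfolding X_def using F f
      by (intro prod.cong refl) (simp add: powr_mult less_imp_le prod_nonneg prod_powr_distrib)
    also have "\<dots> = (F x powr (1 / D)) ^ card R * (\<Prod>j\<in>B. f j x powr (1 / D))"
      by (simp add: prod.distrib grp)
    also have "(F x powr (1 / D)) ^ card R = F x"
    proof -
      have "(F x powr (1 / D)) ^ card R = (F x powr (1 / D)) powr D"
        using F[of x] by (simp add: powr_realpow[symmetric] cR)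
      then show ?thesis using D F[of x] by (simp add: powr_powr)
    qed
    finally show ?thesis .
  qed
  have intX: "integrable M (X r)" for r using int[of r] by (simp add: X_def[abs_def])
  note H = holder_prod[of R "\<lambda>_. 1 / D" X]
  show "integrable M (\<lambda>x. F x * (\<Prod>j\<in>B. f j x powr (1 / (real q + 1))))"
    using H(1)[OF _ _ w Xp intX] D unfolding eq by (simp add: R_def D_def)
  have "expectation (\<lambda>x. F x * (\<Prod>j\<in>B. f j x powr (1 / D))) \<le> (\<Prod>r\<in>R. expectation (X r) powr (1 / D))"
    using H(2)[OF _ _ w Xp intX] D unfolding eq by (simp add: R_def)
  also have "\<dots> \<le> (\<Prod>r\<in>R. exp (a / D + (\<Sum>j\<in>residue B r. b j / D)))"
  proof (intro prod_mono conjI)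
    fix r
    have "expectation (X r) powr (1 / D) \<le> exp (a + (\<Sum>j\<in>residue B r. b j)) powr (1 / D)"
      using bound[of r] D Xp unfolding X_def
      by (intro powr_mono2 integral_nonneg_AE AE_I2) (auto simp: X_def intro: less_imp_le)
    also have "\<dots> = exp (a / D + (\<Sum>j\<in>residue B r. b j / D))"
      by (simp add: powr_def sum_divide_distrib add_divide_distrib)
    finally show "expectation (X r) powr (1 / D) \<le> exp (a / D + (\<Sum>j\<in>residue B r. b j / D))" .
  qed simp
  also have "\<dots> = exp (\<Sum>r\<in>R. a / D + (\<Sum>j\<in>residue B r. b j / D))"
    by (simp add: exp_sum R_def)
  also have "(\<Sum>r\<in>R. a / D + (\<Sum>j\<in>residue B r. b j / D)) = a + (\<Sum>j\<in>B. b j) / D"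
    using D cR by (simp add: sum.distrib grps sum_divide_distrib)
  finally show "expectation (\<lambda>x. F x * (\<Prod>j\<in>B. f j x powr (1 / (real q + 1)))) \<le> exp (a + (\<Sum>j\<in>B. b j) / (real q + 1))"
    by (simp add: D_def)
qed

text \<open>
  The variance of the sum of the \<open>\<omega>\<^sub>i\<close> over \<open>S\<close>.
\<close>
definition cov_mass :: "int set \<Rightarrow> real" where
  "cov_mass S = (\<Sum>i\<in>S. \<Sum>j\<in>S. \<rho> (j - i))"

text \<open>
  The covariance of \<open>\<omega>\<^sub>j\<close> with the sum of the \<open>\<omega>\<^sub>i\<close> over \<open>S\<close>, that is, the response of site \<open>j\<close> to the
  points of \<open>S\<close>.
\<close>
definition cov_sum :: "int set \<Rightarrow> int \<Rightarrow> real" where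
  "cov_sum S j = (\<Sum>i\<in>S. \<rho> (j - i))"

lemma cov_sum_le: 
  assumes "finite S" shows "\<bar>cov_sum S j\<bar> \<le> 2 * real q + 1"
proof -
  have "cov_sum S j = (\<Sum>i\<in>S \<inter> {j - int q..j + int q}. \<rho> (j - i))"
    unfolding cov_sum_def using assms by (intro sum.mono_neutral_right) (auto intro!: rho_range)
  also have "\<bar>\<dots>\<bar> \<le> (\<Sum>i\<in>S \<inter> {j - int q..j + int q}. 1)"
    by (rule order_trans[OF sum_abs]) (intro sum_mono rho_le)
  also have "\<dots> = real (card (S \<inter> {j - int q..j + int q}))" by simp
  also have "\<dots> \<le> real (card {j - int q..j + int q})"
    by (intro of_nat_mono card_mono) auto
  also have "\<dots> = 2 * real q + 1" by simp
  finally show ?thesis .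
qed

lemma restrict_coeff:
  assumes "finite I" "S \<subseteq> I"
  shows "(\<Sum>i\<in>I. (if i \<in> S then \<beta> else 0) * \<omega> i x) = (\<Sum>i\<in>S. \<beta> * \<omega> i x)"
    "cov_form \<rho> I (\<lambda>i. if i \<in> S then \<beta> else 0) = \<beta>\<^sup>2 * cov_mass S"
    "tilt_mean I (\<lambda>i. if i \<in> S then \<beta> else 0) j = \<beta> * cov_sum S j"
proof -
  have r: "(\<Sum>i\<in>I. (if i \<in> S then \<beta> else 0) * h i) = (\<Sum>i\<in>S. \<beta> * h i)" for h
    using assms by (intro sum.mono_neutral_cong_right) auto
  show "(\<Sum>i\<in>I. (if i \<in> S then \<beta> else 0) * \<omega> i x) = (\<Sum>i\<in>S. \<beta> * \<omega> i x)" by (rule r)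
  show t: "tilt_mean I (\<lambda>i. if i \<in> S then \<beta> else 0) j = \<beta> * cov_sum S j" for j
    unfolding tilt_mean_def r cov_sum_def by (simp add: sum_distrib_left)
  have "cov_mass S = (\<Sum>i\<in>S. cov_sum S i)"
    unfolding cov_mass_def cov_sum_def using rho_sym by (intro sum.cong refl) (metis minus_diff_eq)
  then show "cov_form \<rho> I (\<lambda>i. if i \<in> S then \<beta> else 0) = \<beta>\<^sup>2 * cov_mass S"
    unfolding cov_form_tilt_mean t r by (simp add: sum_distrib_left power2_eq_square mult_ac)
qed

lemma exp_moment_points:
  assumes "finite S"
  shows "integrable M (\<lambda>x. exp (\<Sum>i\<in>S. \<beta> * \<omega> i x))"
    "expectation (\<lambda>x. exp (\<Sum>i\<in>S. \<beta> * \<omega> i x)) = exp (\<beta>\<^sup>2 * cov_mass S / 2)"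
  using exp_integrable[OF assms, of "\<lambda>_. \<beta>"] exp_moment[OF assms, of "\<lambda>_. \<beta>"]
  by (auto simp: cov_form_def cov_mass_def sum_distrib_left power2_eq_square)

text \<open>
  The gain of the penalty. On each residue class \<open>1/(1+y) \<le> 1 - y + y\<^sup>2\<close> replaces the penalty by a
  polynomial in exponentials, whose tilted expectation is explicit; the terms of second order in \<open>l\<close> are
  bounded because tilted means are at most \<open>\<beta> (2q + 1)\<close>.
\<close>
lemma tilted_exp_le:
  assumes S: "finite S" and B: "finite B" and l: "l > 0" "\<beta> > 0"
    and small: "l * exp (1/2) * cosh (\<beta> * (2 * real q + 1)) \<le> 1"
  shows "integrable M (\<lambda>x. exp (\<Sum>i\<in>S. \<beta> * \<omega> i x) * (\<Prod>j\<in>B. (1 / (1 + l * cosh (\<omega> j x))) powr (1 / (real q + 1))))"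
    and "expectation (\<lambda>x. exp (\<Sum>i\<in>S. \<beta> * \<omega> i x) * (\<Prod>j\<in>B. (1 / (1 + l * cosh (\<omega> j x))) powr (1 / (real q + 1))))
      \<le> exp (\<beta>\<^sup>2 * cov_mass S / 2 + (\<Sum>j\<in>B. - l * exp (1/2) * cosh (\<beta> * cov_sum S j)
            + l\<^sup>2 * ((1 + exp 2 * cosh (2 * (\<beta> * (2 * real q + 1)))) / 2)) / (real q + 1))"
proof -
  define mx where "mx = \<beta> * (2 * real q + 1)"
  define F where "F x = exp (\<Sum>i\<in>S. \<beta> * \<omega> i x)" for x
  define f where "f j x = 1 / (1 + l * cosh (\<omega> j x))" for j x
  define C1 where "C1 = (1 + exp 2 * cosh (2 * mx)) / 2"
  define b where "b j = - l * exp (1/2) * cosh (\<beta> * cov_sum S j) + l\<^sup>2 * C1" for j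
  have fp: "f j x > 0" for j x unfolding f_def using l cosh_real_pos[of "\<omega> j x"]
    by (simp add: add_pos_pos)
  have [measurable]: "cosh \<in> borel_measurable (borel :: real measure)"
    by (intro borel_measurable_continuous_onI continuous_intros)
  have fm [measurable]: "f j \<in> borel_measurable M" for j unfolding f_def by measurable
  have Fm [measurable]: "F \<in> borel_measurable M" unfolding F_def by measurable
  \<comment> \<open>The polynomial \<open>1 - y + y\<^sup>2\<close> at \<open>l * cosh\<close>, with the square written by the double-argument formula.\<close>
  define psi where "psi y = (1 + l\<^sup>2 / 2) + (- l) * cosh y + (l\<^sup>2 / 2) * cosh (2 * y)" for y
  have fle: "f j x \<le> psi (\<omega> j x)" for j x
  proof -
    define y where "y = l * cosh (\<omega> j x)"
    have y: "y > 0" using l cosh_real_pos[of "\<omega> j x"] by (simp add: y_def)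
    have "psi (\<omega> j x) = 1 - y + y\<^sup>2"
      by (simp add: psi_def y_def cosh_double_cosh power2_eq_square algebra_simps)
    moreover have "1 / (1 + y) \<le> 1 - y + y\<^sup>2"
    proof -
      have "(1 - y + y\<^sup>2) * (1 + y) = 1 + y ^ 3" by (simp add: power2_eq_square power3_eq_cube algebra_simps)
      then show ?thesis using y by (simp add: divide_le_eq)
    qed
    ultimately show ?thesis by (simp add: f_def y_def)
  qed
  have main: "integrable M (\<lambda>x. F x * (\<Prod>j\<in>residue B r. f j x)) \<and>
      expectation (\<lambda>x. F x * (\<Prod>j\<in>residue B r. f j x)) \<le> exp (\<beta>\<^sup>2 * cov_mass S / 2 + (\<Sum>j\<in>residue B r. b j))" for r
  proof -
    define I where "I = S \<union> residue B r"
    have fB: "finite (residue B r)" using B by (simp add: residue_def)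
    have I: "finite I" "S \<subseteq> I" "residue B r \<subseteq> I" using S fB by (auto simp: I_def)
    have unc: "\<rho> (i - j) = 0" if "i \<in> residue B r" "j \<in> residue B r" "i \<noteq> j" for i j
      by (rule residue_uncorrelated[OF that])
    note cp = cosh_poly_prod[OF I(1,3) unc, where c = "\<lambda>i. if i \<in> S then \<beta> else 0"
        and ?a0.0 = "1 + l\<^sup>2 / 2" and ?a1.0 = "- l" and ?a2.0 = "l\<^sup>2 / 2" and s = 2,
        unfolded restrict_coeff[OF I(1,2)], folded psi_def, folded F_def]
    have cp1: "integrable M (\<lambda>x. F x * (\<Prod>j\<in>residue B r. psi (\<omega> j x)))"
      using cp(1) by blast
    have le: "F x * (\<Prod>j\<in>residue B r. f j x) \<le> F x * (\<Prod>j\<in>residue B r. psi (\<omega> j x))" for x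
      using fle fp by (intro mult_left_mono prod_mono) (auto simp: F_def intro: less_imp_le)
    have nn: "0 \<le> F x * (\<Prod>j\<in>residue B r. f j x)" for x
      using fp by (intro mult_nonneg_nonneg prod_nonneg) (auto simp: F_def intro: less_imp_le)
    have int: "integrable M (\<lambda>x. F x * (\<Prod>j\<in>residue B r. f j x))"
    proof (rule Bochner_Integration.integrable_bound[OF cp1], goal_cases)
      case 2
      show ?case
      proof (rule AE_I2)
        fix x
        show "norm (F x * (\<Prod>j\<in>residue B r. f j x)) \<le> norm (F x * (\<Prod>j\<in>residue B r. psi (\<omega> j x)))" using le[of x] nn[of x] unfolding real_norm_def by linarith
      qed
    qed measurable
    have "expectation (\<lambda>x. F x * (\<Prod>j\<in>residue B r. f j x)) \<le> expectation (\<lambda>x. F x * (\<Prod>j\<in>residue B r. psi (\<omega> j x)))"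
      by (rule integral_mono[OF int cp1 le])
    also have "\<dots> = exp (\<beta>\<^sup>2 * cov_mass S / 2) * (\<Prod>j\<in>residue B r. (1 + l\<^sup>2 / 2) + (- l) * exp (1/2) * cosh (\<beta> * cov_sum S j)
            + l\<^sup>2 / 2 * exp (2\<^sup>2 / 2) * cosh (2 * (\<beta> * cov_sum S j)))"
      using cp(2) by blast
    also have "\<dots> \<le> exp (\<beta>\<^sup>2 * cov_mass S / 2) * (\<Prod>j\<in>residue B r. exp (b j))"
    proof (intro mult_left_mono prod_mono conjI)
      fix j
      have ab: "\<bar>\<beta> * cov_sum S j\<bar> \<le> mx"
        using cov_sum_le[OF S, of j] l by (simp add: mx_def abs_mult)
      have mono: "cosh (u :: real) \<le> cosh v" if "\<bar>u\<bar> \<le> v" for u v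
        using that cosh_real_nonneg_le_iff[of "\<bar>u\<bar>" v] by simp
      have c1: "cosh (\<beta> * cov_sum S j) \<le> cosh mx" using ab by (rule mono)
      have c2: "cosh (2 * (\<beta> * cov_sum S j)) \<le> cosh (2 * mx)" using ab by (intro mono) (simp add: abs_mult)
      have "l * exp (1/2) * cosh (\<beta> * cov_sum S j) \<le> l * exp (1/2) * cosh mx"
        using c1 l by (intro mult_left_mono) auto
      then have s1: "l * exp (1/2) * cosh (\<beta> * cov_sum S j) \<le> 1" using small by (simp add: mx_def)
      have "0 \<le> l\<^sup>2 / 2 * exp (2\<^sup>2 / 2) * cosh (2 * (\<beta> * cov_sum S j))"
        by (intro mult_nonneg_nonneg) (auto simp: less_imp_le[OF cosh_real_pos])
      then show "0 \<le> (1 + l\<^sup>2 / 2) + (- l) * exp (1/2) * cosh (\<beta> * cov_sum S j)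
            + l\<^sup>2 / 2 * exp (2\<^sup>2 / 2) * cosh (2 * (\<beta> * cov_sum S j))"
        using s1 zero_le_power2[of l] by linarith
      have "l\<^sup>2 / 2 * exp 2 * cosh (2 * (\<beta> * cov_sum S j)) \<le> l\<^sup>2 / 2 * exp 2 * cosh (2 * mx)"
        using c2 by (intro mult_left_mono) auto
      then have "(1 + l\<^sup>2 / 2) + (- l) * exp (1/2) * cosh (\<beta> * cov_sum S j)
            + l\<^sup>2 / 2 * exp (2\<^sup>2 / 2) * cosh (2 * (\<beta> * cov_sum S j)) \<le> 1 + b j"
        by (simp add: b_def C1_def algebra_simps power2_eq_square)
      also have "\<dots> \<le> exp (b j)" by (rule exp_ge_add_one_self)
      finally show "(1 + l\<^sup>2 / 2) + (- l) * exp (1/2) * cosh (\<beta> * cov_sum S j)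
            + l\<^sup>2 / 2 * exp (2\<^sup>2 / 2) * cosh (2 * (\<beta> * cov_sum S j)) \<le> exp (b j)" .
    qed simp
    also have "\<dots> = exp (\<beta>\<^sup>2 * cov_mass S / 2 + (\<Sum>j\<in>residue B r. b j))"
      using fB by (simp add: exp_add exp_sum)
    finally show ?thesis using int by blast
  qed
  have Fp: "F x > 0" for x by (simp add: F_def)
  show "integrable M (\<lambda>x. exp (\<Sum>i\<in>S. \<beta> * \<omega> i x) * (\<Prod>j\<in>B. (1 / (1 + l * cosh (\<omega> j x))) powr (1 / (real q + 1))))"
    "expectation (\<lambda>x. exp (\<Sum>i\<in>S. \<beta> * \<omega> i x) * (\<Prod>j\<in>B. (1 / (1 + l * cosh (\<omega> j x))) powr (1 / (real q + 1))))
      \<le> exp (\<beta>\<^sup>2 * cov_mass S / 2 + (\<Sum>j\<in>B. - l * exp (1/2) * cosh (\<beta> * cov_sum S j)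
            + l\<^sup>2 * ((1 + exp 2 * cosh (2 * (\<beta> * (2 * real q + 1)))) / 2)) / (real q + 1))"
    using holder_residues[of B F f, OF B Fp fp conjunct1[OF main] conjunct2[OF main]]
    unfolding F_def f_def b_def C1_def mx_def by auto
qed

text \<open>
  The cost of the penalty. Weighted with the Hoelder exponents of \<open>fractional_moment\<close>, its term of first order
  in \<open>l\<close> cancels that of the gain at sites with zero tilted mean, and only second-order terms remain.
\<close>
lemma tilt_dual_le:
  assumes B: "finite B" and l: "l > 0" "l \<le> 1" and n: "n \<ge> (1::nat)"
  shows "integrable M (\<lambda>x. \<Prod>j\<in>B. ((1 + l * cosh (\<omega> j x)) ^ n) powr (1 / (real q + 1)))"
    and "expectation (\<lambda>x. \<Prod>j\<in>B. ((1 + l * cosh (\<omega> j x)) ^ n) powr (1 / (real q + 1)))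
      \<le> exp ((\<Sum>j\<in>B. real n * l * exp (1/2) + l\<^sup>2 * (2 * 2 ^ n * exp ((real n)\<^sup>2 / 2))) / (real q + 1))"
proof -
  define F :: "'b \<Rightarrow> real" where "F x = 1" for x
  define f where "f j x = (1 + l * cosh (\<omega> j x)) ^ n" for j x
  define b where "b j = real n * l * exp (1/2) + l\<^sup>2 * (2 * 2 ^ n * exp ((real n)\<^sup>2 / 2))" for j :: int
  have fp: "f j x > 0" for j x unfolding f_def using l cosh_real_pos[of "\<omega> j x"]
    by (simp add: add_pos_pos)
  have [measurable]: "cosh \<in> borel_measurable (borel :: real measure)"
    by (intro borel_measurable_continuous_onI continuous_intros)
  have fm [measurable]: "f j \<in> borel_measurable M" for j unfolding f_def by measurable
  \<comment> \<open>A majorant of \<open>(1 + l * cosh y) ^ n\<close> that keeps the first-order term and has exponential remainder.\<close>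
  define psi where "psi y = 1 + (real n * l) * cosh y + (l\<^sup>2 * (2 * 2 ^ n)) * cosh (real n * y)" for y
  have pow: "(1 + l * y) ^ n \<le> 1 + real n * (l * y) + l\<^sup>2 * (1 + y) ^ n" if "y \<ge> 0" for y
  proof -
    have "(1 + l * y) ^ k \<le> 1 + real k * (l * y) + l\<^sup>2 * ((1 + y) ^ k - 1 - real k * y)" for k
    proof (induction k)
      case (Suc k)
      have "(1 + l * y) ^ Suc k \<le> (1 + l * y) * (1 + real k * (l * y) + l\<^sup>2 * ((1 + y) ^ k - 1 - real k * y))"
        using Suc l that by (simp add: mult_left_mono)
      also have "\<dots> \<le> 1 + real (Suc k) * (l * y) + l\<^sup>2 * ((1 + y) ^ Suc k - 1 - real (Suc k) * y)"
      proof -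
        define E where "E = (1 + y) ^ k - 1 - real k * y"
        have E: "E \<ge> 0" using Bernoulli_inequality[of y k] that by (simp add: E_def mult.commute)
        have e: "(1 + y) ^ Suc k - 1 - real (Suc k) * y = E + y * E + real k * y\<^sup>2"
          by (simp add: E_def power2_eq_square algebra_simps)
        have "l * (l\<^sup>2 * y * E) \<le> 1 * (l\<^sup>2 * y * E)"
          using l that E by (intro mult_right_mono) auto
        then show ?thesis unfolding e E_def[symmetric]
          by (simp add: power2_eq_square algebra_simps)
      qed
      finally show ?case .
    qed simp
    from this[of n] have "(1 + l * y) ^ n \<le> 1 + real n * (l * y) + l\<^sup>2 * ((1 + y) ^ n - 1 - real n * y)" .
    moreover have ny: "0 \<le> real n * y" using that by simp
    moreover have "l\<^sup>2 * ((1 + y) ^ n - 1 - real n * y) \<le> l\<^sup>2 * (1 + y) ^ n"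
      using ny by (intro mult_left_mono) (linarith, simp)
    ultimately show ?thesis by linarith
  qed
  have fle: "f j x \<le> psi (\<omega> j x)" for j x
  proof -
    have c1: "1 \<le> cosh (\<omega> j x)" by (rule cosh_real_ge_1)
    have "f j x \<le> 1 + real n * (l * cosh (\<omega> j x)) + l\<^sup>2 * (1 + cosh (\<omega> j x)) ^ n"
      unfolding f_def using c1 by (intro pow) simp
    also have "(1 + cosh (\<omega> j x)) ^ n \<le> (2 * exp \<bar>\<omega> j x\<bar>) ^ n"
    proof (intro power_mono)
      have "cosh (\<omega> j x) = cosh \<bar>\<omega> j x\<bar>" by simp
      also have "\<dots> \<le> exp \<bar>\<omega> j x\<bar>" by (simp add: cosh_def)
      finally have "cosh (\<omega> j x) \<le> exp \<bar>\<omega> j x\<bar>" .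
      then show "1 + cosh (\<omega> j x) \<le> 2 * exp \<bar>\<omega> j x\<bar>" using c1 by linarith
    qed (use c1 in simp)
    also have "(2 * exp \<bar>\<omega> j x\<bar>) ^ n = 2 ^ n * exp (real n * \<bar>\<omega> j x\<bar>)"
      by (simp add: power_mult_distrib exp_of_nat_mult)
    also have "exp (real n * \<bar>\<omega> j x\<bar>) \<le> 2 * cosh (real n * \<omega> j x)"
    proof -
      have "cosh (real n * \<omega> j x) = cosh (real n * \<bar>\<omega> j x\<bar>)"
        by (metis abs_mult abs_of_nat cosh_real_abs)
      moreover have "exp (real n * \<bar>\<omega> j x\<bar>) \<le> 2 * cosh (real n * \<bar>\<omega> j x\<bar>)"
        by (simp add: cosh_def)
      ultimately show ?thesis by (simp only:)
    qed
    finally show ?thesis using l by (simp add: psi_def mult_left_mono algebra_simps)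
  qed
  have main: "integrable M (\<lambda>x. F x * (\<Prod>j\<in>residue B r. f j x)) \<and>
      expectation (\<lambda>x. F x * (\<Prod>j\<in>residue B r. f j x)) \<le> exp (0 + (\<Sum>j\<in>residue B r. b j))" for r
  proof -
    have fB: "finite (residue B r)" using B by (simp add: residue_def)
    have unc: "\<rho> (i - j) = 0" if "i \<in> residue B r" "j \<in> residue B r" "i \<noteq> j" for i j
      by (rule residue_uncorrelated[OF that])
    note cp = cosh_poly_prod[OF fB order_refl unc, where c = "\<lambda>i. 0"
        and ?a0.0 = "1" and ?a1.0 = "real n * l" and ?a2.0 = "l\<^sup>2 * (2 * 2 ^ n)" and s = "real n",
        folded psi_def]
    have cp1: "integrable M (\<lambda>x. \<Prod>j\<in>residue B r. psi (\<omega> j x))"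
      using cp(1) by simp
    have le: "(\<Prod>j\<in>residue B r. f j x) \<le> (\<Prod>j\<in>residue B r. psi (\<omega> j x))" for x
      using fle fp by (intro prod_mono) (auto intro: less_imp_le)
    have nn: "0 \<le> (\<Prod>j\<in>residue B r. f j x)" for x
      using fp by (intro prod_nonneg) (auto intro: less_imp_le)
    have int: "integrable M (\<lambda>x. (\<Prod>j\<in>residue B r. f j x))"
    proof (rule Bochner_Integration.integrable_bound[OF cp1], goal_cases)
      case 2
      show ?case
      proof (rule AE_I2)
        fix x
        show "norm (\<Prod>j\<in>residue B r. f j x) \<le> norm (\<Prod>j\<in>residue B r. psi (\<omega> j x))" using le[of x] nn[of x] unfolding real_norm_def by linarith
      qed
    qed measurable
    have "expectation (\<lambda>x. (\<Prod>j\<in>residue B r. f j x)) \<le> expectation (\<lambda>x. (\<Prod>j\<in>residue B r. psi (\<omega> j x)))"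
      by (rule integral_mono[OF int cp1 le])
    also have "\<dots> = (\<Prod>j\<in>residue B r. 1 + real n * l * exp (1/2) + l\<^sup>2 * (2 * 2 ^ n) * exp ((real n)\<^sup>2 / 2))"
      using cp(2) by (simp add: cov_form_def tilt_mean_def)
    also have "\<dots> \<le> (\<Prod>j\<in>residue B r. exp (b j))"
    proof (intro prod_mono conjI)
      fix j
      show "0 \<le> 1 + real n * l * exp (1/2) + l\<^sup>2 * (2 * 2 ^ n) * exp ((real n)\<^sup>2 / 2)"
        using l by (intro add_nonneg_nonneg mult_nonneg_nonneg) auto
      show "1 + real n * l * exp (1/2) + l\<^sup>2 * (2 * 2 ^ n) * exp ((real n)\<^sup>2 / 2) \<le> exp (b j)"
        using exp_ge_add_one_self[of "b j"] by (simp add: b_def algebra_simps)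
    qed
    also have "\<dots> = exp (0 + (\<Sum>j\<in>residue B r. b j))"
      using fB by (simp add: exp_sum)
    finally show ?thesis using int by (simp add: F_def)
  qed
  have Fp: "F x > 0" for x by (simp add: F_def)
  show "integrable M (\<lambda>x. \<Prod>j\<in>B. ((1 + l * cosh (\<omega> j x)) ^ n) powr (1 / (real q + 1)))"
    "expectation (\<lambda>x. \<Prod>j\<in>B. ((1 + l * cosh (\<omega> j x)) ^ n) powr (1 / (real q + 1)))
      \<le> exp ((\<Sum>j\<in>B. real n * l * exp (1/2) + l\<^sup>2 * (2 * 2 ^ n * exp ((real n)\<^sup>2 / 2))) / (real q + 1))"
    using holder_residues[of B F f, OF B Fp fp conjunct1[OF main] conjunct2[OF main]]
    unfolding F_def f_def b_def by auto
qed

end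

section \<open>Isolated sites and path weights\<close>

text \<open>
  Sites whose only neighbour in \<open>A\<close> within the range of the correlations sits at the extreme distance
  \<open>q\<close> on the right.
\<close>
definition isolated :: "nat \<Rightarrow> int set \<Rightarrow> int set" where
  "isolated q A = {j. j + int q \<in> A \<and> (\<forall>i\<in>A. \<bar>i - j\<bar> \<le> int q \<longrightarrow> i = j + int q)}"

definition long_gaps :: "nat \<Rightarrow> nat list \<Rightarrow> nat" where
  "long_gaps q xs = length (filter (\<lambda>x. x > 2 * q) xs)"

lemma long_gaps_append [simp]: "long_gaps q (xs @ ys) = long_gaps q xs + long_gaps q ys"
  by (simp add: long_gaps_def)

text \<open>
  The witnesses \<open>j + q\<close> lie in \<open>A\<close>, so points added to the right of \<open>A\<close> are out of range.
\<close>
lemma isolated_mono: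
  assumes "A \<subseteq> {..b}" "C \<subseteq> {b<..}"
  shows "isolated q A \<subseteq> isolated q (A \<union> C)"
proof
  fix j assume j: "j \<in> isolated q A"
  then have "j + int q \<le> b" using assms by (auto simp: isolated_def)
  then have "\<not> \<bar>i - j\<bar> \<le> int q" if "i \<in> C" for i using that assms by fastforce
  then show "j \<in> isolated q (A \<union> C)" using j by (auto simp: isolated_def)
qed

lemma finite_isolated:
  assumes "finite A" shows "finite (isolated q A)"
proof (rule finite_subset)
  show "isolated q A \<subseteq> (\<lambda>i. i - int q) ` A"
  proof
    fix j assume "j \<in> isolated q A"
    then show "j \<in> (\<lambda>i. i - int q) ` A" by (intro image_eqI[of _ _ "j + int q"]) (auto simp: isolated_def)
  qed
qed (use assms in simp)

text \<open>
  Let \<open>y\<close> be a point reached by a gap larger than \<open>2q\<close>. Then \<open>y - q\<close> is an isolated site: the previous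
  point is more than \<open>q\<close> to its left. It lies to the right of the previous point and not beyond \<open>y\<close>, so different gaps yield
  different sites.
\<close>
lemma long_gaps_le_card_isolated:
  assumes "finite A" "A \<subseteq> {..a}" "0 \<notin> set p"
  shows "long_gaps q p \<le> card (isolated q (A \<union> points a p) \<inter> {a<..a + int (sum_list p)})"
  using assms(3)
proof (induction p rule: rev_induct)
  case Nil
  then show ?case by (simp add: long_gaps_def)
next
  case (snoc x p)
  define b where "b = a + int (sum_list p)"
  define A' where "A' = A \<union> points a p"
  have x: "x \<ge> 1" using snoc by auto
  have A'b: "A' \<subseteq> {..b}"
    using assms(2) points_subset[of p a] snoc.prems by (fastforce simp: A'_def b_def)
  have eq: "A \<union> points a (p @ [x]) = A' \<union> {b + int x}"
    by (auto simp: points_append A'_def b_def)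
  have mono: "isolated q A' \<subseteq> isolated q (A' \<union> {b + int x})"
    using isolated_mono[OF A'b, of "{b + int x}"] x by auto
  have fin: "finite (isolated q (A' \<union> {b + int x}))"
    by (rule finite_isolated) (simp add: A'_def assms)
  have IH: "long_gaps q p \<le> card (isolated q A' \<inter> {a<..b})"
    using snoc by (simp add: A'_def b_def)
  have ab: "a \<le> b" by (simp add: b_def)
  have int: "a + int (sum_list (p @ [x])) = b + int x" by (simp add: b_def)
  show ?case
  proof (cases "x > 2 * q")
    case True
    define j where "j = b + int x - int q"
    have "j \<in> isolated q (A' \<union> {b + int x})"
      using A'b True by (force simp: isolated_def j_def)
    then have sub: "insert j (isolated q A' \<inter> {a<..b}) \<subseteq> isolated q (A' \<union> {b + int x}) \<inter> {a<..b + int x}"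
      using mono ab True by (auto simp: j_def)
    have "card (insert j (isolated q A' \<inter> {a<..b})) = Suc (card (isolated q A' \<inter> {a<..b}))"
      using True finite_isolated[of A' q] by (subst card_insert_disjoint) (auto simp: j_def A'_def assms)
    moreover have "card (insert j (isolated q A' \<inter> {a<..b})) \<le> card (isolated q (A' \<union> {b + int x}) \<inter> {a<..b + int x})"
      using sub fin by (intro card_mono) auto
    ultimately show ?thesis using IH True unfolding eq int by (simp add: long_gaps_def)
  next
    case False
    have "card (isolated q A' \<inter> {a<..b}) \<le> card (isolated q (A' \<union> {b + int x}) \<inter> {a<..b + int x})"
      using mono fin by (intro card_mono) auto
    then show ?thesis using IH False unfolding eq int by (simp add: long_gaps_def)
  qed
qed

context gaussian_disorder
begin

lemma cov_sum_isolated: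
  assumes "finite A" "j \<in> isolated q A"
  shows "cov_sum A j = \<rho> (int q)"
proof -
  have "cov_sum A j = (\<Sum>i\<in>{j + int q}. \<rho> (j - i))"
    unfolding cov_sum_def using assms
  proof (intro sum.mono_neutral_right ballI)
    fix i assume i: "i \<in> A - {j + int q}"
    then have "\<not> \<bar>i - j\<bar> \<le> int q" using assms(2) by (auto simp: isolated_def)
    then show "\<rho> (j - i) = 0" by (intro rho_range) linarith
  qed (auto simp: isolated_def)
  then show ?thesis using rho_sym[of "int q"] by simp
qed

lemma cov_mass_translate: "cov_mass ((+) a ` S) = cov_mass S"
  unfolding cov_mass_def by (simp add: sum.reindex)

text \<open>
  Only the at most \<open>q\<close> points next to the cut on either side interact across it.
\<close>
lemma cov_mass_Un:
  assumes "finite A" "finite C" "A \<subseteq> {..b}" "C \<subseteq> {b<..}"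
  shows "\<bar>cov_mass (A \<union> C) - cov_mass A - cov_mass C\<bar> \<le> 2 * (real q)\<^sup>2"
proof -
  have dis: "A \<inter> C = {}" using assms by force
  define X where "X = (\<Sum>i\<in>A. \<Sum>j\<in>C. \<rho> (j - i))"
  have X': "(\<Sum>i\<in>C. \<Sum>j\<in>A. \<rho> (j - i)) = X"
  proof -
    have "\<rho> (j - i) = \<rho> (i - j)" for i j using rho_sym[of "i - j"] by simp
    then have "(\<Sum>i\<in>C. \<Sum>j\<in>A. \<rho> (j - i)) = (\<Sum>i\<in>C. \<Sum>j\<in>A. \<rho> (i - j))"
      by (intro sum.cong refl)
    also have "\<dots> = X" unfolding X_def by (rule sum.swap)
    finally show ?thesis .
  qed
  have "cov_mass (A \<union> C) = cov_mass A + X + (\<Sum>i\<in>C. \<Sum>j\<in>A. \<rho> (j - i)) + cov_mass C"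
    unfolding cov_mass_def X_def using assms dis by (simp add: sum.union_disjoint sum.distrib)
  then have e: "cov_mass (A \<union> C) - cov_mass A - cov_mass C = 2 * X" using X' by simp
  define A' where "A' = A \<inter> {b - int q<..b}"
  define C' where "C' = C \<inter> {b<..b + int q}"
  have "X = (\<Sum>(i, j)\<in>A \<times> C. \<rho> (j - i))" by (simp add: X_def sum.cartesian_product)
  also have "\<dots> = (\<Sum>(i, j)\<in>A' \<times> C'. \<rho> (j - i))"
  proof (intro sum.mono_neutral_right ballI)
    fix z assume z: "z \<in> A \<times> C - A' \<times> C'"
    obtain i j where ij: "z = (i, j)" by force
    have "i \<le> b" "j > b" using z ij assms by auto
    moreover have "i \<le> b - int q \<or> j > b + int q" using z ij assms by (auto simp: A'_def C'_def)
    ultimately show "(case z of (i, j) \<Rightarrow> \<rho> (j - i)) = 0"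
      unfolding ij by (auto intro!: rho_range)
  qed (use assms in \<open>auto simp: A'_def C'_def\<close>)
  also have "\<bar>\<dots>\<bar> \<le> (\<Sum>z\<in>A' \<times> C'. 1)"
    by (rule order_trans[OF sum_abs], rule sum_mono) (auto intro: rho_le)
  also have "\<dots> = real (card A' * card C')" by (simp add: card_cartesian_product)
  also have "card A' * card C' \<le> q * q"
  proof (intro mult_le_mono)
    show "card A' \<le> q" using card_mono[of "{b - int q<..b}" A'] by (simp add: A'_def)
    show "card C' \<le> q" using card_mono[of "{b<..b + int q}" C'] by (simp add: C'_def)
  qed
  finally show ?thesis unfolding e by (simp add: abs_mult power2_eq_square)
qed

lemma cov_mass_le:
  assumes "finite S" shows "cov_mass S \<le> (2 * real q + 1) * real (card S)"
proof -
  have "cov_mass S = (\<Sum>i\<in>S. cov_sum S i)"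
    unfolding cov_mass_def cov_sum_def by (intro sum.cong refl) (metis minus_diff_eq rho_sym)
  also have "\<dots> \<le> (\<Sum>i\<in>S. 2 * real q + 1)"
    using cov_sum_le[OF assms] by (intro sum_mono) (metis abs_le_D1)
  finally show ?thesis by (simp add: mult.commute)
qed

end

text \<open>
  Subadditivity of \<open>x powr g\<close>: after normalising the sum to \<open>1\<close>, each term is at most its power.
\<close>
lemma sum_powr_le:
  fixes f :: "'i \<Rightarrow> real"
  assumes "finite I" "\<And>i. i \<in> I \<Longrightarrow> f i \<ge> 0" "0 < g" "g \<le> 1"
  shows "(\<Sum>i\<in>I. f i) powr g \<le> (\<Sum>i\<in>I. f i powr g)"
proof (cases "(\<Sum>i\<in>I. f i) = 0")
  case True
  then show ?thesis by (simp add: sum_nonneg)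
next
  case False
  define s where "s = (\<Sum>i\<in>I. f i)"
  have s: "s > 0" using False assms sum_nonneg[of I f] by (simp add: s_def less_le)
  have "f i / s \<le> (f i / s) powr g" if "i \<in> I" for i
  proof -
    have "f i \<le> s" unfolding s_def using assms that by (intro member_le_sum) auto
    then have "f i / s \<le> 1" using s by simp
    moreover have "0 \<le> f i / s" using assms(2)[OF that] s by simp
    ultimately have "(f i / s) powr 1 \<le> (f i / s) powr g" using assms(4) by (intro powr_mono') auto
    then show ?thesis using powr_one[OF \<open>0 \<le> f i / s\<close>] by (simp only:)
  qed
  then have "(\<Sum>i\<in>I. f i / s) \<le> (\<Sum>i\<in>I. (f i / s) powr g)" by (rule sum_mono)
  moreover have "(\<Sum>i\<in>I. f i / s) = 1" using s by (simp add: s_def flip: sum_divide_distrib)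
  moreover have "(\<Sum>i\<in>I. (f i / s) powr g) = (\<Sum>i\<in>I. f i powr g) / s powr g"
    using assms(2) s by (simp add: powr_divide sum_divide_distrib)
  ultimately show ?thesis using s by (simp add: s_def[symmetric] field_simps)
qed

definition concats :: "nat list set \<Rightarrow> nat list set \<Rightarrow> nat list set" where
  "concats Q P = (\<lambda>(xs, ys). xs @ ys) ` (Q \<times> P)"

lemma finite_concats [intro]: "finite Q \<Longrightarrow> finite P \<Longrightarrow> finite (concats Q P)"
  by (simp add: concats_def)

lemma sum_concats:
  assumes "\<And>xs. xs \<in> Q \<Longrightarrow> 0 \<notin> set xs \<and> sum_list xs = a"
  shows "sum f (concats Q P) = (\<Sum>xs\<in>Q. \<Sum>ys\<in>P. f (xs @ ys))"
proof -
  have "inj_on (\<lambda>(xs, ys). xs @ ys) (Q \<times> P)"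
  proof (rule inj_onI, clarify)
    fix xs ys xs' ys' assume "xs \<in> Q" "xs' \<in> Q" "xs @ ys = xs' @ ys'"
    then show "xs = xs' \<and> ys = ys'"
      using append_eq_append_sum_list_eq[of xs ys xs' ys'] assms by auto
  qed
  then show ?thesis
    unfolding concats_def by (simp add: sum.reindex sum.cartesian_product split_def)
qed

lemma concats_E:
  assumes "zs \<in> concats Q P"
  obtains xs ys where "xs \<in> Q" "ys \<in> P" "zs = xs @ ys"
  using assms by (auto simp: concats_def)

lemma split_at_level:
  assumes "sum_list ys \<ge> k" "k \<ge> (1::nat)"
  shows "\<exists>p d zs. ys = p @ d # zs \<and> sum_list p < k \<and> k \<le> sum_list p + d"
  using assms
proof (induction ys arbitrary: k)
  case (Cons x ys)
  show ?case
  proof (cases "x \<ge> k")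
    case True
    then show ?thesis using Cons.prems by (intro exI[of _ "[]"] exI[of _ x] exI[of _ ys]) auto
  next
    case False
    have "\<exists>p d zs. ys = p @ d # zs \<and> sum_list p < k - x \<and> k - x \<le> sum_list p + d"
      by (rule Cons.IH) (use Cons.prems False in auto)
    then obtain p d zs where "ys = p @ d # zs \<and> sum_list p < k - x \<and> k - x \<le> sum_list p + d"
      by blast
    then show ?thesis using False by (intro exI[of _ "x # p"] exI[of _ d] exI[of _ zs]) auto
  qed
qed simp

definition straddling :: "nat \<Rightarrow> nat \<Rightarrow> (nat \<times> nat) set" where
  "straddling k N = {(j, d). j < k \<and> k \<le> j + d \<and> j + d \<le> N}"

lemma finite_straddling [simp, intro]: "finite (straddling k N)"
  by (rule finite_subset[of _ "{..k} \<times> {..N}"]) (auto simp: straddling_def)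

text \<open>
  Every path of length at least \<open>k\<close> has a gap \<open>d\<close> that straddles level \<open>k\<close>; cut the path before and after
  this gap.
\<close>
lemma compositions_split_le:
  fixes f :: "nat list \<Rightarrow> real"
  assumes "N \<ge> k" "k \<ge> 1" and f: "\<And>ys. f ys \<ge> 0"
  shows "sum f (compositions N) \<le> (\<Sum>(j, d)\<in>straddling k N. \<Sum>p\<in>compositions j. \<Sum>zs\<in>compositions (N - j - d). f (p @ d # zs))"
proof -
  define I where "I = (SIGMA jd:straddling k N. compositions (fst jd) \<times> compositions (N - fst jd - snd jd))"
  define \<phi> where "\<phi> = (\<lambda>(jd :: nat \<times> nat, p, zs). p @ snd jd # zs)"
  have finI: "finite I" unfolding I_def by (intro finite_SigmaI finite_cartesian_product) auto
  have "compositions N \<subseteq> \<phi> ` I"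
  proof
    fix ys assume ys: "ys \<in> compositions N"
    then obtain p d zs where pd: "ys = p @ d # zs" "sum_list p < k" "k \<le> sum_list p + d"
      using split_at_level[of k ys] assms by (auto simp: compositions_def)
    then have "((sum_list p, d), p, zs) \<in> I" using ys
      by (auto simp: I_def compositions_def straddling_def)
    moreover have "ys = \<phi> ((sum_list p, d), p, zs)" using pd by (simp add: \<phi>_def)
    ultimately show "ys \<in> \<phi> ` I" by blast
  qed
  then have "sum f (compositions N) \<le> sum f (\<phi> ` I)" using finI f by (intro sum_mono2) auto
  also have "\<dots> \<le> sum (f \<circ> \<phi>) I" using finI f by (intro sum_image_le) auto
  also have "\<dots> = (\<Sum>jd\<in>straddling k N. \<Sum>pz\<in>compositions (fst jd) \<times> compositions (N - fst jd - snd jd). (f \<circ> \<phi>) (jd, pz))"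
    unfolding I_def by (subst sum.Sigma) auto
  also have "\<dots> = (\<Sum>(j, d)\<in>straddling k N. \<Sum>p\<in>compositions j. \<Sum>zs\<in>compositions (N - j - d). f (p @ d # zs))"
    by (simp add: \<phi>_def sum.cartesian_product split_def)
  finally show ?thesis .
qed

locale pinning_model = gaussian_disorder M \<omega> \<rho> q
  for M :: "'b measure" and \<omega> :: "int \<Rightarrow> 'b \<Rightarrow> real" and \<rho> :: "int \<Rightarrow> real" and q :: nat +
  fixes K :: "nat \<Rightarrow> real" and \<beta> :: real
  assumes K_pos: "\<And>n. n \<ge> 1 \<Longrightarrow> K n > 0"
    and beta_pos: "\<beta> > 0"
    and compositions_le_1: "\<And>n. (\<Sum>xs\<in>compositions n. prod_list (map K xs)) \<le> 1"
begin

definition gap_prob :: "nat list \<Rightarrow> real" where "gap_prob xs = prod_list (map K xs)"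

definition weight :: "real \<Rightarrow> nat list \<Rightarrow> real" where
  "weight h xs = gap_prob xs * exp (h * real (length xs) + \<beta>\<^sup>2 / 2 * cov_mass (points 0 xs))"

definition qweight :: "real \<Rightarrow> nat list \<Rightarrow> 'b \<Rightarrow> real" where
  "qweight h xs x = gap_prob xs * exp (\<Sum>i\<in>points 0 xs. \<beta> * \<omega> i x + h)"

text \<open>
  The factor lost when a path is cut in two: the \<open>q\<^sup>2\<close> pairs of points across the cut contribute
  at most this much to the interaction.
\<close>
definition split_const :: real where "split_const = exp (\<beta>\<^sup>2 * (real q)\<^sup>2)"

lemma split_const_ge_1: "split_const \<ge> 1" by (simp add: split_const_def)

lemma gap_prob_pos: "0 \<notin> set xs \<Longrightarrow> gap_prob xs > 0"
  unfolding gap_prob_def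
proof (induction xs)
  case (Cons x xs)
  then have "K x > 0" by (intro K_pos) auto
  with Cons show ?case by simp
qed simp

lemma gap_prob_append [simp]: "gap_prob (xs @ ys) = gap_prob xs * gap_prob ys" by (simp add: gap_prob_def)

lemma weight_pos: "0 \<notin> set xs \<Longrightarrow> weight h xs > 0" by (simp add: weight_def gap_prob_pos)

lemma weight_Nil [simp]: "weight h [] = 1" by (simp add: weight_def gap_prob_def cov_mass_def)

lemma qweight_pos: "0 \<notin> set xs \<Longrightarrow> qweight h xs x > 0" by (simp add: qweight_def gap_prob_pos)

lemma qweight_eq: "0 \<notin> set xs \<Longrightarrow> qweight h xs x = (gap_prob xs * exp (h * real (length xs))) * exp (\<Sum>i\<in>points 0 xs. \<beta> * \<omega> i x)"
  by (simp add: qweight_def sum.distrib card_points_eq exp_add)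

lemma qweight_measurable [measurable]: "qweight h xs \<in> borel_measurable M"
  unfolding qweight_def by measurable

lemma qweight_expectation:
  assumes "0 \<notin> set xs"
  shows "integrable M (qweight h xs)" "expectation (qweight h xs) = weight h xs"
  using exp_moment_points[OF finite_points[of 0 xs], where \<beta> = \<beta>] unfolding qweight_eq[OF assms, abs_def]
  by (auto simp: weight_def exp_add)

lemma cov_mass_points_append:
  assumes "0 \<notin> set xs" "0 \<notin> set ys"
  shows "\<bar>cov_mass (points 0 (xs @ ys)) - cov_mass (points 0 xs) - cov_mass (points 0 ys)\<bar> \<le> 2 * (real q)\<^sup>2"
proof -
  have "points 0 xs \<subseteq> {..int (sum_list xs)}" "points (int (sum_list xs)) ys \<subseteq> {int (sum_list xs)<..}"
    using points_subset[OF assms(1), of 0] points_subset[OF assms(2), of "int (sum_list xs)"] by force+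
  from cov_mass_Un[OF _ _ this]
  have "\<bar>cov_mass (points 0 (xs @ ys)) - cov_mass (points 0 xs) - cov_mass (points (int (sum_list xs)) ys)\<bar> \<le> 2 * (real q)\<^sup>2"
    by (simp add: points_append)
  moreover have "cov_mass (points (int (sum_list xs)) ys) = cov_mass (points 0 ys)"
    using points_translate[of "int (sum_list xs)" 0 ys] cov_mass_translate by simp
  ultimately show ?thesis by simp
qed

lemma weight_append:
  assumes "0 \<notin> set xs" "0 \<notin> set ys"
  shows "weight h (xs @ ys) \<le> split_const * weight h xs * weight h ys" "weight h xs * weight h ys \<le> split_const * weight h (xs @ ys)"
proof -
  define u v w where "u = cov_mass (points 0 xs)" and "v = cov_mass (points 0 ys)" and "w = cov_mass (points 0 (xs @ ys))"
  have q: "\<bar>w - u - v\<bar> \<le> 2 * (real q)\<^sup>2"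
    unfolding u_def v_def w_def by (rule cov_mass_points_append[OF assms])
  have k: "gap_prob xs * gap_prob ys \<ge> 0" using gap_prob_pos assms by (simp add: less_imp_le)
  have b: "\<beta>\<^sup>2 * w \<le> \<beta>\<^sup>2 * (2 * (real q)\<^sup>2 + u + v)" "\<beta>\<^sup>2 * (u + v) \<le> \<beta>\<^sup>2 * (2 * (real q)\<^sup>2 + w)"
    using q by (auto intro!: mult_left_mono)
  have "weight h (xs @ ys) = (gap_prob xs * gap_prob ys) * exp (h * real (length xs) + h * real (length ys) + \<beta>\<^sup>2 / 2 * w)"
    by (simp add: weight_def w_def algebra_simps)
  also have "\<dots> \<le> (gap_prob xs * gap_prob ys) * exp (\<beta>\<^sup>2 * (real q)\<^sup>2 + (h * real (length xs) + \<beta>\<^sup>2 / 2 * u) + (h * real (length ys) + \<beta>\<^sup>2 / 2 * v))"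
    using b(1) k by (intro mult_left_mono) (auto simp: algebra_simps)
  also have "\<dots> = split_const * weight h xs * weight h ys"
    by (simp add: weight_def split_const_def u_def v_def exp_add)
  finally show "weight h (xs @ ys) \<le> split_const * weight h xs * weight h ys" .
  have "weight h xs * weight h ys = (gap_prob xs * gap_prob ys) * exp ((h * real (length xs) + \<beta>\<^sup>2 / 2 * u) + (h * real (length ys) + \<beta>\<^sup>2 / 2 * v))"
    by (simp add: weight_def u_def v_def exp_add)
  also have "\<dots> \<le> (gap_prob xs * gap_prob ys) * exp (\<beta>\<^sup>2 * (real q)\<^sup>2 + (h * real (length xs) + h * real (length ys) + \<beta>\<^sup>2 / 2 * w))"
    using b(2) k by (intro mult_left_mono) (auto simp: algebra_simps)
  also have "\<dots> = split_const * weight h (xs @ ys)"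
    by (simp add: weight_def split_const_def w_def exp_add algebra_simps)
  finally show "weight h xs * weight h ys \<le> split_const * weight h (xs @ ys)" .
qed

text \<open>
  The factor gained at an isolated site by a penalty of strength \<open>l\<close>.
\<close>
definition discount :: "real \<Rightarrow> real" where
  "discount l = exp (- (l * exp (1/2) * (cosh (\<beta> * \<rho> (int q)) - 1) / (real q + 1)))"

text \<open>
  The second-order cost per site, in units of \<open>l\<^sup>2\<close>.
\<close>
definition tilt_cost :: "nat \<Rightarrow> real" where
  "tilt_cost n = (1 + exp 2 * cosh (2 * (\<beta> * (2 * real q + 1)))) / 2 + 2 * 2 ^ n * exp ((real n)\<^sup>2 / 2)"

definition path_sum :: "real \<Rightarrow> nat list set \<Rightarrow> 'b \<Rightarrow> real" where
  "path_sum h Q x = (\<Sum>xs\<in>Q. qweight h xs x)"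

text \<open>
  The bound for a fractional moment obtained by penalising the sites in \<open>B\<close>.
\<close>
definition tilted_bound :: "nat \<Rightarrow> real \<Rightarrow> real \<Rightarrow> nat list set \<Rightarrow> int set \<Rightarrow> real" where
  "tilted_bound n l h Q B = (\<Sum>xs\<in>Q. weight h xs * discount l ^ card (isolated q (points 0 xs) \<inter> B)) powr (real n / (real n + 1))
      * exp (tilt_cost n * l\<^sup>2 * real (card B))"

lemma path_sum_measurable [measurable]: "path_sum h Q \<in> borel_measurable M"
  unfolding path_sum_def by measurable

lemma discount_pos: "discount l > 0" by (simp add: discount_def)
lemma discount_le_1: "l > 0 \<Longrightarrow> discount l \<le> 1"
  using cosh_real_ge_1[of "\<beta> * \<rho> (int q)"] by (simp add: discount_def)

lemma weight_tilt_le: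
  assumes xs: "0 \<notin> set xs" and B: "finite B" and l: "l > 0"
    and small: "l * exp (1/2) * cosh (\<beta> * (2 * real q + 1)) \<le> 1"
  shows "integrable M (\<lambda>x. qweight h xs x * (\<Prod>j\<in>B. (1 / (1 + l * cosh (\<omega> j x))) powr (1 / (real q + 1))))"
    and "expectation (\<lambda>x. qweight h xs x * (\<Prod>j\<in>B. (1 / (1 + l * cosh (\<omega> j x))) powr (1 / (real q + 1))))
       \<le> weight h xs * discount l ^ card (isolated q (points 0 xs) \<inter> B) *
         exp (real (card B) * (- l * exp (1/2) + l\<^sup>2 * ((1 + exp 2 * cosh (2 * (\<beta> * (2 * real q + 1)))) / 2)) / (real q + 1))"
proof -
  define C1 where "C1 = (1 + exp 2 * cosh (2 * (\<beta> * (2 * real q + 1)))) / 2"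
  define D where "D = real q + 1"
  define k where "k = l * exp (1/2)"
  define G where "G = isolated q (points 0 xs) \<inter> B"
  define m where "m j = cosh (\<beta> * cov_sum (points 0 xs) j) - 1" for j
  have D: "D > 0" by (simp add: D_def)
  have k: "k > 0" using l by (simp add: k_def)
  note t = tilted_exp_le[OF finite_points[of 0 xs] B l beta_pos small]
  define E where "E = expectation (\<lambda>x. exp (\<Sum>i\<in>points 0 xs. \<beta> * \<omega> i x) * (\<Prod>j\<in>B. (1 / (1 + l * cosh (\<omega> j x))) powr (1 / (real q + 1))))"
  show "integrable M (\<lambda>x. qweight h xs x * (\<Prod>j\<in>B. (1 / (1 + l * cosh (\<omega> j x))) powr (1 / (real q + 1))))"
    unfolding qweight_eq[OF xs] mult.assoc[of "gap_prob xs * exp (h * real (length xs))"] using t(1) by simp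
  have "expectation (\<lambda>x. qweight h xs x * (\<Prod>j\<in>B. (1 / (1 + l * cosh (\<omega> j x))) powr (1 / (real q + 1))))
      = (gap_prob xs * exp (h * real (length xs))) * E"
    unfolding qweight_eq[OF xs] mult.assoc[of "gap_prob xs * exp (h * real (length xs))"] E_def by simp
  also have "E \<le> exp (\<beta>\<^sup>2 * cov_mass (points 0 xs) / 2 + (\<Sum>j\<in>B. - l * exp (1/2) * cosh (\<beta> * cov_sum (points 0 xs) j) + l\<^sup>2 * C1) / D)"
    using t(2) unfolding E_def C1_def D_def .
  also have "(\<Sum>j\<in>B. - l * exp (1/2) * cosh (\<beta> * cov_sum (points 0 xs) j) + l\<^sup>2 * C1)
      = real (card B) * (- k + l\<^sup>2 * C1) - k * (\<Sum>j\<in>B. m j)"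
    by (simp add: sum.distrib sum_subtractf sum_negf sum_distrib_left m_def k_def algebra_simps)
  also have "\<dots> \<le> real (card B) * (- k + l\<^sup>2 * C1) - k * (real (card G) * (cosh (\<beta> * \<rho> (int q)) - 1))"
  proof -
    have "(\<Sum>j\<in>G. m j) \<le> (\<Sum>j\<in>B. m j)"
      using B by (intro sum_mono2) (auto simp: G_def m_def cosh_real_ge_1)
    moreover have "(\<Sum>j\<in>G. m j) = real (card G) * (cosh (\<beta> * \<rho> (int q)) - 1)"
      using cov_sum_isolated[OF finite_points, of _ 0 xs] by (simp add: G_def m_def)
    ultimately show ?thesis using k by (simp add: mult_left_mono)
  qed
  also have "exp (\<beta>\<^sup>2 * cov_mass (points 0 xs) / 2 + (real (card B) * (- k + l\<^sup>2 * C1) - k * (real (card G) * (cosh (\<beta> * \<rho> (int q)) - 1))) / D)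
     = exp (\<beta>\<^sup>2 / 2 * cov_mass (points 0 xs)) * discount l ^ card G * exp (real (card B) * (- k + l\<^sup>2 * C1) / D)"
  proof -
    have "discount l ^ card G = exp (real (card G) * (- (k * (cosh (\<beta> * \<rho> (int q)) - 1) / D)))"
      by (simp only: discount_def exp_of_nat_mult k_def D_def)
    then show ?thesis using D
      by (simp add: exp_add[symmetric] add_divide_distrib diff_divide_distrib algebra_simps)
  qed
  finally show "expectation (\<lambda>x. qweight h xs x * (\<Prod>j\<in>B. (1 / (1 + l * cosh (\<omega> j x))) powr (1 / (real q + 1))))
       \<le> weight h xs * discount l ^ card (isolated q (points 0 xs) \<inter> B) *
         exp (real (card B) * (- l * exp (1/2) + l\<^sup>2 * ((1 + exp 2 * cosh (2 * (\<beta> * (2 * real q + 1)))) / 2)) / (real q + 1))"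
    using gap_prob_pos[OF xs] D
    by (simp add: weight_def G_def D_def C1_def k_def exp_add mult_left_mono divide_right_mono mult_ac)
qed

text \<open>
  Hoelder's inequality with exponents \<open>n/(n+1)\<close> and \<open>1/(n+1)\<close> between the penalised partition sum and the
  \<open>n\<close>-th power of the inverse penalty. The two contributions of first order in \<open>l\<close> cancel exactly, because
  \<open>n/(n+1) = n * (1 - n/(n+1))\<close>.
\<close>
lemma fractional_moment:
  assumes Q: "finite Q" "Q \<noteq> {}" "\<And>xs. xs \<in> Q \<Longrightarrow> 0 \<notin> set xs" and B: "finite B"
    and l: "l > 0" "l \<le> 1" and n: "n \<ge> (1::nat)"
    and small: "l * exp (1/2) * cosh (\<beta> * (2 * real q + 1)) \<le> 1"
  shows "integrable M (\<lambda>x. path_sum h Q x powr (real n / (real n + 1)))"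
    and "expectation (\<lambda>x. path_sum h Q x powr (real n / (real n + 1))) \<le> tilted_bound n l h Q B"
proof -
  define \<gamma> where "\<gamma> = real n / (real n + 1)"
  define D where "D = real q + 1"
  define k where "k = l * exp (1/2)"
  define C1 where "C1 = (1 + exp 2 * cosh (2 * (\<beta> * (2 * real q + 1)))) / 2"
  define C2 where "C2 = 2 * 2 ^ n * exp ((real n)\<^sup>2 / 2)"
  define y where "y j x = 1 + l * cosh (\<omega> j x)" for j x
  define V where "V x = path_sum h Q x * (\<Prod>j\<in>B. (1 / y j x) powr (1 / D))" for x
  define R where "R x = (\<Prod>j\<in>B. (y j x ^ n) powr (1 / D))" for x
  define W where "W = (\<Sum>xs\<in>Q. weight h xs * discount l ^ card (isolated q (points 0 xs) \<inter> B))"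
  have D: "D \<ge> 1" by (simp add: D_def)
  have g: "\<gamma> > 0" "\<gamma> < 1" "1 - \<gamma> = 1 / (real n + 1)" "\<gamma> = real n * (1 - \<gamma>)"
    using n by (auto simp: \<gamma>_def field_simps)
  have y: "y j x > 0" for j x using l cosh_real_pos[of "\<omega> j x"] by (simp add: y_def add_pos_pos)
  have pfp: "path_sum h Q x > 0" for x unfolding path_sum_def using Q qweight_pos by (intro sum_pos) auto
  have Vp: "V x > 0" for x unfolding V_def using pfp y[of _ x]
    by (intro mult_pos_pos prod_pos) (auto simp: less_imp_neq[symmetric])
  have Rp: "R x > 0" for x unfolding R_def using y[of _ x]
    by (intro prod_pos) (auto simp: less_imp_neq[symmetric])
  have Veq: "V x = (\<Sum>xs\<in>Q. qweight h xs x * (\<Prod>j\<in>B. (1 / y j x) powr (1 / D)))" for x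
    by (simp add: V_def path_sum_def sum_distrib_right)
  have Vint: "integrable M V"
    unfolding Veq[abs_def] y_def D_def using weight_tilt_le(1)[OF _ B l(1) small] Q by auto
  have EV: "expectation V \<le> W * exp (real (card B) * (- k + l\<^sup>2 * C1) / D)"
  proof -
    have "expectation V = (\<Sum>xs\<in>Q. expectation (\<lambda>x. qweight h xs x * (\<Prod>j\<in>B. (1 / y j x) powr (1 / D))))"
      unfolding Veq[abs_def] y_def D_def using weight_tilt_le(1)[OF _ B l(1) small] Q
      by (intro Bochner_Integration.integral_sum) auto
    also have "\<dots> \<le> (\<Sum>xs\<in>Q. weight h xs * discount l ^ card (isolated q (points 0 xs) \<inter> B) * exp (real (card B) * (- k + l\<^sup>2 * C1) / D))"
      unfolding y_def D_def k_def C1_def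
      using weight_tilt_le(2)[OF _ B l(1) small] Q by (intro sum_mono) simp
    finally show ?thesis by (simp add: W_def sum_distrib_right)
  qed
  have Rint: "integrable M R" and ER: "expectation R \<le> exp (real (card B) * (real n * k + l\<^sup>2 * C2) / D)"
    using tilt_dual_le[OF B l n] unfolding R_def y_def D_def k_def C2_def by (auto simp: mult.assoc)
  define X where "X i = (if i = (0::nat) then V else R)" for i
  define w where "w i = (if i = (0::nat) then \<gamma> else 1 - \<gamma>)" for i
  have prodX: "(\<Prod>i\<in>{0, 1}. X i x powr w i) = path_sum h Q x powr \<gamma>" for x
  proof -
    have "V x powr \<gamma> * R x powr (1 - \<gamma>)
        = path_sum h Q x powr \<gamma> * (\<Prod>j\<in>B. ((1 / y j x) powr (1 / D)) powr \<gamma> * ((y j x ^ n) powr (1 / D)) powr (1 - \<gamma>))"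
      unfolding V_def R_def using pfp[of x] y[of _ x]
      by (simp add: powr_mult prod_powr_distrib[symmetric] prod_nonneg less_imp_le prod.distrib)
    also have "(\<Prod>j\<in>B. ((1 / y j x) powr (1 / D)) powr \<gamma> * ((y j x ^ n) powr (1 / D)) powr (1 - \<gamma>)) = (\<Prod>j\<in>B. 1)"
    proof (intro prod.cong refl)
      fix j
      have "((1 / y j x) powr (1 / D)) powr \<gamma> = y j x powr (- (\<gamma> / D))"
        using y[of j x] by (simp add: powr_powr powr_divide powr_minus_divide)
      moreover have "((y j x ^ n) powr (1 / D)) powr (1 - \<gamma>) = y j x powr (real n * (1 - \<gamma>) / D)"
        using y[of j x] by (simp add: powr_powr powr_realpow[symmetric])
      moreover have "real n * (1 - \<gamma>) / D = \<gamma> / D" using g(4) by simp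
      ultimately show "((1 / y j x) powr (1 / D)) powr \<gamma> * ((y j x ^ n) powr (1 / D)) powr (1 - \<gamma>) = 1"
        using y[of j x] by (simp add: powr_add[symmetric])
    qed
    finally show ?thesis by (simp add: X_def w_def)
  qed
  have "w i \<ge> 0" "X i x > 0" "integrable M (X i)" for i x
    using g Vp Rp Vint Rint by (auto simp: w_def X_def)
  moreover have "(\<Sum>i\<in>{0, 1}. w i) = 1" by (simp add: w_def)
  ultimately have H: "integrable M (\<lambda>x. \<Prod>i\<in>{0, 1}. X i x powr w i)"
      "expectation (\<lambda>x. \<Prod>i\<in>{0, 1}. X i x powr w i) \<le> (\<Prod>i\<in>{0, 1}. expectation (X i) powr w i)"
    using holder_prod[of "{0, 1}" w X] by auto
  show "integrable M (\<lambda>x. path_sum h Q x powr (real n / (real n + 1)))"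
    using H(1) unfolding prodX by (simp add: \<gamma>_def)
  have W0: "W \<ge> 0" unfolding W_def using Q weight_pos discount_pos
    by (intro sum_nonneg mult_nonneg_nonneg) (auto intro: less_imp_le)
  have "expectation (\<lambda>x. path_sum h Q x powr \<gamma>) \<le> expectation V powr \<gamma> * expectation R powr (1 - \<gamma>)"
    using H(2) unfolding prodX by (simp add: X_def w_def)
  also have "\<dots> \<le> (W * exp (real (card B) * (- k + l\<^sup>2 * C1) / D)) powr \<gamma> *
       exp (real (card B) * (real n * k + l\<^sup>2 * C2) / D) powr (1 - \<gamma>)"
    using EV ER g Vp Rp
    by (intro mult_mono powr_mono2 integral_nonneg_AE AE_I2) (auto intro: less_imp_le)
  also have "\<dots> = W powr \<gamma> * exp (real (card B) / D * (\<gamma> * (- k + l\<^sup>2 * C1) + (1 - \<gamma>) * (real n * k + l\<^sup>2 * C2)))"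
  proof -
    have "b * u / D * \<gamma> + b * v / D * (1 - \<gamma>) = b / D * (\<gamma> * u + (1 - \<gamma>) * v)" for b u v
      by (simp add: divide_inverse algebra_simps)
    then have "exp (b * u / D) powr \<gamma> * exp (b * v / D) powr (1 - \<gamma>) = exp (b / D * (\<gamma> * u + (1 - \<gamma>) * v))" for b u v
      by (simp only: exp_powr_real exp_add[symmetric])
    then show ?thesis using W0 by (simp only: powr_mult mult.assoc exp_ge_zero)
  qed
  also have "\<gamma> * (- k + l\<^sup>2 * C1) + (1 - \<gamma>) * (real n * k + l\<^sup>2 * C2) = l\<^sup>2 * (\<gamma> * C1 + (1 - \<gamma>) * C2)"
  proof -
    have "(1 - \<gamma>) * (real n * k) = (real n * (1 - \<gamma>)) * k" by simp
    also have "\<dots> = \<gamma> * k" using g(4) by simp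
    finally show ?thesis by (simp add: algebra_simps)
  qed
  also have "real (card B) / D * (l\<^sup>2 * (\<gamma> * C1 + (1 - \<gamma>) * C2)) \<le> real (card B) * (l\<^sup>2 * (C1 + C2))"
  proof (rule mult_mono)
    show "real (card B) / D \<le> real (card B)" using D by (simp add: divide_le_eq mult_le_cancel_left1)
    have C: "C1 \<ge> 0" "C2 \<ge> 0" by (auto simp: C1_def C2_def intro!: add_nonneg_nonneg mult_nonneg_nonneg less_imp_le[OF cosh_real_pos])
    then have "\<gamma> * C1 \<le> 1 * C1" "(1 - \<gamma>) * C2 \<le> 1 * C2"
      using g(1,2) by (intro mult_right_mono; simp)+
    then have "\<gamma> * C1 \<le> C1" "(1 - \<gamma>) * C2 \<le> C2" by simp_all
    then show "l\<^sup>2 * (\<gamma> * C1 + (1 - \<gamma>) * C2) \<le> l\<^sup>2 * (C1 + C2)" by (intro mult_left_mono add_mono) auto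
    show "0 \<le> l\<^sup>2 * (\<gamma> * C1 + (1 - \<gamma>) * C2)" using C g(1,2)
      by (intro mult_nonneg_nonneg add_nonneg_nonneg) auto
  qed auto
  also have "W powr \<gamma> * exp (real (card B) * (l\<^sup>2 * (C1 + C2))) = tilted_bound n l h Q B"
    by (simp add: tilted_bound_def W_def \<gamma>_def tilt_cost_def C1_def C2_def mult_ac)
  finally show "expectation (\<lambda>x. path_sum h Q x powr (real n / (real n + 1))) \<le> tilted_bound n l h Q B"
    by (simp add: \<gamma>_def mult_left_mono)
qed

end

section \<open>Coarse graining\<close>

context pinning_model
begin

definition disc_mass :: "real \<Rightarrow> real \<Rightarrow> nat \<Rightarrow> real" where
  "disc_mass l h j = (\<Sum>p\<in>compositions j. weight h p * discount l ^ long_gaps q p)"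

lemma disc_mass_nonneg: "disc_mass l h j \<ge> 0"
  unfolding disc_mass_def using weight_pos discount_pos
  by (intro sum_nonneg mult_nonneg_nonneg) (auto simp: compositions_def intro: less_imp_le)

lemma card_isolated_append:
  assumes "0 \<notin> set xs" "0 \<notin> set p" "0 \<notin> set r" and a: "sum_list xs = a"
    and B: "finite B" "B \<subseteq> {0<..int a}"
  shows "card (isolated q (points 0 xs) \<inter> B) + long_gaps q p
    \<le> card (isolated q (points 0 (xs @ p @ r)) \<inter> (B \<union> {int a<..int a + int (sum_list p)}))"
proof -
  define A where "A = points 0 xs"
  define A' where "A' = A \<union> points (int a) p"
  define b where "b = int a + int (sum_list p)"
  define G where "G = isolated q (points 0 (xs @ p @ r))"
  have full: "points 0 (xs @ p @ r) = A' \<union> points b r"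
    by (simp add: points_append a A_def A'_def b_def Un_assoc)
  have Aa: "A \<subseteq> {..int a}" using points_subset[OF assms(1), of 0] a by (auto simp: A_def)
  have pb: "points (int a) p \<subseteq> {int a<..b}" using points_subset[OF assms(2)] by (simp add: b_def)
  have A'b: "A' \<subseteq> {..b}" using Aa pb by (force simp: A'_def b_def)
  have rb: "points b r \<subseteq> {b<..}" using points_subset[OF assms(3), of b] by auto
  have m2: "isolated q A' \<subseteq> G" unfolding G_def full by (rule isolated_mono[OF A'b rb])
  have "isolated q A \<subseteq> isolated q A'"
    unfolding A'_def by (rule isolated_mono[OF Aa]) (use pb in auto)
  then have m1: "isolated q A \<subseteq> G" using m2 by auto
  have finG: "finite G" unfolding G_def by (rule finite_isolated) simp
  have "long_gaps q p \<le> card (isolated q A' \<inter> {int a<..b})"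
    unfolding A'_def b_def by (rule long_gaps_le_card_isolated[OF _ Aa assms(2)]) (simp add: A_def)
  also have "\<dots> \<le> card (G \<inter> {int a<..b})" using m2 finG by (intro card_mono) auto
  finally have 2: "long_gaps q p \<le> card (G \<inter> {int a<..b})" .
  have 1: "card (isolated q A \<inter> B) \<le> card (G \<inter> B)" using m1 finG by (intro card_mono) auto
  have "card (G \<inter> (B \<union> {int a<..b})) = card (G \<inter> B) + card (G \<inter> {int a<..b})"
    unfolding Int_Un_distrib using finG B by (intro card_Un_disjoint) auto
  then show ?thesis using 1 2 by (simp add: A_def G_def b_def)
qed

text \<open>
  Extending all paths by a stretch \<open>p\<close> of length \<open>j\<close>, and then by \<open>r\<close>, while also penalising the sites of
  the stretch: the bound factorises, since the isolated sites found so far survive the extension and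
  the long gaps of \<open>p\<close> create new ones.
\<close>
lemma tilted_bound_concats:
  assumes Q: "finite Q" "\<And>xs. xs \<in> Q \<Longrightarrow> 0 \<notin> set xs \<and> sum_list xs = a"
    and B: "finite B" "B \<subseteq> {0<..int a}" and l: "l > 0" and r: "0 \<notin> set r"
  shows "tilted_bound n l h (concats Q ((\<lambda>p. p @ r) ` compositions j)) (B \<union> {int a<..int a + int j})
    \<le> tilted_bound n l h Q B * ((\<Sum>p\<in>compositions j. split_const * weight h (p @ r) * discount l ^ long_gaps q p) powr (real n / (real n + 1))
        * exp (tilt_cost n * l\<^sup>2 * real j))"
proof -
  define \<gamma> where "\<gamma> = real n / (real n + 1)"
  have g: "\<gamma> \<ge> 0" by (simp add: \<gamma>_def)
  define B' where "B' = B \<union> {int a<..int a + int j}"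
  have cB: "card B' = card B + j"
    unfolding B'_def using B by (subst card_Un_disjoint) auto
  define N where "N xs = card (isolated q (points 0 xs) \<inter> B)" for xs
  have th: "0 \<le> discount l" "discount l \<le> 1" using discount_pos[of l] discount_le_1[OF l] by auto
  have "(\<Sum>ys\<in>concats Q ((\<lambda>p. p @ r) ` compositions j). weight h ys * discount l ^ card (isolated q (points 0 ys) \<inter> B'))
      = (\<Sum>xs\<in>Q. \<Sum>p\<in>compositions j. weight h (xs @ p @ r) * discount l ^ card (isolated q (points 0 (xs @ p @ r)) \<inter> B'))"
    by (subst sum_concats[OF Q(2)]) (auto simp: sum.reindex inj_on_def)
  also have "\<dots> \<le> (\<Sum>xs\<in>Q. \<Sum>p\<in>compositions j. (weight h xs * discount l ^ N xs) * (split_const * weight h (p @ r) * discount l ^ long_gaps q p))"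
  proof (intro sum_mono)
    fix xs p assume xs: "xs \<in> Q" and p: "p \<in> compositions j"
    have pos: "0 \<notin> set xs" "0 \<notin> set p" "0 \<notin> set (p @ r)" "sum_list p = j"
      using Q(2)[OF xs] p r by (auto simp: compositions_def)
    have "weight h (xs @ p @ r) \<le> split_const * weight h xs * weight h (p @ r)" by (rule weight_append(1)[OF pos(1,3)])
    moreover have "discount l ^ card (isolated q (points 0 (xs @ p @ r)) \<inter> B') \<le> discount l ^ (N xs + long_gaps q p)"
      using card_isolated_append[OF pos(1,2) r _ B] Q(2)[OF xs] th
      by (intro power_decreasing) (simp_all add: N_def B'_def pos)
    ultimately have "weight h (xs @ p @ r) * discount l ^ card (isolated q (points 0 (xs @ p @ r)) \<inter> B')
       \<le> (split_const * weight h xs * weight h (p @ r)) * discount l ^ (N xs + long_gaps q p)"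
      using th weight_pos[of "xs @ p @ r" h] pos r weight_pos[of xs h] weight_pos[of "p @ r" h] split_const_ge_1
      by (intro mult_mono) (auto intro!: mult_nonneg_nonneg less_imp_le)
    then show "weight h (xs @ p @ r) * discount l ^ card (isolated q (points 0 (xs @ p @ r)) \<inter> B')
       \<le> (weight h xs * discount l ^ N xs) * (split_const * weight h (p @ r) * discount l ^ long_gaps q p)"
      by (simp add: power_add mult_ac)
  qed
  also have "\<dots> = (\<Sum>xs\<in>Q. weight h xs * discount l ^ N xs) * (\<Sum>p\<in>compositions j. split_const * weight h (p @ r) * discount l ^ long_gaps q p)"
    by (simp add: sum_product)
  finally have le: "(\<Sum>ys\<in>concats Q ((\<lambda>p. p @ r) ` compositions j). weight h ys * discount l ^ card (isolated q (points 0 ys) \<inter> B'))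
      \<le> (\<Sum>xs\<in>Q. weight h xs * discount l ^ N xs) * (\<Sum>p\<in>compositions j. split_const * weight h (p @ r) * discount l ^ long_gaps q p)" .
  have nn: "0 \<le> (\<Sum>ys\<in>concats Q ((\<lambda>p. p @ r) ` compositions j). weight h ys * discount l ^ card (isolated q (points 0 ys) \<inter> B'))"
  proof (intro sum_nonneg mult_nonneg_nonneg)
    fix ys assume "ys \<in> concats Q ((\<lambda>p. p @ r) ` compositions j)"
    then have "0 \<notin> set ys" using Q(2) r by (auto elim!: concats_E simp: compositions_def)
    then show "0 \<le> weight h ys" using weight_pos by (auto intro: less_imp_le)
  qed (use th in simp)
  have n1: "0 \<le> (\<Sum>xs\<in>Q. weight h xs * discount l ^ N xs)"
    using Q(2) weight_pos th by (intro sum_nonneg mult_nonneg_nonneg) (auto intro: less_imp_le)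
  have n2: "0 \<le> (\<Sum>p\<in>compositions j. split_const * weight h (p @ r) * discount l ^ long_gaps q p)"
    using r weight_pos th split_const_ge_1
    by (intro sum_nonneg mult_nonneg_nonneg) (auto simp: compositions_def intro: less_imp_le)
  have "tilted_bound n l h (concats Q ((\<lambda>p. p @ r) ` compositions j)) B'
      \<le> ((\<Sum>xs\<in>Q. weight h xs * discount l ^ N xs) * (\<Sum>p\<in>compositions j. split_const * weight h (p @ r) * discount l ^ long_gaps q p)) powr \<gamma>
          * exp (tilt_cost n * l\<^sup>2 * real (card B'))"
    unfolding tilted_bound_def \<gamma>_def[symmetric] using le nn g by (intro mult_right_mono powr_mono2) auto
  also have "\<dots> = tilted_bound n l h Q B * ((\<Sum>p\<in>compositions j. split_const * weight h (p @ r) * discount l ^ long_gaps q p) powr \<gamma>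
        * exp (tilt_cost n * l\<^sup>2 * real j))"
    using n1 n2 by (simp add: tilted_bound_def \<gamma>_def[symmetric] N_def cB powr_mult exp_add distrib_left)
  finally show ?thesis by (simp add: B'_def \<gamma>_def)
qed

text \<open>
  Each step cuts the remaining paths at the gap that straddles level \<open>k\<close> and takes the power inside the
  sum. The expectation is not factorised at the cuts: the whole past is carried along in \<open>Q\<close> and \<open>B\<close>, and
  Hoelder's inequality is applied once, when less than \<open>k\<close> remains. Thus correlations across
  the cuts are dealt with by almost-multiplicativity of the weights alone. The sites of the straddling
  gaps stay unpenalised, so that a stretch is charged for fewer than \<open>k\<close> sites.
\<close>
theorem coarse_graining:
  assumes l: "l > 0" "l \<le> 1" and n: "n \<ge> (1::nat)" and k: "k \<ge> (1::nat)"
    and small: "l * exp (1/2) * cosh (\<beta> * (2 * real q + 1)) \<le> 1"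
    and H1: "\<And>N. N < k \<Longrightarrow> (split_const * disc_mass l h N) powr (real n / (real n + 1)) * exp (tilt_cost n * l\<^sup>2 * real N) \<le> Ub"
    and H2: "\<And>N. (\<Sum>(j, d)\<in>straddling k N. (split_const\<^sup>2 * disc_mass l h j * weight h [d]) powr (real n / (real n + 1))
              * exp (tilt_cost n * l\<^sup>2 * real j)) \<le> 1"
    and Q: "finite Q" "Q \<noteq> {}" "\<And>xs. xs \<in> Q \<Longrightarrow> 0 \<notin> set xs \<and> sum_list xs = a"
    and B: "finite B" "B \<subseteq> {0<..int a}"
  shows "expectation (\<lambda>x. path_sum h (concats Q (compositions N)) x powr (real n / (real n + 1))) \<le> tilted_bound n l h Q B * Ub"
  using Q B
proof (induction N arbitrary: Q B a rule: less_induct)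
  case (less N)
  note Q = less.prems(1-3) and B = less.prems(4,5)
  define \<gamma> where "\<gamma> = real n / (real n + 1)"
  have g: "\<gamma> > 0" "\<gamma> \<le> 1" using n by (auto simp: \<gamma>_def)
  have phi0: "tilted_bound n l h Q B \<ge> 0" by (simp add: tilted_bound_def)
  have fm: "integrable M (\<lambda>x. path_sum h (concats Q' P) x powr \<gamma>)"
      "finite B' \<Longrightarrow> expectation (\<lambda>x. path_sum h (concats Q' P) x powr \<gamma>) \<le> tilted_bound n l h (concats Q' P) B'"
    if "finite Q'" "Q' \<noteq> {}" "\<And>xs. xs \<in> Q' \<Longrightarrow> 0 \<notin> set xs"
      "finite P" "P \<noteq> {}" "\<And>xs. xs \<in> P \<Longrightarrow> 0 \<notin> set xs" for Q' P B'
  proof -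
    have "finite (concats Q' P)" "concats Q' P \<noteq> {}" "\<And>xs. xs \<in> concats Q' P \<Longrightarrow> 0 \<notin> set xs"
      using that by (auto simp: concats_def)
    from fractional_moment[OF this _ l n small] fractional_moment(1)[OF this finite.emptyI l n small]
    show "integrable M (\<lambda>x. path_sum h (concats Q' P) x powr \<gamma>)"
      "finite B' \<Longrightarrow> expectation (\<lambda>x. path_sum h (concats Q' P) x powr \<gamma>) \<le> tilted_bound n l h (concats Q' P) B'"
      unfolding \<gamma>_def by auto
  qed
  have cpos: "0 \<notin> set ys" if "ys \<in> compositions m" for ys m using that by (simp add: compositions_def)
  show ?case
  proof (cases "N < k")
    case True
    have "expectation (\<lambda>x. path_sum h (concats Q (compositions N)) x powr \<gamma>)
        \<le> tilted_bound n l h (concats Q (compositions N)) (B \<union> {int a<..int a + int N})"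
      using Q B compositions_nonempty cpos by (intro fm) auto
    also have "\<dots> \<le> tilted_bound n l h Q B * ((\<Sum>p\<in>compositions N. split_const * weight h p * discount l ^ long_gaps q p) powr \<gamma> * exp (tilt_cost n * l\<^sup>2 * real N))"
      using tilted_bound_concats[OF Q(1,3) B l(1), of "[]" n h N] unfolding \<gamma>_def by simp
    also have "(\<Sum>p\<in>compositions N. split_const * weight h p * discount l ^ long_gaps q p) = split_const * disc_mass l h N"
      by (simp add: disc_mass_def sum_distrib_left mult_ac)
    also have "tilted_bound n l h Q B * ((split_const * disc_mass l h N) powr \<gamma> * exp (tilt_cost n * l\<^sup>2 * real N)) \<le> tilted_bound n l h Q B * Ub"
      using H1[OF True] phi0 unfolding \<gamma>_def by (rule mult_left_mono)
    finally show ?thesis by (simp add: \<gamma>_def)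
  next
    case False
    define R where "R j d = concats Q ((\<lambda>p. p @ [d]) ` compositions j)" for j d
    define T where "T j d x = path_sum h (concats (R j d) (compositions (N - j - d))) x" for j d x
    have d1: "d \<ge> 1" if "(j, d) \<in> straddling k N" for j d using that by (auto simp: straddling_def)
    have Rp: "finite (R j d)" "R j d \<noteq> {}" "\<And>xs. xs \<in> R j d \<Longrightarrow> 0 \<notin> set xs \<and> sum_list xs = a + j + d"
      if "d \<ge> 1" for j d
    proof -
      show "finite (R j d)" "R j d \<noteq> {}"
        using Q compositions_nonempty[of j] by (auto simp: R_def concats_def)
      fix xs assume "xs \<in> R j d"
      then show "0 \<notin> set xs \<and> sum_list xs = a + j + d"
        using Q(3) that by (auto simp: R_def compositions_def elim!: concats_E)
    qed
    have Teq: "T j d x = (\<Sum>xs\<in>Q. \<Sum>p\<in>compositions j. \<Sum>zs\<in>compositions (N - j - d). qweight h (xs @ p @ d # zs) x)"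
      if "d \<ge> 1" for j d x
    proof -
      have "T j d x = (\<Sum>xs\<in>R j d. \<Sum>zs\<in>compositions (N - j - d). qweight h (xs @ zs) x)"
        unfolding T_def path_sum_def by (rule sum_concats[OF Rp(3)[OF that]])
      then show ?thesis unfolding R_def
        by (simp add: sum_concats[OF Q(3)] sum.reindex inj_on_def)
    qed
    have Tpos: "T j d x \<ge> 0" if "d \<ge> 1" for j d x
    proof -
      have "0 \<notin> set (xs @ p @ d # zs)" if "xs \<in> Q" "p \<in> compositions j" "zs \<in> compositions (N - j - d)" for xs p zs
        using that \<open>d \<ge> 1\<close> Q(3) cpos by auto
      then show ?thesis unfolding Teq[OF that] using qweight_pos by (intro sum_nonneg) (auto intro: less_imp_le)
    qed
    have le: "path_sum h (concats Q (compositions N)) x \<le> (\<Sum>(j, d)\<in>straddling k N. T j d x)" for x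
    proof -
      have "path_sum h (concats Q (compositions N)) x = (\<Sum>xs\<in>Q. \<Sum>ys\<in>compositions N. qweight h (xs @ ys) x)"
        unfolding path_sum_def by (rule sum_concats[OF Q(3)])
      also have "\<dots> \<le> (\<Sum>xs\<in>Q. \<Sum>(j, d)\<in>straddling k N. \<Sum>p\<in>compositions j. \<Sum>zs\<in>compositions (N - j - d). qweight h (xs @ p @ d # zs) x)"
      proof (intro sum_mono)
        fix xs assume xs: "xs \<in> Q"
        \<comment> \<open>Set to \<open>0\<close> on lists that are not paths, where the sign of the weight is unknown.\<close>
        define f where "f ys = (if 0 \<in> set ys then 0 else qweight h (xs @ ys) x)" for ys
        have xs0: "0 \<notin> set xs" using Q(3)[OF xs] by simp
        have "(\<Sum>ys\<in>compositions N. qweight h (xs @ ys) x) = sum f (compositions N)"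
          by (intro sum.cong) (auto simp: f_def compositions_def)
        also have "\<dots> \<le> (\<Sum>(j, d)\<in>straddling k N. \<Sum>p\<in>compositions j. \<Sum>zs\<in>compositions (N - j - d). f (p @ d # zs))"
        proof (rule compositions_split_le)
          show "f ys \<ge> 0" for ys using qweight_pos[of "xs @ ys" h x] xs0 by (auto simp: f_def intro: less_imp_le)
        qed (use False k in auto)
        also have "\<dots> = (\<Sum>(j, d)\<in>straddling k N. \<Sum>p\<in>compositions j. \<Sum>zs\<in>compositions (N - j - d). qweight h (xs @ p @ d # zs) x)"
          using d1 cpos by (intro sum.cong refl) (fastforce simp: f_def intro!: sum.cong)+
        finally show "(\<Sum>ys\<in>compositions N. qweight h (xs @ ys) x) \<le> \<dots>" .
      qed
      also have "\<dots> = (\<Sum>(j, d)\<in>straddling k N. \<Sum>xs\<in>Q. \<Sum>p\<in>compositions j. \<Sum>zs\<in>compositions (N - j - d). qweight h (xs @ p @ d # zs) x)"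
        unfolding split_def by (rule sum.swap)
      also have "\<dots> = (\<Sum>(j, d)\<in>straddling k N. T j d x)"
        using d1 by (intro sum.cong refl) (auto simp: Teq)
      finally show ?thesis .
    qed
    have pf0: "path_sum h (concats Q (compositions N)) x \<ge> 0" for x
      unfolding path_sum_def using Q(3) qweight_pos cpos
      by (intro sum_nonneg) (auto elim!: concats_E intro!: less_imp_le)
    have pw: "path_sum h (concats Q (compositions N)) x powr \<gamma> \<le> (\<Sum>(j, d)\<in>straddling k N. T j d x powr \<gamma>)" for x
    proof -
      have "path_sum h (concats Q (compositions N)) x powr \<gamma> \<le> (\<Sum>jd\<in>straddling k N. T (fst jd) (snd jd) x) powr \<gamma>"
        using le[of x] pf0[of x] g by (intro powr_mono2) (auto simp: split_def)
      also have "\<dots> \<le> (\<Sum>jd\<in>straddling k N. T (fst jd) (snd jd) x powr \<gamma>)"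
        using Tpos d1 g by (intro sum_powr_le) auto
      finally show ?thesis by (simp add: split_def)
    qed
    have Tint: "integrable M (\<lambda>x. T j d x powr \<gamma>)" if "d \<ge> 1" for j d
      unfolding T_def using Rp[OF that] cpos compositions_nonempty by (intro fm) auto
    have "expectation (\<lambda>x. path_sum h (concats Q (compositions N)) x powr \<gamma>)
        \<le> expectation (\<lambda>x. \<Sum>(j, d)\<in>straddling k N. T j d x powr \<gamma>)"
      using Q cpos compositions_nonempty Tint d1 pw
      by (intro integral_mono fm Bochner_Integration.integrable_sum) (auto simp: split_def)
    also have "\<dots> = (\<Sum>(j, d)\<in>straddling k N. expectation (\<lambda>x. T j d x powr \<gamma>))"
      unfolding split_def using Tint d1 by (intro Bochner_Integration.integral_sum) auto
    also have "\<dots> \<le> (\<Sum>(j, d)\<in>straddling k N. (tilted_bound n l h Q B * Ub) * ((split_const\<^sup>2 * disc_mass l h j * weight h [d]) powr \<gamma>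
              * exp (tilt_cost n * l\<^sup>2 * real j)))"
    proof (intro sum_mono, clarify)
      fix j d assume jd: "(j, d) \<in> straddling k N"
      have d: "d \<ge> 1" using d1[OF jd] .
      have "N - j - d < N" using d jd by (auto simp: straddling_def)
      then have "expectation (\<lambda>x. T j d x powr \<gamma>) \<le> tilted_bound n l h (R j d) (B \<union> {int a<..int a + int j}) * Ub"
        unfolding T_def \<gamma>_def
        by (rule less.IH[OF _ Rp(1)[OF d] Rp(2)[OF d] Rp(3)[OF d]]) (use B in auto)
      also have "\<dots> \<le> (tilted_bound n l h Q B * ((\<Sum>p\<in>compositions j. split_const * weight h (p @ [d]) * discount l ^ long_gaps q p) powr \<gamma>
            * exp (tilt_cost n * l\<^sup>2 * real j))) * Ub"
      proof (rule mult_right_mono)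
        show "tilted_bound n l h (R j d) (B \<union> {int a<..int a + int j}) \<le> tilted_bound n l h Q B *
            ((\<Sum>p\<in>compositions j. split_const * weight h (p @ [d]) * discount l ^ long_gaps q p) powr \<gamma> * exp (tilt_cost n * l\<^sup>2 * real j))"
          unfolding R_def \<gamma>_def using tilted_bound_concats[OF Q(1,3) B l(1), of "[d]" n h j] d by simp
        show "0 \<le> Ub" using H1[of 0] k by (rule_tac order_trans[OF _ H1[of 0]]) auto
      qed
      also have "\<dots> \<le> (tilted_bound n l h Q B * ((split_const\<^sup>2 * disc_mass l h j * weight h [d]) powr \<gamma> * exp (tilt_cost n * l\<^sup>2 * real j))) * Ub"
      proof (intro mult_right_mono mult_left_mono powr_mono2)
        show "0 \<le> Ub" using H1[of 0] k by (rule_tac order_trans[OF _ H1[of 0]]) auto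
        show "0 \<le> (\<Sum>p\<in>compositions j. split_const * weight h (p @ [d]) * discount l ^ long_gaps q p)"
          using d weight_pos discount_pos split_const_ge_1 cpos
          by (intro sum_nonneg mult_nonneg_nonneg) (auto intro: less_imp_le)
        have "(\<Sum>p\<in>compositions j. split_const * weight h (p @ [d]) * discount l ^ long_gaps q p)
            \<le> (\<Sum>p\<in>compositions j. split_const * (split_const * weight h p * weight h [d]) * discount l ^ long_gaps q p)"
          using d weight_append(1)[of _ "[d]" h] cpos split_const_ge_1 discount_pos[of l]
          by (intro sum_mono mult_right_mono mult_left_mono) auto
        also have "\<dots> = split_const\<^sup>2 * disc_mass l h j * weight h [d]"
          by (simp add: disc_mass_def sum_distrib_left sum_distrib_right power2_eq_square mult_ac)
        finally show "(\<Sum>p\<in>compositions j. split_const * weight h (p @ [d]) * discount l ^ long_gaps q p) \<le> split_const\<^sup>2 * disc_mass l h j * weight h [d]" .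
      qed (use g phi0 in auto)
      finally show "expectation (\<lambda>x. T j d x powr \<gamma>) \<le> (tilted_bound n l h Q B * Ub) * ((split_const\<^sup>2 * disc_mass l h j * weight h [d]) powr \<gamma>
              * exp (tilt_cost n * l\<^sup>2 * real j))" by (simp add: mult_ac)
    qed
    also have "\<dots> = (tilted_bound n l h Q B * Ub) * (\<Sum>(j, d)\<in>straddling k N. (split_const\<^sup>2 * disc_mass l h j * weight h [d]) powr \<gamma>
              * exp (tilt_cost n * l\<^sup>2 * real j))"
      by (simp add: sum_distrib_left split_def)
    also have "\<dots> \<le> (tilted_bound n l h Q B * Ub) * 1"
    proof (rule mult_left_mono)
      have "0 \<le> Ub" using H1[of 0] k by (rule_tac order_trans[OF _ H1[of 0]]) auto
      then show "0 \<le> tilted_bound n l h Q B * Ub" using phi0 by simp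
    qed (use H2[of N] in \<open>simp add: \<gamma>_def\<close>)
    finally show ?thesis by (simp add: \<gamma>_def)
  qed
qed

end

section \<open>Annealed weight at the critical point\<close>

text \<open>
  The power-mean inequality, from Young's inequality applied to \<open>a j\<close> divided by the average.
\<close>
lemma sum_powr_le_card:
  fixes a :: "nat \<Rightarrow> real"
  assumes a: "\<And>j. a j \<ge> 0" and g: "0 < g" "g < 1" and n: "n \<ge> 1"
  shows "(\<Sum>j<n. a j powr g) \<le> real n powr (1 - g) * (\<Sum>j<n. a j) powr g"
proof (cases "(\<Sum>j<n. a j) = 0")
  case True
  then have "a j = 0" if "j < n" for j using that a by (simp add: sum_nonneg_eq_0_iff)
  then have "(\<Sum>j<n. a j powr g) = 0" by (intro sum.neutral) auto
  then show ?thesis by simp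
next
  case False
  define A where "A = (\<Sum>j<n. a j) / real n"
  have S: "(\<Sum>j<n. a j) > 0" using False a sum_nonneg[of "{..<n}" a] by (simp add: less_le)
  then have A: "A > 0" using n by (simp add: A_def)
  have pt: "a j powr g \<le> A powr g * (g * (a j / A) + (1 - g))" for j
  proof (cases "a j = 0")
    case True
    then show ?thesis using g by simp
  next
    case False
    then have "a j > 0" using a[of j] by simp
    then have "(a j / A) powr g * 1 powr (1 - g) \<le> g * (a j / A) + (1 - g) * 1"
      using A g by (intro Youngs_inequality_0) auto
    then have "A powr g * (a j / A) powr g \<le> A powr g * (g * (a j / A) + (1 - g))"
      by (intro mult_left_mono) auto
    then show ?thesis using A a[of j] by (simp add: powr_divide)
  qed
  have "(\<Sum>j<n. a j powr g) \<le> (\<Sum>j<n. A powr g * (g * (a j / A) + (1 - g)))"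
    by (intro sum_mono pt)
  also have "\<dots> = A powr g * (g * ((\<Sum>j<n. a j) / A) + real n * (1 - g))"
    by (simp add: sum_distrib_left sum.distrib sum_divide_distrib distrib_left mult_ac)
  also have "(\<Sum>j<n. a j) / A = real n" using S n by (simp add: A_def)
  also have "A powr g * (g * real n + real n * (1 - g)) = real n powr (1 - g) * (\<Sum>j<n. a j) powr g"
    using S n by (simp add: A_def powr_divide powr_diff algebra_simps)
  finally show ?thesis .
qed

text \<open>
  The sum is compared with the integral; the induction step is the tangent inequality
  for the concave function \<open>t powr (1 - s)\<close> at \<open>t = 1\<close>.
\<close>
lemma sum_powr_neg_le:
  assumes s: "0 \<le> s" "s < 1"
  shows "(\<Sum>y\<in>{1..Y}. real y powr (- s)) \<le> real Y powr (1 - s) / (1 - s)"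
proof (induction Y)
  case (Suc Y)
  have step: "(1 - s) * real (Suc Y) powr (- s) \<le> real (Suc Y) powr (1 - s) - real Y powr (1 - s)"
  proof (cases "Y = 0")
    case True
    then show ?thesis using s by simp
  next
    case False
    define t where "t = real Y / real (Suc Y)"
    have t: "t > 0" using False by (simp add: t_def)
    have "t powr (1 - s) * 1 powr s \<le> (1 - s) * t + s * 1"
      using t s by (intro Youngs_inequality_0) auto
    then have "(1 - s) * (1 - t) \<le> 1 - t powr (1 - s)" by (simp add: algebra_simps)
    moreover have "1 - t = 1 / real (Suc Y)" by (simp add: t_def field_simps)
    moreover have "t powr (1 - s) = real Y powr (1 - s) / real (Suc Y) powr (1 - s)"
      by (simp add: t_def powr_divide)
    ultimately have "(1 - s) * (1 / real (Suc Y)) \<le> 1 - real Y powr (1 - s) / real (Suc Y) powr (1 - s)"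
      by simp
    then have "real (Suc Y) powr (1 - s) * ((1 - s) * (1 / real (Suc Y)))
        \<le> real (Suc Y) powr (1 - s) * (1 - real Y powr (1 - s) / real (Suc Y) powr (1 - s))"
      by (intro mult_left_mono) auto
    moreover have "real (Suc Y) powr (- s) = real (Suc Y) powr (1 - s) * (1 / real (Suc Y))"
      by (simp add: powr_diff powr_minus divide_inverse)
    ultimately show ?thesis by (simp add: right_diff_distrib mult_ac)
  qed
  have "(\<Sum>y\<in>{1..Suc Y}. real y powr (- s)) \<le> real Y powr (1 - s) / (1 - s) + real (Suc Y) powr (- s)"
    using Suc by simp
  also have "\<dots> \<le> real (Suc Y) powr (1 - s) / (1 - s)"
  proof -
    have "real (Suc Y) powr (- s) \<le> (real (Suc Y) powr (1 - s) - real Y powr (1 - s)) / (1 - s)"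
      using step s by (subst pos_le_divide_eq) (auto simp: mult.commute)
    then show ?thesis by (simp add: diff_divide_distrib)
  qed
  finally show ?case .
qed simp

context pinning_model
begin

text \<open>
  Paths that are cut right after their \<open>b\<close>-th long gap. For fixed \<open>b\<close> they form a prefix code, so their
  concatenations can be decoded.
\<close>
definition ends_long :: "nat \<Rightarrow> nat list \<Rightarrow> bool" where
  "ends_long b xs \<longleftrightarrow> 0 \<notin> set xs \<and> long_gaps q xs = b \<and> xs \<noteq> [] \<and> last xs > 2 * q"

lemma ends_long_decode:
  assumes "ends_long b xs" "ends_long b xs'" "xs @ ys = xs' @ ys'"
  shows "xs = xs' \<and> ys = ys'"
proof -
  have nil: "us = []" if "ends_long b (vs @ us)" "ends_long b vs" for us vs
  proof (rule ccontr)
    assume "us \<noteq> []"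
    then have "last us > 2 * q" "long_gaps q us = 0" using that by (auto simp: ends_long_def)
    moreover have "long_gaps q us \<ge> 1" if "last us > 2 * q"
      using that \<open>us \<noteq> []\<close> by (cases us rule: rev_cases) (auto simp: long_gaps_def)
    ultimately show False by simp
  qed
  from assms(3) obtain us where "xs = xs' @ us \<and> us @ ys = ys' \<or> xs @ us = xs' \<and> ys = us @ ys'"
    by (auto simp: append_eq_append_conv2)
  with nil[of xs us] nil[of xs' us] assms show ?thesis by auto
qed

definition annealed_mass :: "real \<Rightarrow> nat \<Rightarrow> real" where
  "annealed_mass h n = (\<Sum>xs\<in>compositions n. weight h xs)"

lemma annealed_mass_pos: "annealed_mass h n > 0"
  unfolding annealed_mass_def by (intro sum_pos finite_compositions compositions_nonempty weight_pos) (simp add: compositions_def)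

text \<open>
  Zero annealed free energy means subexponential growth, so any exponential damping in the length makes
  the total weight of all paths finite.
\<close>
lemma laplace_bound:
  assumes lim: "(\<lambda>n. ln (annealed_mass h n) / real n) \<longlonglongrightarrow> 0" and e: "e > 0"
  obtains C where "\<And>X. finite X \<Longrightarrow> (\<And>xs. xs \<in> X \<Longrightarrow> 0 \<notin> set xs) \<Longrightarrow>
      (\<Sum>xs\<in>X. weight h xs * exp (- e * real (sum_list xs))) \<le> C"
proof -
  define f where "f n = annealed_mass h n * exp (- e * real n)" for n
  have f0: "f n \<ge> 0" for n using annealed_mass_pos[of h n] by (simp add: f_def)
  have "eventually (\<lambda>n. ln (annealed_mass h n) / real n < e / 2) sequentially"
    using order_tendstoD(2)[OF lim, of "e / 2"] e by simp
  then have "eventually (\<lambda>n. norm (f n) \<le> exp (- e / 2) ^ n) sequentially"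
    using eventually_gt_at_top[of 0]
  proof eventually_elim
    case (elim n)
    then have "ln (annealed_mass h n) < e / 2 * real n" by (simp add: field_simps)
    then have "annealed_mass h n \<le> exp (e / 2 * real n)" using annealed_mass_pos[of h n] by (metis exp_le_cancel_iff exp_ln less_imp_le)
    then have "f n \<le> exp (e / 2 * real n) * exp (- e * real n)" by (simp add: f_def)
    also have "\<dots> = exp (- e / 2) ^ n" by (simp add: exp_add[symmetric] exp_of_nat_mult[symmetric] algebra_simps)
    finally show ?case using f0 by simp
  qed
  moreover have "summable (\<lambda>n. exp (- e / 2) ^ n)" using e by (intro summable_geometric) simp
  ultimately have sf: "summable f" by (rule summable_comparison_test_ev)
  show thesis
  proof (rule that[of "suminf f"])
    fix X :: "nat list set"
    assume X: "finite X" "\<And>xs. xs \<in> X \<Longrightarrow> 0 \<notin> set xs"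
    define m where "m = Suc (Max (insert 0 (sum_list ` X)))"
    have m: "sum_list xs < m" if "xs \<in> X" for xs
      unfolding m_def using X that by (auto simp: less_Suc_eq_le intro!: Max_ge)
    have "(\<Sum>xs\<in>X. weight h xs * exp (- e * real (sum_list xs)))
        = (\<Sum>n<m. \<Sum>xs\<in>{xs\<in>X. sum_list xs = n}. weight h xs * exp (- e * real (sum_list xs)))"
      using X m by (intro sum.group[symmetric]) auto
    also have "\<dots> \<le> (\<Sum>n<m. f n)"
    proof (rule sum_mono)
      fix n
      have "(\<Sum>xs\<in>{xs\<in>X. sum_list xs = n}. weight h xs * exp (- e * real (sum_list xs)))
          \<le> (\<Sum>xs\<in>compositions n. weight h xs * exp (- e * real n))"
      proof (rule order_trans[OF _ sum_mono2])
        show "{xs\<in>X. sum_list xs = n} \<subseteq> compositions n" using X by (auto simp: compositions_def)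
        show "0 \<le> weight h xs * exp (- e * real n)" if "xs \<in> compositions n - {xs\<in>X. sum_list xs = n}" for xs
          using that weight_pos[of xs h] by (simp add: compositions_def)
      qed auto
      then show "(\<Sum>xs\<in>{xs\<in>X. sum_list xs = n}. weight h xs * exp (- e * real (sum_list xs))) \<le> f n"
        by (simp add: f_def annealed_mass_def sum_distrib_right)
    qed
    also have "\<dots> \<le> suminf f" using f0 by (intro sum_le_suminf sf) auto
    finally show "(\<Sum>xs\<in>X. weight h xs * exp (- e * real (sum_list xs))) \<le> suminf f" .
  qed
qed

text \<open>
  Let \<open>v\<close> be the sum on the left. By unique decoding and almost-multiplicativity the \<open>j\<close>-fold
  concatenations have damped weight at least \<open>(v / split_const)\<close> to the power \<open>j\<close>, whereas all paths together
  have bounded damped weight.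
\<close>
lemma renewal_mass_le_laplace:
  assumes lim: "(\<lambda>n. ln (annealed_mass h n) / real n) \<longlonglongrightarrow> 0" and e: "e > 0"
    and X: "finite X" "\<And>xs. xs \<in> X \<Longrightarrow> ends_long b xs"
  shows "(\<Sum>xs\<in>X. weight h xs * exp (- e * real (sum_list xs))) \<le> split_const"
proof -
  define u where "u xs = weight h xs * exp (- e * real (sum_list xs))" for xs
  define v where "v = sum u X"
  define pw where "pw j = ((concats X) ^^ j) {[]}" for j
  obtain C where C: "\<And>X. finite X \<Longrightarrow> (\<And>xs. xs \<in> X \<Longrightarrow> 0 \<notin> set xs) \<Longrightarrow> sum u X \<le> C"
    using laplace_bound[OF lim e] unfolding u_def by blast
  have X0: "0 \<notin> set xs" if "xs \<in> X" for xs using X(2)[OF that] by (simp add: ends_long_def)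
  have pw: "finite (pw j) \<and> (\<forall>xs\<in>pw j. 0 \<notin> set xs)" for j
  proof (induction j)
    case (Suc j)
    have e: "pw (Suc j) = concats X (pw j)" by (simp add: pw_def)
    have "0 \<notin> set zs" if zs: "zs \<in> concats X (pw j)" for zs
    proof -
      from zs obtain xs ys where "xs \<in> X" "ys \<in> pw j" "zs = xs @ ys" by (rule concats_E)
      then show ?thesis using X0 Suc by simp
    qed
    then show ?case unfolding e using Suc X(1) by (auto intro: finite_concats)
  qed (simp add: pw_def)
  have u0: "u xs > 0" if "0 \<notin> set xs" for xs using weight_pos[OF that, of h] by (simp add: u_def)
  have v0: "v \<ge> 0" unfolding v_def using X0 u0 by (intro sum_nonneg) (auto intro: less_imp_le)
  have S: "(v / split_const) ^ j \<le> sum u (pw j)" for j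
  proof (induction j)
    case 0
    then show ?case by (simp add: pw_def u_def)
  next
    case (Suc j)
    have inj: "inj_on (\<lambda>(xs, ys). xs @ ys) (X \<times> pw j)"
    proof (rule inj_onI, clarify)
      fix xs ys xs' ys' assume "xs \<in> X" "xs' \<in> X" "xs @ ys = xs' @ ys'"
      then show "xs = xs' \<and> ys = ys'" using ends_long_decode[OF X(2) X(2)] by blast
    qed
    have "(v / split_const) ^ Suc j \<le> v / split_const * sum u (pw j)"
      unfolding power_Suc using Suc v0 split_const_ge_1 by (intro mult_left_mono) auto
    also have "\<dots> = (\<Sum>xs\<in>X. \<Sum>ys\<in>pw j. u xs * u ys / split_const)"
      by (simp add: v_def sum_product sum_divide_distrib)
    also have "\<dots> \<le> (\<Sum>xs\<in>X. \<Sum>ys\<in>pw j. u (xs @ ys))"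
    proof (intro sum_mono)
      fix xs ys assume "xs \<in> X" "ys \<in> pw j"
      then have "weight h xs * weight h ys \<le> split_const * weight h (xs @ ys)" using X0 pw by (intro weight_append(2)) auto
      then have "(weight h xs * weight h ys) * exp (- e * real (sum_list xs + sum_list ys))
          \<le> (split_const * weight h (xs @ ys)) * exp (- e * real (sum_list xs + sum_list ys))"
        by (intro mult_right_mono) auto
      then show "u xs * u ys / split_const \<le> u (xs @ ys)"
        using split_const_ge_1 by (simp add: u_def exp_add[symmetric] field_simps exp_add)
    qed
    also have "\<dots> = sum u (pw (Suc j))"
      using inj by (simp add: pw_def concats_def sum.reindex sum.cartesian_product split_def)
    finally show ?case .
  qed
  have "v / split_const \<le> 1"
  proof (rule ccontr)
    assume "\<not> v / split_const \<le> 1"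
    then obtain j where "(v / split_const) ^ j > C" using real_arch_pow[of "v / split_const" C] by auto
    moreover have "sum u (pw j) \<le> C" using pw by (intro C) auto
    ultimately show False using S[of j] by simp
  qed
  then show ?thesis using split_const_ge_1 by (simp add: v_def u_def)
qed

lemma renewal_mass_le:
  assumes lim: "(\<lambda>n. ln (annealed_mass h n) / real n) \<longlonglongrightarrow> 0"
    and X: "finite X" "\<And>xs. xs \<in> X \<Longrightarrow> ends_long b xs"
  shows "(\<Sum>xs\<in>X. weight h xs) \<le> split_const"
proof (rule tendsto_upperbound)
  have "((\<lambda>e. \<Sum>xs\<in>X. weight h xs * exp (- e * real (sum_list xs))) \<longlongrightarrow> (\<Sum>xs\<in>X. weight h xs * exp (- 0 * real (sum_list xs)))) (at_right 0)"
    by (intro tendsto_intros)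
  then show "((\<lambda>e. \<Sum>xs\<in>X. weight h xs * exp (- e * real (sum_list xs))) \<longlongrightarrow> (\<Sum>xs\<in>X. weight h xs)) (at_right 0)"
    by simp
  show "eventually (\<lambda>e. (\<Sum>xs\<in>X. weight h xs * exp (- e * real (sum_list xs))) \<le> split_const) (at_right 0)"
    using renewal_mass_le_laplace[OF lim _ X] by (auto simp: eventually_at_filter)
qed simp

lemma weight_mono: "0 \<notin> set xs \<Longrightarrow> h \<le> h' \<Longrightarrow> weight h xs \<le> weight h' xs"
  unfolding weight_def using gap_prob_pos[of xs] by (intro mult_left_mono) (auto simp: mult_right_mono)

text \<open>
  For finite sets of paths the bound is a closed condition on \<open>h\<close>, and weights increase with \<open>h\<close>.
\<close>
lemma renewal_mass_le_Sup:
  assumes A: "A \<noteq> {}" "bdd_above A" "\<And>h. h \<in> A \<Longrightarrow> (\<lambda>n. ln (annealed_mass h n) / real n) \<longlonglongrightarrow> 0"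
    and X: "finite X" "\<And>xs. xs \<in> X \<Longrightarrow> ends_long b xs"
  shows "(\<Sum>xs\<in>X. weight (Sup A) xs) \<le> split_const"
proof (rule tendsto_upperbound)
  show "((\<lambda>h. \<Sum>xs\<in>X. weight h xs) \<longlongrightarrow> (\<Sum>xs\<in>X. weight (Sup A) xs)) (at_left (Sup A))"
    unfolding weight_def by (intro tendsto_intros)
  have "(\<Sum>xs\<in>X. weight h xs) \<le> split_const" if h: "h < Sup A" for h
  proof -
    obtain h' where h': "h' \<in> A" "h < h'" using less_cSupD[OF A(1) h] by blast
    have "(\<Sum>xs\<in>X. weight h xs) \<le> (\<Sum>xs\<in>X. weight h' xs)"
      using X(2) h' by (intro sum_mono weight_mono) (auto simp: ends_long_def)
    also have "\<dots> \<le> split_const" by (rule renewal_mass_le[OF A(3)[OF h'(1)] X])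
    finally show ?thesis .
  qed
  then show "eventually (\<lambda>h. (\<Sum>xs\<in>X. weight h xs) \<le> split_const) (at_left (Sup A))"
    by (auto simp: eventually_at_filter)
qed simp

definition subcritical_mass :: "real \<Rightarrow> bool" where
  "subcritical_mass h \<longleftrightarrow> (\<forall>X b. finite X \<longrightarrow> (\<forall>xs\<in>X. ends_long b xs) \<longrightarrow> (\<Sum>xs\<in>X. weight h xs) \<le> split_const)"

text \<open>
  Appending one gap of length \<open>2q + 1\<close> turns a path with \<open>b\<close> long gaps into one that ends with its
  \<open>(b+1)\<close>-st long gap. So each value of \<open>b\<close> contributes a bounded weight, and the discounts
  sum to a geometric series.
\<close>
lemma discounted_weight_le:
  assumes crit: "subcritical_mass h" and th: "0 \<le> t" "t < 1"
    and X: "finite X" "\<And>xs. xs \<in> X \<Longrightarrow> 0 \<notin> set xs"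
  shows "(\<Sum>xs\<in>X. weight h xs * t ^ long_gaps q xs) \<le> split_const\<^sup>2 / weight h [2 * q + 1] / (1 - t)"
proof -
  define g where "g = [2 * q + 1]"
  define C where "C = split_const\<^sup>2 / weight h g"
  have g: "weight h g > 0" by (simp add: g_def weight_pos)
  have C0: "C \<ge> 0" using g by (simp add: C_def)
  have Xb: "(\<Sum>xs\<in>{xs\<in>X. long_gaps q xs = b}. weight h xs) \<le> C" for b
  proof -
    have "weight h xs \<le> split_const / weight h g * weight h (xs @ g)" if "xs \<in> X" for xs
      using weight_append(2)[of xs g h] X(2)[OF that] g by (simp add: g_def field_simps)
    then have "(\<Sum>xs\<in>{xs\<in>X. long_gaps q xs = b}. weight h xs) \<le> split_const / weight h g * (\<Sum>xs\<in>{xs\<in>X. long_gaps q xs = b}. weight h (xs @ g))"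
      unfolding sum_distrib_left by (intro sum_mono) auto
    also have "(\<Sum>xs\<in>{xs\<in>X. long_gaps q xs = b}. weight h (xs @ g)) = (\<Sum>ys\<in>(\<lambda>xs. xs @ g) ` {xs\<in>X. long_gaps q xs = b}. weight h ys)"
      by (simp add: sum.reindex inj_on_def)
    also have "split_const / weight h g * \<dots> \<le> split_const / weight h g * split_const"
    proof (rule mult_left_mono)
      have "\<forall>ys\<in>(\<lambda>xs. xs @ g) ` {xs\<in>X. long_gaps q xs = b}. ends_long (Suc b) ys"
        using X by (auto simp: ends_long_def g_def long_gaps_def)
      then show "(\<Sum>ys\<in>(\<lambda>xs. xs @ g) ` {xs\<in>X. long_gaps q xs = b}. weight h ys) \<le> split_const"
        using crit X unfolding subcritical_mass_def by (metis (no_types, lifting) finite_imageI finite_subset mem_Collect_eq subsetI)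
    qed (use split_const_ge_1 g in simp)
    finally show ?thesis by (simp add: C_def power2_eq_square)
  qed
  define m where "m = Suc (Max (insert 0 (long_gaps q ` X)))"
  have m: "long_gaps q xs < m" if "xs \<in> X" for xs
    unfolding m_def using X that by (auto simp: less_Suc_eq_le intro!: Max_ge)
  have "(\<Sum>xs\<in>X. weight h xs * t ^ long_gaps q xs)
      = (\<Sum>b<m. \<Sum>xs\<in>{xs\<in>X. long_gaps q xs = b}. weight h xs * t ^ long_gaps q xs)"
    using X m by (intro sum.group[symmetric]) auto
  also have "\<dots> = (\<Sum>b<m. (\<Sum>xs\<in>{xs\<in>X. long_gaps q xs = b}. weight h xs) * t ^ b)"
    by (simp add: sum_distrib_right)
  also have "\<dots> \<le> (\<Sum>b<m. C * t ^ b)" using Xb th by (intro sum_mono mult_right_mono) auto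
  also have "\<dots> = C * ((1 - t ^ m) / (1 - t))"
    using th by (simp add: sum_distrib_left[symmetric] sum_gp_strict)
  also have "\<dots> \<le> C * (1 / (1 - t))" using th C0
    by (intro mult_left_mono divide_right_mono) auto
  finally show ?thesis by (simp add: C_def g_def)
qed

lemma sum_disc_mass_le:
  assumes crit: "subcritical_mass h" and th: "discount l < 1"
  shows "(\<Sum>j<J. disc_mass l h j) \<le> split_const\<^sup>2 / weight h [2 * q + 1] / (1 - discount l)"
proof -
  have "(\<Sum>j<J. disc_mass l h j) = (\<Sum>xs\<in>(\<Union>j\<in>{..<J}. compositions j). weight h xs * discount l ^ long_gaps q xs)"
    unfolding disc_mass_def
  proof (rule sum.UNION_disjoint[symmetric])
    show "\<forall>i\<in>{..<J}. \<forall>j\<in>{..<J}. i \<noteq> j \<longrightarrow> compositions i \<inter> compositions j = {}"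
      by (auto simp: compositions_def)
  qed simp_all
  also have "\<dots> \<le> split_const\<^sup>2 / weight h [2 * q + 1] / (1 - discount l)"
  proof (rule discounted_weight_le[OF crit])
    show "0 \<notin> set xs" if "xs \<in> (\<Union>j\<in>{..<J}. compositions j)" for xs
      using that by (auto simp: compositions_def)
  qed (use discount_pos[of l] th in auto)
  finally show ?thesis .
qed

lemma disc_mass_shift:
  assumes "D \<ge> 0"
  shows "disc_mass l (h + D) j \<le> exp (D * real j) * disc_mass l h j"
proof -
  have "weight (h + D) p \<le> exp (D * real j) * weight h p" if "p \<in> compositions j" for p
  proof -
    have "length p \<le> j" using that length_le_sum_list_pos by (auto simp: compositions_def)
    then have "D * real (length p) \<le> D * real j" using assms by (simp add: mult_left_mono)
    moreover have "weight (h + D) p = exp (D * real (length p)) * weight h p"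
      by (simp add: weight_def exp_add algebra_simps)
    ultimately show ?thesis using weight_pos[of p h] that by (simp add: compositions_def mult_right_mono)
  qed
  then show ?thesis unfolding disc_mass_def sum_distrib_left
    using discount_pos[of l] by (intro sum_mono) (simp add: mult.assoc[symmetric] mult_right_mono)
qed

lemma weight_singleton: "weight h [d] = K d * exp (h + \<beta>\<^sup>2 / 2)"
  by (simp add: weight_def gap_prob_def cov_mass_def rho_0)

end

section \<open>The choice of the block length\<close>

text \<open>
  Here \<open>1 + e + s\<close> is the decay exponent of \<open>K\<close> to the power \<open>\<gamma> = n/(n+1)\<close>, after losing \<open>e\<close> to the slowly
  varying function; a further \<open>e\<close> pays for convergence of tail sums. As \<open>\<gamma>\<close> tends to \<open>1\<close>
  and \<open>e\<close> to \<open>0\<close>, the last quantity tends to \<open>\<alpha> + 1/2\<close>.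
\<close>
lemma exponent_choice:
  assumes a: "1/2 < \<alpha>" "\<alpha> < (1::real)"
  obtains n :: nat and e s :: real
  where "n \<ge> 1" "e > 0" "0 \<le> s" "s < 1" "(1 + \<alpha> - e) * (real n / (real n + 1)) = 1 + e + s"
    "s + real n / (real n + 1) / 2 > 1"
proof -
  define \<delta> where "\<delta> = \<alpha> - 1/2"
  have d: "0 < \<delta>" "\<delta> < 1/2" using a by (auto simp: \<delta>_def)
  define n where "n = Suc (nat \<lceil>6 / \<delta>\<rceil>)"
  have n: "real n \<ge> 6 / \<delta>" unfolding n_def by (simp; linarith)
  define \<gamma> where "\<gamma> = real n / (real n + 1)"
  have "\<gamma> = 1 - 1 / (real n + 1)" by (simp add: \<gamma>_def field_simps)
  moreover have "1 / (real n + 1) \<le> \<delta> / 6" using n d by (simp add: field_simps)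
  ultimately have g: "1 - \<delta> / 6 \<le> \<gamma>" "\<gamma> < 1" "\<gamma> > 0" by (auto simp: n_def)
  \<comment> \<open>Small enough that \<open>\<gamma> (2 + 3\<delta>/4) - 1 - \<delta>/4\<close> still exceeds \<open>1\<close> when \<open>\<gamma> \<ge> 1 - \<delta>/6\<close>.\<close>
  define e where "e = \<delta> / 4"
  define s where "s = (1 + \<alpha> - e) * \<gamma> - 1 - e"
  have "(1 - \<delta> / 6) * (2 + 3 * \<delta> / 4) \<le> \<gamma> * (2 + 3 * \<delta> / 4)"
    using g d by (intro mult_right_mono) auto
  moreover have "(1 - \<delta> / 6) * (2 + 3 * \<delta> / 4) = 2 + 5 * \<delta> / 12 - \<delta> * \<delta> / 8"
    by (simp add: field_simps)
  moreover have "\<delta> * \<delta> \<le> \<delta> * (1/2)" using d by (intro mult_left_mono) auto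
  moreover have "s + \<gamma> / 2 = \<gamma> * (2 + 3 * \<delta> / 4) - 1 - \<delta> / 4"
    by (simp add: s_def e_def \<delta>_def field_simps)
  ultimately have 1: "s + \<gamma> / 2 > 1" using d by linarith
  have e: "e > 0" "e < 1" using d by (auto simp: e_def)
  have 2: "s < 1"
  proof -
    have "(1 + \<alpha> - e) * \<gamma> \<le> (1 + \<alpha> - e) * 1"
      using g a e by (intro mult_left_mono) auto
    then have "s \<le> (1 + \<alpha> - e) * 1 - 1 - e" unfolding s_def by (intro diff_right_mono)
    then show ?thesis using a e by simp
  qed
  have 0: "0 \<le> s" using 1 g by linarith
  have "(1 + \<alpha> - e) * \<gamma> = 1 + e + s" by (simp add: s_def)
  moreover have "n \<ge> 1" by (simp add: n_def)
  ultimately show thesis using that[of n e s] 0 1 2 e unfolding \<gamma>_def by blast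
qed

lemma powr_tail_sum_le:
  assumes e: "e > 0" and s: "s \<ge> 0"
  obtains Z where "Z > 0" "\<And>y N. y \<ge> (1::nat) \<Longrightarrow> (\<Sum>d\<in>{y..N}. real d powr (- (1 + e + s))) \<le> Z * real y powr (- s)"
proof -
  define f where "f d = real d powr (- (1 + e))" for d :: nat
  have sf: "summable f" unfolding f_def using e by (subst summable_real_powr_iff) simp
  \<comment> \<open>The summand \<open>1\<close> only makes the constant positive.\<close>
  show thesis
  proof (rule that[of "suminf f + 1"])
    show "suminf f + 1 > 0" using suminf_nonneg[OF sf] by (simp add: f_def add_nonneg_pos)
    fix y N :: nat assume y: "y \<ge> 1"
    have "(\<Sum>d\<in>{y..N}. real d powr (- (1 + e + s))) \<le> (\<Sum>d\<in>{y..N}. f d * real y powr (- s))"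
    proof (intro sum_mono)
      fix d assume d: "d \<in> {y..N}"
      have "real d powr (- (1 + e + s)) = f d * real d powr (- s)"
        by (simp add: f_def powr_add[symmetric])
      also have "real d powr (- s) \<le> real y powr (- s)" using d y s by (intro powr_mono2') auto
      finally show "real d powr (- (1 + e + s)) \<le> f d * real y powr (- s)"
        by (simp add: mult_left_mono f_def)
    qed
    also have "\<dots> = (\<Sum>d\<in>{y..N}. f d) * real y powr (- s)" by (simp add: sum_distrib_right)
    also have "(\<Sum>d\<in>{y..N}. f d) \<le> suminf f + 1"
      using sum_le_suminf[OF sf, of "{y..N}"] by (simp add: f_def)
    finally show "(\<Sum>d\<in>{y..N}. real d powr (- (1 + e + s))) \<le> (suminf f + 1) * real y powr (- s)"
      by (simp add: mult_right_mono)
  qed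
qed

lemma ex_le_average:
  fixes f :: "nat \<Rightarrow> real"
  assumes "finite I" "I \<noteq> {}" "sum f I \<le> T"
  shows "\<exists>k\<in>I. f k \<le> T / real (card I)"
proof (rule ccontr)
  assume "\<not> ?thesis"
  then have "(\<Sum>k\<in>I. T / real (card I)) < sum f I"
    using assms by (intro sum_strict_mono) auto
  then show False using assms by simp
qed

context pinning_model
begin

text \<open>
  The penalty has an effect of first order in \<open>l\<close>. This is where \<open>\<rho> q \<noteq> 0\<close> and \<open>\<beta> > 0\<close> are used.
\<close>
lemma inverse_1_minus_discount:
  obtains C where "C > 0" "\<And>l. 0 < l \<Longrightarrow> l \<le> 1 \<Longrightarrow> discount l < 1 \<and> 1 / (1 - discount l) \<le> C / l"
proof -
  define k where "k = exp (1/2) * (cosh (\<beta> * \<rho> (int q)) - 1) / (real q + 1)"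
  have "cosh (\<beta> * \<rho> (int q)) \<noteq> 1" using beta_pos rho_q by (simp add: cosh_real_one_iff)
  then have "cosh (\<beta> * \<rho> (int q)) > 1" using cosh_real_ge_1[of "\<beta> * \<rho> (int q)"] by linarith
  then have k: "k > 0" by (simp add: k_def)
  show thesis
  proof (rule that[of "(1 + k) / k"])
    show "(1 + k) / k > 0" using k by simp
    fix l :: real assume l: "0 < l" "l \<le> 1"
    have th: "discount l = exp (- (k * l))" by (simp add: discount_def k_def)
    have kl: "0 < k * l" "k * l \<le> k" using k l by (auto simp: mult_le_cancel_left2)
    have "discount l = 1 / exp (k * l)" by (simp add: th exp_minus inverse_eq_divide)
    also have "\<dots> \<le> 1 / (1 + k * l)" using kl exp_ge_add_one_self[of "k * l"] by (intro divide_left_mono) auto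
    finally have 1: "discount l \<le> 1 / (1 + k * l)" .
    have "k * l / (1 + k) \<le> k * l / (1 + k * l)" using kl k by (intro divide_left_mono) auto
    also have "\<dots> = 1 - 1 / (1 + k * l)" using kl by (simp add: field_simps)
    also have "\<dots> \<le> 1 - discount l" using 1 by simp
    finally have 2: "k * l / (1 + k) \<le> 1 - discount l" .
    have p: "k * l / (1 + k) > 0" using kl k by simp
    have "1 / (1 - discount l) \<le> 1 / (k * l / (1 + k))" using 2 p by (intro divide_left_mono mult_pos_pos) linarith+
    moreover have "1 / (k * l / (1 + k)) = (1 + k) / k / l" by simp
    moreover have "discount l < 1" using 2 p by linarith
    ultimately show "discount l < 1 \<and> 1 / (1 - discount l) \<le> (1 + k) / k / l" by metis
  qed
qed

lemma straddling_sum_le: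
  assumes K: "\<And>d. d \<ge> 1 \<Longrightarrow> K d \<le> CK * real d powr (- a)" and CK: "CK > 0"
    and g: "0 < g" and ag: "a * g = 1 + e + s" and Z: "\<And>y N. y \<ge> (1::nat) \<Longrightarrow> (\<Sum>d\<in>{y..N}. real d powr (- (1 + e + s))) \<le> Z * real y powr (- s)"
    and A: "\<And>j. A j \<ge> 0" 
  shows "(\<Sum>(j, d)\<in>straddling k N. (A j * K d) powr g)
    \<le> CK powr g * Z * (\<Sum>j<k. A j powr g * real (k - j) powr (- s))"
proof -
  have Kd: "K d powr g \<le> CK powr g * real d powr (- (1 + e + s))" if "d \<ge> 1" for d
  proof -
    have "K d powr g \<le> (CK * real d powr (- a)) powr g"
      using K[OF that] K_pos[OF that] g by (intro powr_mono2) auto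
    also have "\<dots> = CK powr g * real d powr (- (a * g))" using CK by (simp add: powr_mult powr_powr)
    finally show ?thesis by (simp add: ag)
  qed
  have "(\<Sum>(j, d)\<in>straddling k N. (A j * K d) powr g)
      \<le> (\<Sum>(j, d)\<in>(SIGMA j:{..<k}. {k - j..N}). A j powr g * (CK powr g * real d powr (- (1 + e + s))))"
  proof -
    have "(\<Sum>(j, d)\<in>straddling k N. (A j * K d) powr g)
        \<le> (\<Sum>(j, d)\<in>straddling k N. A j powr g * (CK powr g * real d powr (- (1 + e + s))))"
    proof (intro sum_mono, clarify)
      fix j d assume "(j, d) \<in> straddling k N"
      then have d: "d \<ge> 1" by (auto simp: straddling_def)
      then have "(A j * K d) powr g = A j powr g * K d powr g"
        using A[of j] K_pos[OF d] by (simp add: powr_mult)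
      then show "(A j * K d) powr g \<le> A j powr g * (CK powr g * real d powr (- (1 + e + s)))"
        using Kd[OF d] by (simp add: mult_left_mono)
    qed
    also have "\<dots> \<le> (\<Sum>(j, d)\<in>(SIGMA j:{..<k}. {k - j..N}). A j powr g * (CK powr g * real d powr (- (1 + e + s))))"
      by (intro sum_mono2) (auto simp: straddling_def)
    finally show ?thesis .
  qed
  also have "\<dots> = (\<Sum>j<k. \<Sum>d\<in>{k - j..N}. A j powr g * (CK powr g * real d powr (- (1 + e + s))))"
    by (rule sum.Sigma[symmetric]) auto
  also have "\<dots> = (\<Sum>j<k. A j powr g * CK powr g * (\<Sum>d\<in>{k - j..N}. real d powr (- (1 + e + s))))"
    by (simp add: sum_distrib_left mult.assoc)
  also have "\<dots> \<le> (\<Sum>j<k. A j powr g * CK powr g * (Z * real (k - j) powr (- s)))"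
    by (intro sum_mono mult_left_mono Z) auto
  also have "\<dots> = CK powr g * Z * (\<Sum>j<k. A j powr g * real (k - j) powr (- s))"
    by (simp add: sum_distrib_left mult_ac)
  finally show ?thesis .
qed

text \<open>
  Averaging over the level \<open>k\<close> smooths the convolution: only the total mass of \<open>A\<close> enters, not its values
  close to \<open>k\<close>.
\<close>
lemma averaged_block_sum:
  assumes A: "\<And>j. A j \<ge> 0" and s: "0 \<le> s" "s < 1" and m: "m \<ge> 1"
  shows "\<exists>k\<in>{m<..2*m}. (\<Sum>j<k. A j * real (k - j) powr (- s))
    \<le> (\<Sum>j<2*m. A j) * (real (2*m) powr (1 - s) / (1 - s)) / real m"
proof -
  have "(\<Sum>k\<in>{m<..2*m}. \<Sum>j<k. A j * real (k - j) powr (- s))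
      = (\<Sum>k\<in>{m<..2*m}. \<Sum>j<2*m. A j * real (k - j) powr (- s))"
    \<comment> \<open>Terms with \<open>j \<ge> k\<close> vanish: the truncated difference is \<open>0\<close>, and \<open>0 powr _ = 0\<close>.\<close>
    by (intro sum.cong refl sum.mono_neutral_left) auto
  also have "\<dots> = (\<Sum>j<2*m. A j * (\<Sum>k\<in>{m<..2*m}. real (k - j) powr (- s)))"
    by (subst sum.swap) (simp add: sum_distrib_left)
  also have "\<dots> \<le> (\<Sum>j<2*m. A j * (real (2*m) powr (1 - s) / (1 - s)))"
  proof (intro sum_mono mult_left_mono A)
    fix j
    have "(\<Sum>k\<in>{m<..2*m}. real (k - j) powr (- s)) = (\<Sum>k\<in>{k\<in>{m<..2*m}. j < k}. real (k - j) powr (- s))"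
      by (intro sum.mono_neutral_right) auto
    also have "\<dots> = (\<Sum>y\<in>(\<lambda>k. k - j) ` {k\<in>{m<..2*m}. j < k}. real y powr (- s))"
      by (subst sum.reindex) (auto simp: inj_on_def)
    also have "\<dots> \<le> (\<Sum>y\<in>{1..2*m}. real y powr (- s))"
      by (intro sum_mono2) auto
    also have "\<dots> \<le> real (2*m) powr (1 - s) / (1 - s)" by (rule sum_powr_neg_le[OF s])
    finally show "(\<Sum>k\<in>{m<..2*m}. real (k - j) powr (- s)) \<le> real (2*m) powr (1 - s) / (1 - s)" .
  qed
  also have "\<dots> = (\<Sum>j<2*m. A j) * (real (2*m) powr (1 - s) / (1 - s))" by (rule sum_distrib_right[symmetric])
  finally have le: "(\<Sum>k\<in>{m<..2*m}. \<Sum>j<k. A j * real (k - j) powr (- s))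
    \<le> (\<Sum>j<2*m. A j) * (real (2*m) powr (1 - s) / (1 - s))" .
  have "{m<..2*m} \<noteq> {}" "card {m<..2*m} = m" using m by auto
  then show ?thesis using ex_le_average[OF _ _ le] by simp
qed

text \<open>
  With \<open>l = 1 / sqrt m\<close> the total discounted weight is of order \<open>sqrt m\<close>. Its \<open>g\<close>-th power, the power-mean
  inequality and the tail sums of \<open>K\<close> to the power \<open>g\<close> give a sum over cuts of order
  \<open>m powr (1 - s - g/2)\<close>, which is small for large \<open>m\<close>.
\<close>
theorem bounded_fractional_moment:
  assumes crit: "subcritical_mass h0"
    and KU: "\<And>e. e > 0 \<Longrightarrow> \<exists>C>0. \<forall>d\<ge>1. K d \<le> C * real d powr (e - (1 + \<alpha>))"
    and a: "1/2 < \<alpha>" "\<alpha> < 1"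
  shows "\<exists>h>h0. \<exists>n\<ge>(1::nat). \<exists>Ub. \<forall>N. integrable M (\<lambda>x. path_sum h (compositions N) x powr (real n / (real n + 1)))
     \<and> expectation (\<lambda>x. path_sum h (compositions N) x powr (real n / (real n + 1))) \<le> Ub"
proof -
  obtain n e s where n: "n \<ge> (1::nat)" and e: "e > 0" and s: "0 \<le> s" "s < 1"
    and ag: "(1 + \<alpha> - e) * (real n / (real n + 1)) = 1 + e + s"
    and gain: "s + real n / (real n + 1) / 2 > 1"
    using exponent_choice[OF a] by metis
  define g where "g = real n / (real n + 1)"
  have g: "0 < g" "g < 1" using n by (auto simp: g_def)
  obtain CK where CK: "CK > 0" "\<And>d. d \<ge> 1 \<Longrightarrow> K d \<le> CK * real d powr (- (1 + \<alpha> - e))"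
    using KU[OF e] by (auto simp: algebra_simps)
  obtain Z where Z: "Z > 0" "\<And>y N. y \<ge> (1::nat) \<Longrightarrow> (\<Sum>d\<in>{y..N}. real d powr (- (1 + e + s))) \<le> Z * real y powr (- s)"
    using powr_tail_sum_le[OF e s(1)] by blast
  obtain Ct where Ct: "Ct > 0" "\<And>l. 0 < l \<Longrightarrow> l \<le> 1 \<Longrightarrow> discount l < 1 \<and> 1 / (1 - discount l) \<le> Ct / l"
    using inverse_1_minus_discount by blast
  define C6 where "C6 = split_const\<^sup>2 / weight h0 [2 * q + 1] * Ct"
  have C6: "C6 > 0" using split_const_ge_1 weight_pos[of "[2 * q + 1]" h0] Ct(1) by (simp add: C6_def)
  define W where "W = split_const\<^sup>2 * exp 1 * exp (h0 + 1 + \<beta>\<^sup>2 / 2)"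
  have W: "W > 0" using split_const_ge_1 by (simp add: W_def)
  define C4 where "C4 = W powr g * exp (2 * tilt_cost n) * (CK powr g * Z)"
  have C4: "C4 > 0" using W CK Z by (simp add: C4_def)
  define C7 where "C7 = C4 * (2 powr (1 - g) * C6 powr g * (2 powr (1 - s) / (1 - s)))"
  have C7: "C7 > 0" using C4 C6 s by (simp add: C7_def)
  define \<xi> where "\<xi> = s + g / 2 - 1"
  have xi: "\<xi> > 0" using gain by (simp add: \<xi>_def g_def)
  \<comment> \<open>The bound \<open>m \<ge> B0\<^sup>2\<close> makes the penalty weak enough for the first-order terms to stay below \<open>1\<close>.\<close>
  define B0 where "B0 = exp (1/2) * cosh (\<beta> * (2 * real q + 1))"
  have B0: "B0 > 0" using cosh_real_pos by (simp add: B0_def)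
  have "((\<lambda>m::nat. C7 * real m powr (- \<xi>)) \<longlongrightarrow> C7 * 0) sequentially"
    using xi by (intro tendsto_intros tendsto_neg_powr filterlim_real_sequentially) auto
  then have "eventually (\<lambda>m. C7 * real m powr (- \<xi>) < 1) sequentially"
    by (rule order_tendstoD) simp
  moreover have "eventually (\<lambda>m::nat. real m \<ge> B0\<^sup>2) sequentially"
    using filterlim_real_sequentially by (simp add: filterlim_at_top)
  ultimately have "eventually (\<lambda>m. C7 * real m powr (- \<xi>) < 1 \<and> real m \<ge> B0\<^sup>2 \<and> m \<ge> 1) sequentially"
    using eventually_ge_at_top[of 1] by eventually_elim auto
  then obtain m where m: "C7 * real m powr (- \<xi>) < 1" "real m \<ge> B0\<^sup>2" "m \<ge> 1"
    by (auto simp: eventually_sequentially)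
  define l where "l = 1 / sqrt (real m)"
  have sq: "sqrt (real m) \<ge> 1" using m by simp
  have l: "0 < l" "l \<le> 1" using sq by (auto simp: l_def)
  have lm: "l\<^sup>2 = 1 / real m" using m by (simp add: l_def power_divide)
  have "B0 \<le> sqrt (real m)" using m B0 by (simp add: real_le_rsqrt)
  then have small: "l * exp (1/2) * cosh (\<beta> * (2 * real q + 1)) \<le> 1"
    using sq by (simp add: l_def B0_def field_simps)
  define A where "A j = disc_mass l h0 j" for j
  have A0: "A j \<ge> 0" for j by (simp add: A_def disc_mass_nonneg)
  have sumA: "(\<Sum>j<2*m. A j) \<le> C6 * sqrt (real m)"
  proof -
    have "(\<Sum>j<2*m. A j) \<le> split_const\<^sup>2 / weight h0 [2 * q + 1] / (1 - discount l)"
      unfolding A_def using Ct(2)[OF l] by (intro sum_disc_mass_le crit) auto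
    also have "\<dots> = split_const\<^sup>2 / weight h0 [2 * q + 1] * (1 / (1 - discount l))" by simp
    also have "\<dots> \<le> split_const\<^sup>2 / weight h0 [2 * q + 1] * (Ct / l)"
      using Ct(2)[OF l] weight_pos[of "[2 * q + 1]" h0] by (intro mult_left_mono) (auto intro: less_imp_le)
    also have "\<dots> = C6 * sqrt (real m)" by (simp add: C6_def l_def)
    finally show ?thesis .
  qed
  obtain k where k: "k \<in> {m<..2*m}" and Sk: "(\<Sum>j<k. A j powr g * real (k - j) powr (- s))
      \<le> (\<Sum>j<2*m. A j powr g) * (real (2*m) powr (1 - s) / (1 - s)) / real m"
    using averaged_block_sum[of "\<lambda>j. A j powr g" s m] s m by auto
  have S1: "C4 * (\<Sum>j<k. A j powr g * real (k - j) powr (- s)) \<le> 1"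
  proof -
    have "(\<Sum>j<2*m. A j powr g) \<le> real (2*m) powr (1 - g) * (\<Sum>j<2*m. A j) powr g"
      using m g A0 by (intro sum_powr_le_card) auto
    also have "\<dots> \<le> real (2*m) powr (1 - g) * (C6 * sqrt (real m)) powr g"
      using sumA g A0 by (intro mult_left_mono powr_mono2 sum_nonneg) auto
    finally have "(\<Sum>j<k. A j powr g * real (k - j) powr (- s))
        \<le> (real (2*m) powr (1 - g) * (C6 * sqrt (real m)) powr g) * (real (2*m) powr (1 - s) / (1 - s)) / real m"
      using s by (intro order_trans[OF Sk] divide_right_mono mult_right_mono) auto
    also have "\<dots> = (2 powr (1 - g) * C6 powr g * (2 powr (1 - s) / (1 - s))) *
        (real m powr (1 - g) * sqrt (real m) powr g * real m powr (1 - s) / real m)"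
      using C6 by (simp add: powr_mult)
    also have "real m powr (1 - g) * sqrt (real m) powr g * real m powr (1 - s) / real m = real m powr (- \<xi>)"
    proof -
      have "sqrt (real m) powr g = real m powr (g / 2)"
        using m by (simp add: powr_half_sqrt[symmetric] powr_powr)
      moreover have "real m powr (1 - g) * real m powr (g / 2) * real m powr (1 - s) / real m powr 1
          = real m powr ((1 - g) + g / 2 + (1 - s) - 1)"
        by (simp only: powr_add powr_diff)
      moreover have "(1 - g) + g / 2 + (1 - s) - 1 = - \<xi>" by (simp add: \<xi>_def)
      ultimately show ?thesis using m by simp
    qed
    finally have "C4 * (\<Sum>j<k. A j powr g * real (k - j) powr (- s))
        \<le> C4 * ((2 powr (1 - g) * C6 powr g * (2 powr (1 - s) / (1 - s))) * real m powr (- \<xi>))"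
      using C4 by (intro mult_left_mono) auto
    also have "\<dots> = C7 * real m powr (- \<xi>)" by (simp add: C7_def)
    finally show ?thesis using m by simp
  qed
  have k1: "k \<ge> 1" using k by auto
  \<comment> \<open>Paths of length below \<open>k\<close> have fewer than \<open>k\<close> points, so this raises their weight by at most \<open>e\<close>.\<close>
  define h where "h = h0 + 1 / real k"
  have hk: "h > h0" "h \<le> h0 + 1" using k1 by (auto simp: h_def)
  have c30: "tilt_cost n \<ge> 0" unfolding tilt_cost_def
    using cosh_real_pos[of "2 * (\<beta> * (2 * real q + 1))"] by (intro add_nonneg_nonneg divide_nonneg_nonneg mult_nonneg_nonneg) auto
  have tj: "disc_mass l h j \<le> exp 1 * A j" if "j < k" for j
  proof -
    have "disc_mass l h j \<le> exp (1 / real k * real j) * A j"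
      unfolding h_def A_def by (rule disc_mass_shift) simp
    also have "\<dots> \<le> exp 1 * A j" using that A0 by (intro mult_right_mono) (auto simp: field_simps)
    finally show ?thesis .
  qed
  have H2: "(\<Sum>(j, d)\<in>straddling k N. (split_const\<^sup>2 * disc_mass l h j * weight h [d]) powr (real n / (real n + 1))
              * exp (tilt_cost n * l\<^sup>2 * real j)) \<le> 1" for N
  proof -
    have "(\<Sum>(j, d)\<in>straddling k N. (split_const\<^sup>2 * disc_mass l h j * weight h [d]) powr g * exp (tilt_cost n * l\<^sup>2 * real j))
        \<le> (\<Sum>(j, d)\<in>straddling k N. (W powr g * exp (2 * tilt_cost n)) * (A j * K d) powr g)"
    proof (intro sum_mono, clarify)
      fix j d assume jd: "(j, d) \<in> straddling k N"
      then have j: "j < k" and d: "d \<ge> 1" by (auto simp: straddling_def)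
      have w0: "weight h [d] \<ge> 0" using weight_pos[of "[d]" h] d by simp
      have "weight h [d] \<le> K d * exp (h0 + 1 + \<beta>\<^sup>2 / 2)"
        unfolding weight_singleton using hk K_pos[OF d] by (intro mult_left_mono) auto
      then have "split_const\<^sup>2 * disc_mass l h j * weight h [d] \<le> split_const\<^sup>2 * (exp 1 * A j) * (K d * exp (h0 + 1 + \<beta>\<^sup>2 / 2))"
        using tj[OF j] w0 A0 by (intro mult_mono mult_left_mono mult_nonneg_nonneg disc_mass_nonneg) auto
      also have "\<dots> = W * (A j * K d)" by (simp add: W_def)
      finally have "(split_const\<^sup>2 * disc_mass l h j * weight h [d]) powr g \<le> (W * (A j * K d)) powr g"
        using g w0 disc_mass_nonneg by (intro powr_mono2) auto
      also have "\<dots> = W powr g * (A j * K d) powr g"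
        using W A0 K_pos[OF d] by (simp add: powr_mult)
      finally have 1: "(split_const\<^sup>2 * disc_mass l h j * weight h [d]) powr g \<le> W powr g * (A j * K d) powr g" .
      have "real j \<le> 2 * real m" using j k by auto
      then have "l\<^sup>2 * real j \<le> 2" using m by (simp add: lm field_simps)
      then have "tilt_cost n * (l\<^sup>2 * real j) \<le> tilt_cost n * 2" using c30 by (rule mult_left_mono)
      then have 2: "exp (tilt_cost n * l\<^sup>2 * real j) \<le> exp (2 * tilt_cost n)" by (simp add: mult_ac)
      have "(split_const\<^sup>2 * disc_mass l h j * weight h [d]) powr g * exp (tilt_cost n * l\<^sup>2 * real j)
          \<le> (W powr g * (A j * K d) powr g) * exp (2 * tilt_cost n)"
        using 1 2 by (intro mult_mono) auto
      then show "(split_const\<^sup>2 * disc_mass l h j * weight h [d]) powr g * exp (tilt_cost n * l\<^sup>2 * real j)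
          \<le> (W powr g * exp (2 * tilt_cost n)) * (A j * K d) powr g" by (simp add: mult_ac)
    qed
    also have "\<dots> = (W powr g * exp (2 * tilt_cost n)) * (\<Sum>(j, d)\<in>straddling k N. (A j * K d) powr g)"
      by (simp add: sum_distrib_left split_def)
    also have "\<dots> \<le> (W powr g * exp (2 * tilt_cost n)) * (CK powr g * Z * (\<Sum>j<k. A j powr g * real (k - j) powr (- s)))"
      using ag by (intro mult_left_mono straddling_sum_le[OF CK(2,1) g(1) _ Z(2) A0]) (auto simp: g_def)
    also have "\<dots> = C4 * (\<Sum>j<k. A j powr g * real (k - j) powr (- s))" by (simp add: C4_def mult_ac)
    finally show ?thesis using S1 by (simp add: g_def)
  qed
  define Ub where "Ub = (\<Sum>N<k. (split_const * disc_mass l h N) powr (real n / (real n + 1)) * exp (tilt_cost n * l\<^sup>2 * real N))"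
  have H1: "(split_const * disc_mass l h N) powr (real n / (real n + 1)) * exp (tilt_cost n * l\<^sup>2 * real N) \<le> Ub" if "N < k" for N
    unfolding Ub_def using that by (intro member_le_sum) auto
  have "integrable M (\<lambda>x. path_sum h (compositions N) x powr (real n / (real n + 1)))
     \<and> expectation (\<lambda>x. path_sum h (compositions N) x powr (real n / (real n + 1))) \<le> Ub" for N
  proof
    show "integrable M (\<lambda>x. path_sum h (compositions N) x powr (real n / (real n + 1)))"
      using fractional_moment(1)[OF finite_compositions compositions_nonempty _ finite.emptyI l n small] by (simp add: compositions_def)
    have ext1: "concats {[]} (compositions N) = compositions N" by (auto simp: concats_def image_iff)
    have "expectation (\<lambda>x. path_sum h (concats {[]} (compositions N)) x powr (real n / (real n + 1))) \<le> tilted_bound n l h {[]} {} * Ub"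
      by (rule coarse_graining[OF l n k1 small H1 H2, where a = 0]) auto
    then show "expectation (\<lambda>x. path_sum h (compositions N) x powr (real n / (real n + 1))) \<le> Ub"
      unfolding ext1 by (simp add: tilted_bound_def)
  qed
  then show ?thesis using hk n by blast
qed

end

section \<open>From fractional moments to critical points\<close>

lemma (in prob_space) AE_tendsto_0_of_summable_expectation:
  fixes f :: "nat \<Rightarrow> 'a \<Rightarrow> real"
  assumes int: "\<And>n. integrable M (f n)" and nn: "\<And>n x. f n x \<ge> 0"
    and sm: "summable (\<lambda>n. expectation (f n))"
  shows "AE x in M. (\<lambda>n. f n x) \<longlonglongrightarrow> 0"
proof -
  have [measurable]: "f n \<in> borel_measurable M" for n using int by auto
  have "(\<integral>\<^sup>+x. (\<Sum>n. ennreal (f n x)) \<partial>M) = (\<Sum>n. \<integral>\<^sup>+x. ennreal (f n x) \<partial>M)"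
    by (rule nn_integral_suminf) simp
  also have "\<dots> = (\<Sum>n. ennreal (expectation (f n)))"
    using int nn by (simp add: nn_integral_eq_integral)
  also have "\<dots> < \<infinity>"
    using sm nn by (subst suminf_ennreal2) (auto intro: integral_nonneg_AE)
  finally have "(\<integral>\<^sup>+x. (\<Sum>n. ennreal (f n x)) \<partial>M) \<noteq> \<infinity>" by simp
  then have "AE x in M. (\<Sum>n. ennreal (f n x)) \<noteq> \<infinity>"
    by (rule nn_integral_PInf_AE[rotated]) measurable
  then show ?thesis
  proof eventually_elim
    case (elim x)
    then have "summable (\<lambda>n. f n x)" using nn by (intro summable_suminf_not_top) auto
    then show ?case by (rule summable_LIMSEQ_zero)
  qed
qed

context pinning_model
begin

lemma expectation_path_sum: "expectation (path_sum h (compositions n)) = annealed_mass h n"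
proof -
  have "expectation (path_sum h (compositions n)) = (\<Sum>xs\<in>compositions n. expectation (qweight h xs))"
    unfolding path_sum_def[abs_def] using qweight_expectation(1)
    by (intro Bochner_Integration.integral_sum) (simp add: compositions_def)
  then show ?thesis unfolding annealed_mass_def using qweight_expectation(2)
    by (simp add: compositions_def)
qed

lemma path_sum_ge_qweight:
  assumes "xs \<in> compositions n" shows "qweight h xs x \<le> path_sum h (compositions n) x"
  unfolding path_sum_def using assms qweight_pos[of _ h x]
  by (intro member_le_sum[where f = "\<lambda>xs. qweight h xs x"] finite_compositions) (auto simp: compositions_def less_imp_le)

lemma path_sum_pos: "path_sum h (compositions n) x > 0"
  unfolding path_sum_def by (intro sum_pos finite_compositions compositions_nonempty qweight_pos) (simp add: compositions_def)

lemma K_le_1: "n \<ge> 1 \<Longrightarrow> K n \<le> 1"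
proof -
  assume n: "n \<ge> 1"
  have "gap_prob [n] \<le> (\<Sum>xs\<in>compositions n. gap_prob xs)"
    using singleton_in_compositions[OF n] gap_prob_pos
    by (intro member_le_sum finite_compositions) (auto simp: compositions_def less_imp_le)
  also have "\<dots> \<le> 1" using compositions_le_1[of n] by (simp add: gap_prob_def)
  finally show ?thesis by (simp add: gap_prob_def)
qed

text \<open>
  Keeping only the path that jumps directly to \<open>n\<close> bounds \<open>ln Z\<close> from below by \<open>ln (K n)\<close> plus one disorder
  variable, which is \<open>o(n)\<close>. From above, \<open>ln Z\<close> is \<open>1/g\<close> times the logarithm of a variable with bounded
  expectation. Convergence in mean is immediate; almost sure convergence follows since the expectations
  of \<open>V n\<close> are summable.
\<close>
lemma free_energy_zero_if_fractional_moment_bounded: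
  assumes lnK: "(\<lambda>n. ln (K n) / real n) \<longlonglongrightarrow> 0" and g: "0 < g"
    and int: "\<And>N. integrable M (\<lambda>x. path_sum h (compositions N) x powr g)"
    and Ub: "\<And>N. expectation (\<lambda>x. path_sum h (compositions N) x powr g) \<le> Ub"
  shows "AE x in M. (\<lambda>n. ln (path_sum h (compositions n) x) / real n) \<longlonglongrightarrow> 0"
    and "\<And>n. n \<ge> 1 \<Longrightarrow> integrable M (\<lambda>x. ln (path_sum h (compositions n) x) / real n)"
    and "(\<lambda>n. LINT x|M. \<bar>ln (path_sum h (compositions n) x) / real n\<bar>) \<longlonglongrightarrow> 0"
proof -
  define Y where "Y n x = path_sum h (compositions n) x powr g" for n x
  have Y0: "Y n x > 0" for n x using path_sum_pos[of h n x] by (simp add: Y_def)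
  have lnY: "ln (path_sum h (compositions n) x) = ln (Y n x) / g" for n x
    using path_sum_pos[of h n x] g by (simp add: Y_def ln_powr)
  have lower: "- (\<bar>ln (K n)\<bar> + \<beta> * \<bar>\<omega> (int n) x\<bar> + \<bar>h\<bar>) \<le> ln (path_sum h (compositions n) x)" if n: "n \<ge> 1" for n x
  proof -
    have "ln (qweight h [n] x) \<le> ln (path_sum h (compositions n) x)"
      using path_sum_ge_qweight[OF singleton_in_compositions[OF n]] qweight_pos[of "[n]" h x] n by (intro ln_mono) auto
    moreover have "ln (qweight h [n] x) = ln (K n) + (\<beta> * \<omega> (int n) x + h)"
      using K_pos[OF n] by (simp add: qweight_def gap_prob_def ln_mult)
    moreover have "- (\<beta> * \<bar>\<omega> (int n) x\<bar>) \<le> \<beta> * \<omega> (int n) x"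
      using beta_pos by (metis abs_ge_minus_self abs_mult abs_of_pos minus_le_iff)
    ultimately show ?thesis by linarith
  qed
  have bound: "\<bar>ln (path_sum h (compositions n) x)\<bar> \<le> \<bar>ln (K n)\<bar> + \<beta> * \<bar>\<omega> (int n) x\<bar> + \<bar>h\<bar> + max 0 (ln (Y n x)) / g"
    if n: "n \<ge> 1" for n x
  proof -
    have "0 \<le> max 0 (ln (Y n x)) / g" using g by simp
    moreover have "ln (path_sum h (compositions n) x) \<le> max 0 (ln (Y n x)) / g"
      unfolding lnY using g by (simp add: divide_right_mono)
    moreover have "0 \<le> \<beta> * \<bar>\<omega> (int n) x\<bar>" using beta_pos by simp
    ultimately show ?thesis using lower[OF n, of x] by linarith
  qed
  define G where "G n x = (\<bar>ln (K n)\<bar> + \<beta> * (1 + (\<omega> (int n) x)\<^sup>2) + \<bar>h\<bar> + Y n x / g) / real n" for n x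
  have le_G: "\<bar>ln (path_sum h (compositions n) x) / real n\<bar> \<le> G n x" if n: "n \<ge> 1" for n x
  proof -
    have "max 0 (ln (Y n x)) \<le> Y n x" using ln_le_minus_one[OF Y0[of n x]] Y0[of n x] by simp
    then have "max 0 (ln (Y n x)) / g \<le> Y n x / g" using g by (simp add: divide_right_mono)
    moreover have "\<bar>\<omega> (int n) x\<bar> \<le> 1 + (\<omega> (int n) x)\<^sup>2"
    proof -
      have "0 \<le> (\<bar>\<omega> (int n) x\<bar> - 1)\<^sup>2" by simp
      then have "2 * \<bar>\<omega> (int n) x\<bar> \<le> 1 + (\<omega> (int n) x)\<^sup>2" by (simp add: power2_eq_square algebra_simps)
      then show ?thesis by simp
    qed
    then have "\<beta> * \<bar>\<omega> (int n) x\<bar> \<le> \<beta> * (1 + (\<omega> (int n) x)\<^sup>2)" using beta_pos by (intro mult_left_mono) auto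
    ultimately have "\<bar>ln (path_sum h (compositions n) x)\<bar> \<le> \<bar>ln (K n)\<bar> + \<beta> * (1 + (\<omega> (int n) x)\<^sup>2) + \<bar>h\<bar> + Y n x / g"
      using bound[OF n, of x] by linarith
    then show ?thesis by (simp add: G_def divide_right_mono)
  qed
  have Yint: "integrable M (Y n)" for n unfolding Y_def[abs_def] by (rule int)
  have G_int: "integrable M (G n)" for n
    unfolding G_def[abs_def] using Yint omega_sq_integrable by auto
  have EG: "expectation (G n) \<le> (\<bar>ln (K n)\<bar> + 2 * \<beta> + \<bar>h\<bar> + Ub / g) / real n" for n
  proof -
    have "expectation (G n) = (\<bar>ln (K n)\<bar> + \<beta> * 2 + \<bar>h\<bar> + expectation (Y n) / g) / real n"
      unfolding G_def[abs_def] using Yint omega_sq_integrable by (simp add: prob_space omega_var)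
    also have "\<dots> \<le> (\<bar>ln (K n)\<bar> + \<beta> * 2 + \<bar>h\<bar> + Ub / g) / real n"
      using Ub[of n] g by (intro divide_right_mono add_left_mono) (auto simp: Y_def[abs_def])
    finally show ?thesis by (simp add: mult.commute)
  qed
  show i: "integrable M (\<lambda>x. ln (path_sum h (compositions n) x) / real n)" if "n \<ge> 1" for n
    by (rule Bochner_Integration.integrable_bound[OF G_int[of n]])
      (use le_G[OF that] in \<open>auto intro!: AE_I2 intro: order_trans[OF _ abs_ge_self]\<close>)
  have lnK': "(\<lambda>n. \<bar>ln (K n)\<bar> / real n) \<longlonglongrightarrow> 0"
    using tendsto_rabs[OF lnK] by simp
  have cn: "(\<lambda>n. c / real n) \<longlonglongrightarrow> 0" for c :: real by (rule lim_const_over_n)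
  have lim: "(\<lambda>n. (\<bar>ln (K n)\<bar> + 2 * \<beta> + \<bar>h\<bar> + Ub / g) / real n) \<longlonglongrightarrow> 0"
    using tendsto_add[OF lnK' cn[of "2 * \<beta> + \<bar>h\<bar> + Ub / g"]] by (simp add: add_divide_distrib[symmetric] add.assoc)
  show "(\<lambda>n. LINT x|M. \<bar>ln (path_sum h (compositions n) x) / real n\<bar>) \<longlonglongrightarrow> 0"
  proof (rule tendsto_sandwich[OF _ _ tendsto_const lim])
    show "eventually (\<lambda>n. (LINT x|M. \<bar>ln (path_sum h (compositions n) x) / real n\<bar>)
        \<le> (\<bar>ln (K n)\<bar> + 2 * \<beta> + \<bar>h\<bar> + Ub / g) / real n) sequentially"
      using eventually_ge_at_top[of 1]
    proof eventually_elim
      case (elim n)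
      have "(LINT x|M. \<bar>ln (path_sum h (compositions n) x) / real n\<bar>) \<le> expectation (G n)"
        by (rule integral_mono[OF integrable_abs[OF i[OF elim]] G_int le_G[OF elim]])
      then show ?case using EG[of n] by linarith
    qed
  qed (auto intro!: always_eventually integral_nonneg_AE)
  \<comment> \<open>Controls the disorder at \<open>n\<close> and the fractional moment together; the factor \<open>1/n\<^sup>2\<close> makes it summable.\<close>
  define V where "V n x = ((\<omega> (int n) x)\<^sup>2 + Y n x) / (real n)\<^sup>2" for n x
  have Vint: "integrable M (V n)" for n
    unfolding V_def[abs_def] using Yint omega_sq_integrable by auto
  have V0: "V n x \<ge> 0" for n x unfolding V_def using Y0[of n x] by simp
  have EV: "expectation (V n) \<le> (1 + Ub) * (1 / (real n)\<^sup>2)" for n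
  proof -
    have "expectation (V n) = (1 + expectation (Y n)) / (real n)\<^sup>2"
      unfolding V_def[abs_def] using Yint omega_sq_integrable by (simp add: omega_var)
    also have "\<dots> \<le> (1 + Ub) / (real n)\<^sup>2"
      using Ub[of n] by (intro divide_right_mono add_left_mono) (auto simp: Y_def[abs_def])
    finally show ?thesis by simp
  qed
  have "summable (\<lambda>n. (1 + Ub) * (1 / (real n)\<^sup>2))"
    using inverse_power_summable[of 2, where 'a = real] by (intro summable_mult) (simp add: inverse_eq_divide)
  then have "summable (\<lambda>n. expectation (V n))"
    by (rule summable_comparison_test'[where N = 0]) (use EV V0 in \<open>auto simp: abs_of_nonneg integral_nonneg_AE\<close>)
  then have "AE x in M. (\<lambda>n. V n x) \<longlonglongrightarrow> 0"
    by (intro AE_tendsto_0_of_summable_expectation Vint V0)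
  then show "AE x in M. (\<lambda>n. ln (path_sum h (compositions n) x) / real n) \<longlonglongrightarrow> 0"
  proof eventually_elim
    case (elim x)
    have w: "(\<lambda>n. \<bar>\<omega> (int n) x\<bar> / real n) \<longlonglongrightarrow> 0"
    proof -
      have "(\<lambda>n. sqrt (V n x)) \<longlonglongrightarrow> sqrt 0" by (intro tendsto_intros elim)
      then have sq: "(\<lambda>n. sqrt (V n x)) \<longlonglongrightarrow> 0" by simp
      show ?thesis
      proof (rule tendsto_sandwich[OF _ _ tendsto_const sq])
        have "\<bar>\<omega> (int n) x\<bar> / real n \<le> sqrt (V n x)" for n
        proof -
          have "\<bar>\<omega> (int n) x\<bar> / real n = sqrt ((\<omega> (int n) x)\<^sup>2 / (real n)\<^sup>2)" by (simp add: real_sqrt_divide)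
          also have "\<dots> \<le> sqrt (V n x)"
            unfolding V_def using Y0[of n x] by (intro real_sqrt_le_mono divide_right_mono) auto
          finally show ?thesis .
        qed
        then show "eventually (\<lambda>n. \<bar>\<omega> (int n) x\<bar> / real n \<le> sqrt (V n x)) sequentially" by simp
      qed auto
    qed
    have "eventually (\<lambda>n. V n x < 1) sequentially" using order_tendstoD(2)[OF elim, of 1] by simp
    then have ev: "eventually (\<lambda>n. \<bar>ln (path_sum h (compositions n) x) / real n\<bar> \<le> \<bar>ln (K n)\<bar> / real n + \<beta> * (\<bar>\<omega> (int n) x\<bar> / real n)
        + \<bar>h\<bar> / real n + 2 / g * (ln (real n) / real n)) sequentially"
      using eventually_ge_at_top[of 1]
    proof eventually_elim
      case (elim n)
      have "(\<omega> (int n) x)\<^sup>2 + Y n x < (real n)\<^sup>2" using elim by (simp add: V_def divide_less_eq)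
      then have "Y n x \<le> (real n)\<^sup>2" by (smt (verit) zero_le_power2)
      then have "ln (Y n x) \<le> ln ((real n)\<^sup>2)" using Y0[of n x] by (intro ln_mono) auto
      also have "\<dots> = 2 * ln (real n)" using elim by (simp add: ln_realpow)
      finally have "max 0 (ln (Y n x)) / g \<le> 2 * ln (real n) / g"
        using elim g by (intro divide_right_mono) auto
      then have "\<bar>ln (path_sum h (compositions n) x)\<bar> \<le> \<bar>ln (K n)\<bar> + \<beta> * \<bar>\<omega> (int n) x\<bar> + \<bar>h\<bar> + 2 * ln (real n) / g"
        using bound[OF elim(2), of x] by linarith
      then have "\<bar>ln (path_sum h (compositions n) x)\<bar> / real n \<le> (\<bar>ln (K n)\<bar> + \<beta> * \<bar>\<omega> (int n) x\<bar> + \<bar>h\<bar> + 2 * ln (real n) / g) / real n"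
        by (intro divide_right_mono) auto
      then show ?case by (simp add: add_divide_distrib mult.commute)
    qed
    have "(\<lambda>n. \<bar>ln (K n)\<bar> / real n + \<beta> * (\<bar>\<omega> (int n) x\<bar> / real n) + \<bar>h\<bar> / real n + 2 / g * (ln (real n) / real n))
        \<longlonglongrightarrow> 0 + \<beta> * 0 + 0 + 2 / g * 0"
      by (intro tendsto_intros lnK' w cn lim_ln_over_n)
    then have "(\<lambda>n. \<bar>ln (K n)\<bar> / real n + \<beta> * (\<bar>\<omega> (int n) x\<bar> / real n) + \<bar>h\<bar> / real n + 2 / g * (ln (real n) / real n))
        \<longlonglongrightarrow> 0" by simp
    then have "(\<lambda>n. \<bar>ln (path_sum h (compositions n) x) / real n\<bar>) \<longlonglongrightarrow> 0"
      by (intro tendsto_sandwich[OF _ ev tendsto_const]) auto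
    then show ?case by (rule tendsto_rabs_zero_cancel)
  qed
qed

text \<open>
  Keep only the path that visits every site, and average: the disorder has mean \<open>0\<close>.
\<close>
lemma h_le_if_free_energy_zero:
  assumes int: "\<And>n. n \<ge> 1 \<Longrightarrow> integrable M (\<lambda>x. ln (path_sum h (compositions n) x) / real n)"
    and L1: "(\<lambda>n. LINT x|M. \<bar>ln (path_sum h (compositions n) x) / real n\<bar>) \<longlonglongrightarrow> 0"
  shows "h \<le> - ln (K 1)"
proof -
  have "ln (K 1) + h \<le> (LINT x|M. \<bar>ln (path_sum h (compositions n) x) / real n\<bar>)" if n: "n \<ge> 1" for n
  proof -
    define xs where "xs = replicate n (1::nat)"
    have xs: "xs \<in> compositions n" "0 \<notin> set xs" "length xs = n" by (auto simp: xs_def compositions_def sum_list_replicate)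
    have kx: "gap_prob xs = K 1 ^ n" by (simp add: gap_prob_def xs_def prod_list_replicate)
    have pt: "real n * ln (K 1) + (\<Sum>i\<in>points 0 xs. \<beta> * \<omega> i x + h) \<le> real n * (ln (path_sum h (compositions n) x) / real n)" for x
    proof -
      have "ln (qweight h xs x) \<le> ln (path_sum h (compositions n) x)"
        using path_sum_ge_qweight[OF xs(1)] qweight_pos[OF xs(2)] by (intro ln_mono) auto
      moreover have "ln (qweight h xs x) = real n * ln (K 1) + (\<Sum>i\<in>points 0 xs. \<beta> * \<omega> i x + h)"
        using K_pos[of 1] by (simp add: qweight_def kx ln_mult ln_realpow)
      ultimately show ?thesis using n by simp
    qed
    have ei: "integrable M (\<lambda>x. real n * ln (K 1) + (\<Sum>i\<in>points 0 xs. \<beta> * \<omega> i x + h))"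
      using omega_integrable by auto
    have "real n * (ln (K 1) + h) = expectation (\<lambda>x. real n * ln (K 1) + (\<Sum>i\<in>points 0 xs. \<beta> * \<omega> i x + h))"
      using omega_integrable
      by (simp add: Bochner_Integration.integral_sum omega_mean prob_space card_points_eq[OF xs(2)] xs(3) algebra_simps)
    also have "\<dots> \<le> expectation (\<lambda>x. real n * (ln (path_sum h (compositions n) x) / real n))"
      by (rule integral_mono[OF ei integrable_mult_right[OF int[OF n]] pt])
    also have "\<dots> = real n * expectation (\<lambda>x. ln (path_sum h (compositions n) x) / real n)" by simp
    finally have "ln (K 1) + h \<le> expectation (\<lambda>x. ln (path_sum h (compositions n) x) / real n)"
      using n by (subst (asm) mult_le_cancel_left_pos) auto
    also have "\<dots> \<le> (LINT x|M. \<bar>ln (path_sum h (compositions n) x) / real n\<bar>)"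
      by (rule integral_mono[OF int[OF n] integrable_abs[OF int[OF n]] abs_ge_self])
    finally show ?thesis .
  qed
  then have "ln (K 1) + h \<le> 0"
    by (intro tendsto_lowerbound[OF L1]) (auto simp: eventually_sequentially)
  then show ?thesis by simp
qed

text \<open>
  For this \<open>h\<close> the pinning reward is cancelled by the largest possible interaction per point, so
  weights are at most the renewal probabilities; the direct jump to \<open>n\<close> gives the lower bound. It follows
  that the supremum defining the annealed critical point is over a nonempty set.
\<close>
lemma annealed_zero_at_low_h:
  assumes lnK: "(\<lambda>n. ln (K n) / real n) \<longlonglongrightarrow> 0"
  shows "(\<lambda>n. ln (annealed_mass (- (\<beta>\<^sup>2 / 2 * (2 * real q + 1))) n) / real n) \<longlonglongrightarrow> 0"
proof -
  define h where "h = - (\<beta>\<^sup>2 / 2 * (2 * real q + 1))"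
  have up: "annealed_mass h n \<le> 1" for n
  proof -
    have "weight h xs \<le> gap_prob xs" if "xs \<in> compositions n" for xs
    proof -
      have x0: "0 \<notin> set xs" using that by (simp add: compositions_def)
      have "cov_mass (points 0 xs) \<le> (2 * real q + 1) * real (length xs)"
        using cov_mass_le[OF finite_points, of 0 xs] by (simp add: card_points_eq[OF x0])
      then have "\<beta>\<^sup>2 / 2 * cov_mass (points 0 xs) \<le> \<beta>\<^sup>2 / 2 * ((2 * real q + 1) * real (length xs))"
        by (intro mult_left_mono) auto
      then have "h * real (length xs) + \<beta>\<^sup>2 / 2 * cov_mass (points 0 xs) \<le> 0" by (simp add: h_def algebra_simps)
      then show ?thesis using gap_prob_pos[OF x0] by (simp add: weight_def mult_le_cancel_left2)
    qed
    then have "annealed_mass h n \<le> (\<Sum>xs\<in>compositions n. gap_prob xs)" unfolding annealed_mass_def by (rule sum_mono)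
    then show ?thesis using compositions_le_1[of n] by (simp add: gap_prob_def)
  qed
  have lo: "ln (K n) + (h + \<beta>\<^sup>2 / 2) \<le> ln (annealed_mass h n)" if n: "n \<ge> 1" for n
  proof -
    have "weight h [n] \<le> annealed_mass h n" unfolding annealed_mass_def using singleton_in_compositions[OF n] weight_pos
      by (intro member_le_sum finite_compositions) (auto simp: compositions_def less_imp_le)
    then have "ln (weight h [n]) \<le> ln (annealed_mass h n)" using weight_pos[of "[n]" h] n by (intro ln_mono) auto
    then show ?thesis using K_pos[OF n] by (simp add: weight_singleton ln_mult)
  qed
  have "(\<lambda>n. ln (K n) / real n + (h + \<beta>\<^sup>2 / 2) / real n) \<longlonglongrightarrow> 0 + 0"
    by (intro tendsto_add lnK lim_const_over_n)
  then have l: "(\<lambda>n. ln (K n) / real n + (h + \<beta>\<^sup>2 / 2) / real n) \<longlonglongrightarrow> 0" by simp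
  have "(\<lambda>n. ln (annealed_mass h n) / real n) \<longlonglongrightarrow> 0"
  proof (rule tendsto_sandwich[OF _ _ l tendsto_const])
    show "eventually (\<lambda>n. ln (K n) / real n + (h + \<beta>\<^sup>2 / 2) / real n \<le> ln (annealed_mass h n) / real n) sequentially"
      using eventually_ge_at_top[of 1]
      by eventually_elim (use lo in \<open>simp add: add_divide_distrib[symmetric] divide_right_mono\<close>)
    show "eventually (\<lambda>n. ln (annealed_mass h n) / real n \<le> 0) sequentially"
      using up annealed_mass_pos by (auto intro!: always_eventually divide_nonpos_nonneg simp: ln_le_zero_iff)
  qed
  then show ?thesis by (simp add: h_def)
qed

lemma annealed_h_le:
  assumes "(\<lambda>n. ln (annealed_mass h n) / real n) \<longlonglongrightarrow> 0"
  shows "h \<le> ln (split_const / K (2 * q + 1)) - \<beta>\<^sup>2 / 2"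
proof -
  have "(\<Sum>xs\<in>{[2 * q + 1]}. weight h xs) \<le> split_const"
    by (rule renewal_mass_le[OF assms, where b = 1]) (auto simp: ends_long_def long_gaps_def)
  then have "exp (h + \<beta>\<^sup>2 / 2) \<le> split_const / K (2 * q + 1)"
    using K_pos[of "2 * q + 1"] by (simp add: weight_singleton field_simps)
  then have "h + \<beta>\<^sup>2 / 2 \<le> ln (split_const / K (2 * q + 1))"
    using K_pos[of "2 * q + 1"] split_const_ge_1 by (subst ln_ge_iff) auto
  then show ?thesis by simp
qed

end

theorem theorem2p2:
  fixes P :: "'a measure" and \<tau> :: "nat \<Rightarrow> 'a \<Rightarrow> nat"
    and M :: "'b measure" and \<omega> :: "int \<Rightarrow> 'b \<Rightarrow> real"
    and L :: "real \<Rightarrow> real" and \<alpha> \<beta> :: real and q :: nat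
  assumes "slowly_varying L"
    and "recurrent_renewal_process P \<tau> (\<lambda>n. L (real n) * real n powr (-(1 + \<alpha>)))"
    and "stationary_gaussian_process M \<omega>"
    and "prob_space.expectation M (\<omega> 0) = 0"
    and "prob_space.variance M (\<omega> 0) = 1"
    and "q \<ge> 1"
    and "\<And>n::int. n > int q \<Longrightarrow> covariance M (\<omega> 0) (\<omega> n) = 0"
    and "1/2 < \<alpha>" and "\<alpha> < 1"
    and "\<beta> > 0"
  shows "quenched_critical_point P \<tau> M \<omega> \<beta> > annealed_critical_point P \<tau> M \<omega> \<beta>"
proof -
  define K where "K n = L (real n) * real n powr (-(1 + \<alpha>))" for n :: nat
  obtain q' where gd: "gaussian_disorder M \<omega> (\<lambda>n. covariance M (\<omega> 0) (\<omega> n)) q'"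
    using gaussian_disorderI[OF assms(3-5,7)] by blast
  interpret R: recurrent_renewal_process P \<tau> K
    using assms(2) by (simp add: K_def[abs_def])
  interpret gaussian_disorder M \<omega> "\<lambda>n. covariance M (\<omega> 0) (\<omega> n)" q' by (rule gd)
  have Lpos: "L x > 0" if "x > 0" for x using assms(1) that by (simp add: slowly_varying_def)
  interpret pinning_model M \<omega> "\<lambda>n. covariance M (\<omega> 0) (\<omega> n)" q' K \<beta>
    by unfold_locales (use Lpos assms R.sum_compositions_prod_le_1 in \<open>auto simp: K_def\<close>)
  have Zq: "quenched_Z P \<tau> \<beta> h (\<lambda>k. \<omega> k x) n = path_sum h (compositions n) x" for h x n
    by (simp add: R.quenched_Z_eq path_sum_def qweight_def gap_prob_def)
  have Zan: "annealed_Z P \<tau> M \<omega> \<beta> h n = annealed_mass h n" for h n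
    using expectation_path_sum[of h n] by (simp add: annealed_Z_def Zq)
  define A where "A = {h. has_annealed_free_energy P \<tau> M \<omega> \<beta> h 0}"
  define Qs where "Qs = {h. has_quenched_free_energy P \<tau> M \<omega> \<beta> h 0}"
  have A: "h \<in> A \<longleftrightarrow> (\<lambda>n. ln (annealed_mass h n) / real n) \<longlonglongrightarrow> 0" for h
    by (simp add: A_def has_annealed_free_energy_def Zan)
  have Qs: "h \<in> Qs \<longleftrightarrow> (AE x in M. (\<lambda>n. ln (path_sum h (compositions n) x) / real n) \<longlonglongrightarrow> 0) \<and>
       (\<forall>n\<ge>1. integrable M (\<lambda>x. ln (path_sum h (compositions n) x) / real n)) \<and>
       (\<lambda>n. LINT x|M. \<bar>ln (path_sum h (compositions n) x) / real n\<bar>) \<longlonglongrightarrow> 0" for h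
    by (simp add: Qs_def has_quenched_free_energy_def Zq Let_def)
  have lnK: "(\<lambda>n. ln (K n) / real n) \<longlonglongrightarrow> 0"
  proof -
    obtain c where c: "c > 0" "\<And>n::nat. n \<ge> 1 \<Longrightarrow> L (real n) \<ge> c * real n powr (-1)"
      using slowly_varying_ge_powr[OF assms(1), of 1] by auto
    have up: "eventually (\<lambda>n. ln (K n) / real n \<le> 0) sequentially"
      using eventually_ge_at_top[of 1]
      by eventually_elim (use K_le_1 K_pos in \<open>auto intro!: divide_nonpos_nonneg simp: ln_le_zero_iff\<close>)
    have lo: "eventually (\<lambda>n. ln c / real n - (2 + \<alpha>) * (ln (real n) / real n) \<le> ln (K n) / real n) sequentially"
      using eventually_ge_at_top[of 1]
    proof eventually_elim
      case (elim n)
      have e: "-(2 + \<alpha>) = -1 + -(1 + \<alpha>)" by simp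
      have "c * real n powr (-(2 + \<alpha>)) = c * real n powr (-1) * real n powr (-(1 + \<alpha>))"
        by (simp only: e powr_add mult.assoc)
      also have "\<dots> \<le> K n" unfolding K_def using c(2)[OF elim] by (intro mult_right_mono) auto
      finally have "ln (c * real n powr (-(2 + \<alpha>))) \<le> ln (K n)"
        using c elim by (intro ln_mono) auto
      moreover have "ln (c * real n powr (-(2 + \<alpha>))) = ln c + (-(2 + \<alpha>)) * ln (real n)"
        using c elim by (simp add: ln_mult ln_powr)
      ultimately have "ln c - (2 + \<alpha>) * ln (real n) \<le> ln (K n)"
        by (simp only: mult_minus_left)
      then have "(ln c - (2 + \<alpha>) * ln (real n)) / real n \<le> ln (K n) / real n"
        by (intro divide_right_mono) auto
      then show ?case by (simp add: diff_divide_distrib)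
    qed
    have "(\<lambda>n. ln c / real n - (2 + \<alpha>) * (ln (real n) / real n)) \<longlonglongrightarrow> 0 - (2 + \<alpha>) * 0"
      by (intro tendsto_intros lim_const_over_n lim_ln_over_n)
    then have "(\<lambda>n. ln c / real n - (2 + \<alpha>) * (ln (real n) / real n)) \<longlonglongrightarrow> 0" by simp
    then show ?thesis by (intro tendsto_sandwich[OF lo up _ tendsto_const])
  qed
  have A_ne: "A \<noteq> {}" using annealed_zero_at_low_h[OF lnK] A by blast
  have A_bdd: "bdd_above A" using annealed_h_le A by (intro bdd_aboveI) blast
  have crit: "subcritical_mass (Sup A)"
    unfolding subcritical_mass_def using renewal_mass_le_Sup[OF A_ne A_bdd] A by blast
  have KU: "\<exists>C>0. \<forall>d\<ge>1. K d \<le> C * real d powr (e - (1 + \<alpha>))" if e: "e > 0" for e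
  proof -
    obtain C where C: "C > 0" "\<And>n::nat. n \<ge> 1 \<Longrightarrow> L (real n) \<le> C * real n powr e"
      using slowly_varying_le_powr[OF assms(1) e] by blast
    have "K d \<le> C * real d powr (e - (1 + \<alpha>))" if "d \<ge> 1" for d
    proof -
      have "K d \<le> C * real d powr e * real d powr (-(1 + \<alpha>))"
        unfolding K_def using C(2)[OF that] by (intro mult_right_mono) auto
      also have "\<dots> = C * (real d powr e * real d powr (-(1 + \<alpha>)))" by simp
      also have "real d powr e * real d powr (-(1 + \<alpha>)) = real d powr (e - (1 + \<alpha>))"
        by (simp add: powr_add[symmetric] algebra_simps)
      finally show ?thesis .
    qed
    then show ?thesis using C by blast
  qed
  obtain h n Ub where h: "h > Sup A" and n: "n \<ge> (1::nat)"
    and B: "\<And>N. integrable M (\<lambda>x. path_sum h (compositions N) x powr (real n / (real n + 1)))"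
      "\<And>N. expectation (\<lambda>x. path_sum h (compositions N) x powr (real n / (real n + 1))) \<le> Ub"
    using bounded_fractional_moment[OF crit KU assms(8,9)] by blast
  have g: "0 < real n / (real n + 1)" using n by simp
  have "h \<in> Qs"
    unfolding Qs using free_energy_zero_if_fractional_moment_bounded[OF lnK g B] by blast
  moreover have "bdd_above Qs"
    using h_le_if_free_energy_zero Qs by (intro bdd_aboveI) blast
  ultimately have "h \<le> Sup Qs" by (rule cSup_upper)
  then show ?thesis
    using h by (simp add: quenched_critical_point_def annealed_critical_point_def A_def Qs_def)
qed

end
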